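(* Let $n\ge1$, $i\in\{1,\ldots,n\}$, $k\in\mathbb{N}$ and $j_1,\ldots,j_k\in\{1,\ldots,n\}$. Then $$x_{j_k}^-(z)_\bullet\cdots{}_\bullet x_{j_2}^-(z)_\bullet x_{j_1}^-(z)_\bullet\mathcal{Y}_i(z)\neq0\quad\text{if and only if}\quad f_{j_k}\cdots f_{j_2}f_{j_1}v_{\lambda_i}\neq0.$$
   Context: **Notation.** $n\ge1$ is an integer, $q$ an indeterminate, $F=\mathbb{C}(q^{1/2})$, $[m]=\frac{q^m-q^{-m}}{q-q^{-1}}$. $(a_{ij})_{i,j=1}^n$ is the Cartan matrix of type $A_n$; $\alpha_1,\ldots,\alpha_n$ and $\lambda_1,\ldots,\lambda_n$ are the simple roots and fundamental weights of $\mathfrak{sl}_{n+1}$; $Q=\bigoplus\mathbb{Z}\alpha_i\subset P=\bigoplus\mathbb{Z}\lambda_i$; $(\cdot,\cdot)$ is the symmetric bilinear form with $(\alpha_i,\alpha_j)=a_{ij}$, $(\lambda_i,\alpha_j)=\delta_{ij}$. **The space $V$.** $K(1)$ is the symmetric algebra over $F$ on the symbols $a_i(-r)$, $1\le i\le n$, $r\in\mathbb{Z}_{>0}$; $a_i(-r)$ acts by multiplication and $a_i(r)$, $r>0$, acts as the derivation annihilating $1$ such that $[a_i(r),a_j(s)]=\delta_{r+s,0}\frac{[a_{ij}r][r]}{r}$ for all $r,s\in\mathbb{Z}\setminus\{0\}$. $\mathbb{C}\{P\}$ is the (twisted group) algebra, with scalars in $F$, generated by the invertible elements $e^{\alpha_2},\ldots,e^{\alpha_n},e^{\lambda_n}$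 with relations $e^{\alpha_i}e^{\alpha_j}=(-1)^{(\alpha_i,\alpha_j)}e^{\alpha_j}e^{\alpha_i}$, $e^{\alpha_i}e^{\lambda_n}=(-1)^{\delta_{in}}e^{\lambda_n}e^{\alpha_i}$ ($2\le i,j\le n$). For $\alpha=m_2\alpha_2+\cdots+m_n\alpha_n+m_{n+1}\lambda_n\in P$ put $e^\alpha=(e^{\alpha_2})^{m_2}\cdots(e^{\alpha_n})^{m_n}(e^{\lambda_n})^{m_{n+1}}$. Let $V=K(1)\otimes\mathbb{C}\{P\}$, $1=1\otimes e^0\in V$. The $e^\alpha$ act by left multiplication on $\mathbb{C}\{P\}$; $z^{\partial_\alpha}e^\beta=z^{(\alpha,\beta)}e^\beta$; $(-1)^{m\partial_\alpha}e^\beta=(-1)^{m(\alpha,\beta)}e^\beta$ with $(-1)^s=e^{\pi\sqrt{-1}s}$. **Operators.** For $j=1,\ldots,n$: $$x_j^\pm(z)=\exp\Big(\pm\sum_{r\ge1}\tfrac{q^{\mp r/2}}{[r]}a_j(-r)z^r\Big)\exp\Big(\mp\sum_{r\ge1}\tfrac{q^{\mp r/2}}{[r]}a_j(r)z^{-r}\Big)\otimes e^{\pm\alpha_j}z^{\pm\partial_{\alpha_j}}\in\mathrm{Hom}(V,V((z))).$$ For $l\ne0$ let $a_i^*(l)=\sum_{j=1}^n m_i^{(j)}a_j(l)$ with $m_i^{(j)}=\frac{[jl][(n-i+1)l]}{[(n+1)l][l]}$ if $j\le i$ and $m_i^{(j)}=\frac{[il][(n-j+1)l]}{[(n+1)l][l]}$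 if $j>i$. For $i=1,\ldots,n$, $$\mathcal{Y}_i(z)=\exp\Big(\sum_{r\ge1}\tfrac{q^{r/2}}{[r]}a_i^*(-r)z^r\Big)\exp\Big(-\sum_{r\ge1}\tfrac{q^{r/2}}{[r]}a_i^*(r)z^{-r}\Big)\otimes e^{\lambda_i}(-1)^{(1-\delta_{in})i\,\partial_{\lambda_n}}z^{\partial_{\lambda_i}}\in\mathrm{Hom}(V,V((z^{1/(n+1)}))).$$ **Products.** A pair $(a(z),b(z))$, $a(z)\in\mathrm{Hom}(V,V((z)))$, $b(z)\in\mathrm{Hom}(V,V((z^{1/(n+1)})))$, is quasi compatible if there is a nonzero polynomial $p(z_1,z_2)\in F[z_1,z_2]$ with $p(z_1,z_2)a(z_1)b(z_2)\in\mathrm{Hom}(V,V((z_1,z_2^{1/(n+1)})))$. For such a pair, the products $a(z)_rb(z)$, $r\in\mathbb{Z}$, are defined by $$\sum_{r\in\mathbb{Z}}(a(z)_rb(z))z_0^{-r-1}=\iota_{z,z_0}\big(p(z_0+z,z)^{-1}\big)\,\big(p(z_1,z)a(z_1)b(z)\big)\big|_{z_1=z+z_0},$$ where $\iota_{z,z_0}$ expands in $F((z))((z_0))$ (i.e. in nonnegative powers of $z_0$ up to a finite pole), and $z_1=z+z_0$ is likewise expanded in nonnegative powers of $z_0$; this is independent of $p$. For $c(z)\in\mathrm{Hom}(V,V((z^{1/(n+1)})))$ write $\mathrm{wt}\,c(z)=\alpha\in P$ if $c(z)1=d(z)\otimes e^\alpha$ for some $d(z)\in K(1)((z^{1/(n+1)}))$;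 e.g. $\mathrm{wt}\,x_j^\pm(z)=\pm\alpha_j$, $\mathrm{wt}\,\mathcal{Y}_i(z)=\lambda_i$. For a quasi compatible pair define $$a(z)_\bullet b(z)=\sum_{t\in\frac12\mathbb{Z}}\Big(\frac{1}{zq^t}\Big)^{(\mathrm{wt}\,a(z),\mathrm{wt}\,b(z))+1}q^t\,a(zq^t)_0b(z)$$ (a finite sum; $a(zq^t)_0b(z)$ is the zeroth product of the operators $a(zq^t)$ and $b(z)$; the product with $b(z)=0$ is $0$). Iterated products are nested from the right: $a_1(z)_\bullet a_2(z)_\bullet b(z)=a_1(z)_\bullet(a_2(z)_\bullet b(z))$. **$U_q(\mathfrak{sl}_{n+1})$.** The associative unital $F$-algebra generated by $e_i,f_i,K_i^{\pm1}$, $1\le i\le n$, with relations $K_iK_j=K_jK_i$, $K_iK_i^{-1}=K_i^{-1}K_i=1$, $K_ie_jK_i^{-1}=q^{(\alpha_i,\alpha_j)}e_j$, $K_if_jK_i^{-1}=q^{-(\alpha_i,\alpha_j)}f_j$, $[e_i,f_j]=\delta_{ij}\frac{K_i-K_i^{-1}}{q-q^{-1}}$, and the $q$-Serre relations $\sum_{s=0}^m(-1)^s\frac{[m]!}{[s]![m-s]!}y_i^{m-s}y_jy_i^s=0$ for $i\ne j$, $m=1-a_{ij}$, $y=e$ and $y=f$ (here $[0]!=1$, $[k]!=[k]\cdots[1]$). $L(\lambda_i)$ is the irreducible highest weight module of highest weight $\lambda_i$ (so $K_j v_{\lambda_i}=q^{\delta_{ij}}v_{\lambda_i}$, $e_jv_{\lambda_i}=0$),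 with highest weight vector $v_{\lambda_i}$. *)

theory Defs
  imports
    Complex_Main
    "HOL-Library.Poly_Mapping"
    "HOL-Computational_Algebra.Computational_Algebra"
begin

section \<open>The ground field and quantum integers\<close>

text \<open>The field \<open>F = \<complex>(q\<^sup>1\<^sup>/\<^sup>2)\<close> is the field of fractions of the polynomials in the
  indeterminate \<open>qh = q\<^sup>1\<^sup>/\<^sup>2\<close>.\<close>

type_synonym qf = "complex poly fract"

definition qconst :: "complex \<Rightarrow> qf" where
  "qconst c = Fract [:c:] 1"

definition qh :: qf where
  "qh = Fract [:0, 1:] 1"

definition qq :: qf where
  "qq = qh ^ 2"

definition qint :: "int \<Rightarrow> qf" where
  "qint m = (qq powi m - qq powi (- m)) / (qq - qq powi (- 1))"

definition qfact :: "nat \<Rightarrow> qf" where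
  "qfact k = (\<Prod>s = 1..k. qint (int s))"


section \<open>Root data of type A\<close>

text \<open>A weight \<open>\<Sum>\<^sub>i c\<^sub>i \<lambda>\<^sub>i\<close> is represented by its coefficients with respect to the fundamental weights.\<close>

type_synonym wt = "nat \<Rightarrow>\<^sub>0 int"

definition weight_lattice :: "nat \<Rightarrow> wt set" where
  "weight_lattice n = {\<alpha>. Poly_Mapping.keys \<alpha> \<subseteq> {1..n}}"

definition cartan :: "nat \<Rightarrow> nat \<Rightarrow> int" where
  "cartan i j = (if i = j then 2 else if i = Suc j \<or> j = Suc i then - 1 else 0)"

definition fund_weight :: "nat \<Rightarrow> wt" where
  "fund_weight i = Poly_Mapping.single i 1"

definition simple_root :: "nat \<Rightarrow> nat \<Rightarrow> wt" where
  "simple_root n i = (\<Sum>j = 1..n. Poly_Mapping.single j (cartan i j))"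

text \<open>The bilinear form on \<open>P\<close>, given by \<open>(\<lambda>\<^sub>i, \<lambda>\<^sub>j) = min i j (n + 1 - max i j) / (n + 1)\<close>, the
  inverse Cartan matrix; the characterising values are \<open>wform_root_root\<close> and \<open>wform_fund_root\<close> below.\<close>

definition wform :: "nat \<Rightarrow> wt \<Rightarrow> wt \<Rightarrow> rat" where
  "wform n \<alpha> \<beta> = (\<Sum>i = 1..n. \<Sum>j = 1..n.
     of_int (Poly_Mapping.lookup \<alpha> i) * of_int (Poly_Mapping.lookup \<beta> j) *
     (of_nat (min i j) * (of_nat (Suc n) - of_nat (max i j)) / of_nat (Suc n)))"


lemma sum_cartan:
  fixes h :: "nat \<Rightarrow> 'a::comm_ring_1"
  assumes j: "j \<in> {1..n}" and h0: "h 0 = 0" and hn: "h (Suc n) = 0"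
  shows "(\<Sum>l = 1..n. of_int (cartan j l) * h l) = 2 * h j - h (j - 1) - h (Suc j)"
proof -
  have "(\<Sum>l = 1..n. of_int (cartan j l) * h l) = (\<Sum>l = 0..Suc n. of_int (cartan j l) * h l)"
    using h0 hn by (simp add: sum.atLeast_Suc_atMost[of 0])
  also have "\<dots> = (\<Sum>l \<in> {j - 1, j, Suc j}. of_int (cartan j l) * h l)"
    by (rule sum.mono_neutral_right) (use j in \<open>auto simp: cartan_def\<close>)
  also have "\<dots> = 2 * h j - h (j - 1) - h (Suc j)"
  proof -
    obtain k where "j = Suc k" using j by (cases j) auto
    then show ?thesis by (simp add: cartan_def)
  qed
  finally show ?thesis .
qed

lemma cartan_sym: "cartan i j = cartan j i"
  by (auto simp: cartan_def)

lemma lookup_simple_root: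
  "Poly_Mapping.lookup (simple_root n i) j = (if j \<in> {1..n} then cartan i j else 0)"
  by (simp add: simple_root_def lookup_sum lookup_single when_def)

lemma lookup_fund_weight: "Poly_Mapping.lookup (fund_weight i) j = (if j = i then 1 else 0)"
  by (auto simp: fund_weight_def lookup_single when_def)

lemma wform_fund_root:
  assumes i: "i \<in> {1..n}" and j: "j \<in> {1..n}"
  shows "wform n (fund_weight i) (simple_root n j) = (if i = j then 1 else 0)"
proof -
  define h :: "nat \<Rightarrow> rat"
    where "h l = of_nat (min i l) * (of_nat (Suc n) - of_nat (max i l)) / of_nat (Suc n)" for l
  have hle: "h l = of_nat l * (1 - of_nat i / of_nat (Suc n))" if "l \<le> i" for l
    using that by (simp add: h_def max_absorb1 min_absorb2 diff_divide_distrib algebra_simps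
        del: of_nat_Suc)
  have hge: "h l = of_nat i * (1 - of_nat l / of_nat (Suc n))" if "l \<ge> i" for l
    using that by (simp add: h_def max_absorb2 min_absorb1 diff_divide_distrib algebra_simps
        del: of_nat_Suc)
  have "wform n (fund_weight i) (simple_root n j) =
      (\<Sum>k = 1..n. if k = i then \<Sum>l = 1..n. of_int (cartan j l) * h l else 0)"
    unfolding wform_def h_def
    by (rule sum.cong[OF refl]) (auto simp: lookup_simple_root lookup_fund_weight)
  also have "\<dots> = (\<Sum>l = 1..n. of_int (cartan j l) * h l)"
    using i by simp
  also have "\<dots> = 2 * h j - h (j - 1) - h (Suc j)"
    by (rule sum_cartan[OF j]) (use i in \<open>auto simp: h_def max_def\<close>)
  also have "\<dots> = (if i = j then 1 else 0)"
  proof -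
    obtain k where k: "j = Suc k" using j by (cases j) auto
    define N :: rat where "N = of_nat (Suc n)"
    have "N \<noteq> 0" unfolding N_def using of_nat_neq_0 by blast
    consider "i \<le> k" | "i = j" | "i \<ge> Suc j" using k by linarith
    then show ?thesis
      by cases (use k \<open>N \<noteq> 0\<close> in \<open>auto simp: hle hge N_def[symmetric] field_simps
        simp del: of_nat_Suc\<close>, (auto simp: field_simps)?)
  qed
  finally show ?thesis .
qed

lemma wform_root_root:
  assumes i: "i \<in> {1..n}" and j: "j \<in> {1..n}"
  shows "wform n (simple_root n i) (simple_root n j) = of_int (cartan i j)"
proof -
  have "wform n (simple_root n i) (simple_root n j) =
      (\<Sum>k = 1..n. of_int (cartan i k) * wform n (fund_weight k) (simple_root n j))"
  proof -
    have *: "wform n (fund_weight k) (simple_root n j) = (\<Sum>l = 1..n. of_int (cartan j l) *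
       (of_nat (min k l) * (of_nat (Suc n) - of_nat (max k l)) / of_nat (Suc n)))" if "k \<in> {1..n}" for k
    proof -
      have "wform n (fund_weight k) (simple_root n j) =
        (\<Sum>k' = 1..n. if k' = k then \<Sum>l = 1..n. of_int (cartan j l) *
         (of_nat (min k l) * (of_nat (Suc n) - of_nat (max k l)) / of_nat (Suc n)) else 0)"
        unfolding wform_def
        by (rule sum.cong[OF refl]) (auto simp: lookup_simple_root lookup_fund_weight)
      then show ?thesis using that by simp
    qed
    show ?thesis
      by (subst wform_def, rule sum.cong[OF refl], subst *, assumption)
         (simp add: lookup_simple_root sum_distrib_left mult.assoc)
  qed
  also have "\<dots> = (\<Sum>k = 1..n. if k = j then of_int (cartan i k) else 0)"
    by (rule sum.cong[OF refl]) (use j in \<open>auto simp: wform_fund_root\<close>)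
  also have "\<dots> = of_int (cartan i j)"
    using j by simp
  finally show ?thesis .
qed

lemma wform_sym: "wform n \<alpha> \<beta> = wform n \<beta> \<alpha>"
  unfolding wform_def
  by (subst sum.swap) (simp add: mult.commute min.commute max.commute)

lemma wform_add: "wform n (\<alpha> + \<alpha>') \<beta> = wform n \<alpha> \<beta> + wform n \<alpha>' \<beta>"
  by (simp add: wform_def lookup_add distrib_right sum.distrib add_divide_distrib del: of_nat_Suc)


section \<open>The space V\<close>

text \<open>The symmetric algebra \<open>K(1)\<close> is the polynomial algebra over \<open>F\<close> in the variables
  \<open>a\<^sub>i(-r)\<close>, indexed by the pairs \<open>(i, r)\<close>. The elements \<open>e\<^sup>\<alpha>\<close>, \<open>\<alpha> \<in> P\<close>, are a basis of \<open>\<complex>{P}\<close>, so an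
  element of \<open>V = K(1) \<otimes> \<complex>{P}\<close> is a finitely supported family of elements of \<open>K(1)\<close>, and
  \<open>single \<alpha> u\<close> is \<open>u \<otimes> e\<^sup>\<alpha>\<close>. The types do not depend on \<open>n\<close>; the actual spaces are
  the subsets \<open>Kspace n\<close> and \<open>Vspace n\<close>.\<close>

type_synonym mono = "(nat \<times> nat) \<Rightarrow>\<^sub>0 nat"
type_synonym kalg = "mono \<Rightarrow>\<^sub>0 qf"
type_synonym vsp = "wt \<Rightarrow>\<^sub>0 kalg"

definition Kspace :: "nat \<Rightarrow> kalg set" where
  "Kspace n = {u. \<forall>M \<in> Poly_Mapping.keys u. Poly_Mapping.keys M \<subseteq> {1..n} \<times> {1..}}"

definition Vspace :: "nat \<Rightarrow> vsp set" where
  "Vspace n = {v. Poly_Mapping.keys v \<subseteq> weight_lattice n \<and>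
     (\<forall>\<alpha>. Poly_Mapping.lookup v \<alpha> \<in> Kspace n)}"

definition vac :: vsp where
  "vac = Poly_Mapping.single 0 1"

definition kconst :: "qf \<Rightarrow> kalg" where
  "kconst c = Poly_Mapping.single 0 c"

definition vscale :: "qf \<Rightarrow> vsp \<Rightarrow> vsp" where
  "vscale c v = Poly_Mapping.map ((*) (kconst c)) v"

definition kpderiv :: "nat \<times> nat \<Rightarrow> kalg \<Rightarrow> kalg" where
  "kpderiv x u = (\<Sum>M \<in> Poly_Mapping.keys u.
     Poly_Mapping.single (M - Poly_Mapping.single x 1)
       (of_nat (Poly_Mapping.lookup M x) * Poly_Mapping.lookup u M))"

definition kvar :: "nat \<Rightarrow> nat \<Rightarrow> kalg" where
  "kvar i r = Poly_Mapping.single (Poly_Mapping.single (i, r) 1) 1"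

text \<open>The derivation \<open>a\<^sub>j(r)\<close> for \<open>r > 0\<close>, determined by its values on the variables \<open>a\<^sub>i(-s)\<close>.\<close>

definition kann :: "nat \<Rightarrow> nat \<Rightarrow> nat \<Rightarrow> kalg \<Rightarrow> kalg" where
  "kann n j r u = (\<Sum>i = 1..n.
     kconst (qint (cartan j i * int r) * qint (int r) / of_nat r) * kpderiv (i, r) u)"

definition heis :: "nat \<Rightarrow> nat \<Rightarrow> int \<Rightarrow> vsp \<Rightarrow> vsp" where
  "heis n j l v =
     (if l < 0 then Poly_Mapping.map ((*) (kvar j (nat (- l)))) v
      else Poly_Mapping.map (kann n j (nat l)) v)"

lemma kpderiv_lookup:
  "Poly_Mapping.lookup (kpderiv x u) M =
     of_nat (Poly_Mapping.lookup M x + 1) * Poly_Mapping.lookup u (M + Poly_Mapping.single x 1)"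
proof -
  let ?M = "M + Poly_Mapping.single x 1"
  have *: "N = ?M" if "N - Poly_Mapping.single x 1 = M" "Poly_Mapping.lookup N x \<noteq> 0" for N
  proof (rule poly_mapping_eqI)
    fix k
    have "Poly_Mapping.lookup M k = Poly_Mapping.lookup N k - (if k = x then 1 else 0)"
      using that(1) by (auto simp: lookup_minus lookup_single when_def)
    then show "Poly_Mapping.lookup N k = Poly_Mapping.lookup ?M k"
      using that(2) by (auto simp: lookup_add lookup_single when_def split: if_splits)
  qed
  have "Poly_Mapping.lookup (kpderiv x u) M = (\<Sum>N \<in> Poly_Mapping.keys u.
      if N = ?M then of_nat (Poly_Mapping.lookup ?M x) * Poly_Mapping.lookup u ?M else 0)"
    unfolding kpderiv_def lookup_sum
  proof (rule sum.cong[OF refl], goal_cases)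
    case (1 N)
    show ?case
    proof (cases "N = ?M")
      case True
      then show ?thesis by (simp add: lookup_single when_def)
    next
      case False
      then show ?thesis using *[of N] by (cases "Poly_Mapping.lookup N x = 0")
        (auto simp: lookup_single when_def)
    qed
  qed
  also have "\<dots> = of_nat (Poly_Mapping.lookup ?M x) * Poly_Mapping.lookup u ?M"
    by (auto simp: in_keys_iff)
  finally show ?thesis by (simp add: lookup_add lookup_single)
qed

lemma kpderiv_add: "kpderiv x (u + w) = kpderiv x u + kpderiv x w"
  by (rule poly_mapping_eqI) (simp add: kpderiv_lookup lookup_add algebra_simps)

lemma kpderiv_zero [simp]: "kpderiv x 0 = 0"
  by (rule poly_mapping_eqI) (simp add: kpderiv_lookup)

lemma kalg_monomials:
  "u = (\<Sum>N \<in> Poly_Mapping.keys u. Poly_Mapping.single N (Poly_Mapping.lookup u N))"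
  by (rule poly_mapping_eqI) (simp add: lookup_sum lookup_single when_def in_keys_iff)

lemma lookup_kvar_mult:
  "Poly_Mapping.lookup (kvar j s * u) M =
     (if Poly_Mapping.lookup M (j, s) = 0 then 0
      else Poly_Mapping.lookup u (M - Poly_Mapping.single (j, s) 1))"
proof -
  let ?e = "Poly_Mapping.single (j, s) (1::nat)"
  have eq: "(M = ?e + N) = (Poly_Mapping.lookup M (j, s) \<noteq> 0 \<and> N = M - ?e)" for N
  proof
    assume "Poly_Mapping.lookup M (j, s) \<noteq> 0 \<and> N = M - ?e"
    then show "M = ?e + N"
      by (intro poly_mapping_eqI) (auto simp: lookup_add lookup_minus lookup_single when_def)
  qed (auto simp: lookup_add)
  have "Poly_Mapping.lookup (kvar j s * u) M =
     (\<Sum>N \<in> Poly_Mapping.keys u. if M = ?e + N then Poly_Mapping.lookup u N else 0)"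
  proof -
    have "kvar j s * u = (\<Sum>N \<in> Poly_Mapping.keys u. kvar j s * Poly_Mapping.single N (Poly_Mapping.lookup u N))"
      by (subst (1) kalg_monomials[of u]) (rule sum_distrib_left)
    then show ?thesis
      by (simp add: lookup_sum kvar_def mult_single lookup_single when_def eq_commute)
  qed
  also have "\<dots> = (\<Sum>N \<in> Poly_Mapping.keys u. if N = M - ?e then
      (if Poly_Mapping.lookup M (j, s) = 0 then 0 else Poly_Mapping.lookup u (M - ?e)) else 0)"
    by (rule sum.cong[OF refl], subst eq) auto
  also have "\<dots> = (if Poly_Mapping.lookup M (j, s) = 0 then 0 else Poly_Mapping.lookup u (M - ?e))"
    by (auto simp: in_keys_iff)
  finally show ?thesis .
qed

lemma kpderiv_kvar_mult:
  "kpderiv x (kvar j s * u) = kvar j s * kpderiv x u + (if x = (j, s) then u else 0)"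
proof (rule poly_mapping_eqI)
  fix M
  let ?e = "Poly_Mapping.single (j, s) (1::nat)" and ?x = "Poly_Mapping.single x (1::nat)"
  show "Poly_Mapping.lookup (kpderiv x (kvar j s * u)) M =
    Poly_Mapping.lookup (kvar j s * kpderiv x u + (if x = (j, s) then u else 0)) M"
  proof (cases "x = (j, s)")
    case True
    then have "M - ?e + ?e = M" if "Poly_Mapping.lookup M (j, s) \<noteq> 0"
      using that by (intro poly_mapping_eqI) (auto simp: lookup_add lookup_minus lookup_single when_def)
    then show ?thesis using True
      by (auto simp: kpderiv_lookup lookup_kvar_mult lookup_add lookup_minus distrib_right)
  next
    case False
    then have "M + ?x - ?e = M - ?e + ?x" if "Poly_Mapping.lookup M (j, s) \<noteq> 0"
      using that by (intro poly_mapping_eqI) (auto simp: lookup_add lookup_minus lookup_single when_def)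
    then show ?thesis using False
      by (auto simp: kpderiv_lookup lookup_kvar_mult lookup_add lookup_minus lookup_single when_def)
  qed
qed

lemma kpderiv_one: "kpderiv x 1 = 0"
proof (rule poly_mapping_eqI)
  fix M :: mono
  have "Poly_Mapping.lookup (M + Poly_Mapping.single x 1) x \<noteq> 0"
    by (simp add: lookup_add lookup_single)
  then have "M + Poly_Mapping.single x 1 \<noteq> 0" by (metis lookup_zero)
  then show "Poly_Mapping.lookup (kpderiv x 1) M = Poly_Mapping.lookup 0 M"
    by (simp add: kpderiv_lookup lookup_one when_def)
qed

lemma kann_zero [simp]: "kann n j r 0 = 0"
  by (simp add: kann_def)

lemma kann_one: "kann n j r 1 = 0"
  by (simp add: kann_def kpderiv_one)

lemma kann_kvar_mult:
  assumes "j \<in> {1..n}"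
  shows "kann n i r (kvar j s * u) = kvar j s * kann n i r u +
    kconst (if r = s then qint (cartan i j * int r) * qint (int r) / of_nat r else 0) * u"
proof -
  have "kann n i r (kvar j s * u) = (\<Sum>k = 1..n.
      kvar j s * (kconst (qint (cartan i k * int r) * qint (int r) / of_nat r) * kpderiv (k, r) u) +
      (if k = j then kconst (if r = s then qint (cartan i j * int r) * qint (int r) / of_nat r else 0) * u else 0))"
    unfolding kann_def
    by (rule sum.cong[OF refl]) (auto simp: kpderiv_kvar_mult distrib_left mult.left_commute kconst_def)
  then show ?thesis
    using assms by (simp add: sum.distrib kann_def sum_distrib_left)
qed

lemma lookup_map0: "f 0 = 0 \<Longrightarrow> Poly_Mapping.lookup (Poly_Mapping.map f v) k = f (Poly_Mapping.lookup v k)"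
  by (simp add: Poly_Mapping.map.rep_eq when_def)

lemma lookup_vscale: "Poly_Mapping.lookup (vscale c v) \<beta> = kconst c * Poly_Mapping.lookup v \<beta>"
  by (simp add: vscale_def lookup_map0)

text \<open>The defining commutation relations of the Heisenberg algebra. Together with \<open>a\<^sub>i(r) 1 = 0\<close> they
  determine the operators \<open>a\<^sub>i(r)\<close>, \<open>r > 0\<close>.\<close>

lemma heis_commutator:
  assumes "j \<in> {1..n}" and "r > 0" and "s > 0"
  shows "heis n i (int r) (heis n j (- int s) v) - heis n j (- int s) (heis n i (int r) v) =
    vscale (if r = s then qint (cartan i j * int r) * qint (int r) / of_nat r else 0) v"
  using assms
  by (intro poly_mapping_eqI) (simp add: lookup_minus heis_def lookup_map0 lookup_vscale kann_kvar_mult)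

lemma heis_vac: "r > 0 \<Longrightarrow> heis n i (int r) vac = 0"
  by (rule poly_mapping_eqI)
    (simp add: heis_def lookup_map0 vac_def lookup_single lookup_one when_def kann_one del: single_one)


definition mcoef :: "nat \<Rightarrow> nat \<Rightarrow> nat \<Rightarrow> int \<Rightarrow> qf" where
  "mcoef n i j l =
     (if j \<le> i then qint (int j * l) * qint (int (n + 1 - i) * l)
      else qint (int i * l) * qint (int (n + 1 - j) * l))
     / (qint (int (n + 1) * l) * qint l)"

definition heis_star :: "nat \<Rightarrow> nat \<Rightarrow> int \<Rightarrow> vsp \<Rightarrow> vsp" where
  "heis_star n i l v = (\<Sum>j = 1..n. vscale (mcoef n i j l) (heis n j l v))"


subsection \<open>The twisted group algebra\<close>

text \<open>Generators of \<open>P\<close>: \<open>\<gamma>\<^sub>k = \<alpha>\<^sub>k\<close> for \<open>2 \<le> k \<le> n\<close> and \<open>\<gamma>\<^bsub>n+1\<^esub> = \<lambda>\<^sub>n\<close>. The coefficient of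
  \<open>\<gamma>\<^sub>k\<close> in \<open>\<alpha>\<close> is \<open>lat_coord n \<alpha> k\<close>; see \<open>lat_coord_expansion\<close>.\<close>

definition lat_gen :: "nat \<Rightarrow> nat \<Rightarrow> wt" where
  "lat_gen n k = (if k = Suc n then fund_weight n else simple_root n k)"

definition lat_coord :: "nat \<Rightarrow> wt \<Rightarrow> nat \<Rightarrow> int" where
  "lat_coord n \<alpha> k =
     (if k = Suc n then (\<Sum>j = 1..n. (int (Suc n) - int j) * Poly_Mapping.lookup \<alpha> j)
      else - (\<Sum>j = 1..<k. (int k - int j) * Poly_Mapping.lookup \<alpha> j))"

text \<open>Write \<open>g\<^sub>k\<close> for the generator \<open>e\<^bsup>\<gamma>\<^esup>\<close>, \<open>\<gamma> = \<gamma>\<^sub>k\<close>, of \<open>\<complex>{P}\<close>. The defining relations are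
  \<open>g\<^sub>k g\<^sub>l = (-1)\<^bsup>comm_exp n k l\<^esup> g\<^sub>l g\<^sub>k\<close>.\<close>

definition comm_exp :: "nat \<Rightarrow> nat \<Rightarrow> nat \<Rightarrow> int" where
  "comm_exp n k l =
     (if k = Suc n \<and> l = Suc n then 0
      else if l = Suc n then (if k = n then 1 else 0)
      else if k = Suc n then (if l = n then 1 else 0)
      else cartan k l)"

text \<open>The element \<open>e\<^sup>\<alpha>\<close> is the product of the powers \<open>g\<^sub>k ^ lat_coord n \<alpha> k\<close> in increasing order of
  \<open>k\<close>. Reordering the product of \<open>e\<^sup>\<alpha>\<close> and \<open>e\<^sup>\<beta>\<close> moves each factor \<open>g\<^sub>k\<close> of \<open>e\<^sup>\<beta>\<close> to the
  left past the factors \<open>g\<^sub>l\<close>, \<open>l > k\<close>, of \<open>e\<^sup>\<alpha>\<close>, which yields \<open>e\<^sup>\<alpha> e\<^sup>\<beta> = lat_sign n \<alpha> \<beta> e\<^bsup>\<alpha>+\<beta>\<^esup>\<close>.\<close>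

definition lat_sign :: "nat \<Rightarrow> wt \<Rightarrow> wt \<Rightarrow> qf" where
  "lat_sign n \<alpha> \<beta> =
     (- 1) powi (\<Sum>l = 2..Suc n. \<Sum>k = 2..<l. lat_coord n \<alpha> l * lat_coord n \<beta> k * comm_exp n l k)"

text \<open>Left multiplication by \<open>e\<^sup>\<alpha>\<close>.\<close>

definition lat_mult :: "nat \<Rightarrow> wt \<Rightarrow> vsp \<Rightarrow> vsp" where
  "lat_mult n \<alpha> v = (\<Sum>\<beta> \<in> Poly_Mapping.keys v.
     Poly_Mapping.single (\<alpha> + \<beta>) (kconst (lat_sign n \<alpha> \<beta>) * Poly_Mapping.lookup v \<beta>))"

lemma lat_coord_expansion:
  assumes "\<alpha> \<in> weight_lattice n" and n: "n \<ge> 1"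
  shows "Poly_Mapping.lookup \<alpha> j =
    (\<Sum>k = 2..Suc n. lat_coord n \<alpha> k * Poly_Mapping.lookup (lat_gen n k) j)"
proof (cases "j \<in> {1..n}")
  case False
  then have "Poly_Mapping.lookup \<alpha> j = 0"
    using assms by (auto simp: weight_lattice_def in_keys_iff)
  with False n show ?thesis
    by (auto simp: lat_gen_def lookup_simple_root lookup_fund_weight intro!: sum.neutral[symmetric])
next
  case True
  define c where "c = Poly_Mapping.lookup \<alpha>"
  define m where "m k = - (\<Sum>j = 1..<k. (int k - int j) * c j)" for k
  have diff: "m (Suc k) = m k - (\<Sum>j = 1..<Suc k. c j)" for k
  proof -
    have "(\<Sum>j = 1..<Suc k. (int (Suc k) - int j) * c j) =
      (\<Sum>j = 1..<Suc k. (int k - int j) * c j) + (\<Sum>j = 1..<Suc k. c j)"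
      by (simp only: sum.distrib[symmetric]) (rule sum.cong, auto simp: algebra_simps)
    moreover have "(\<Sum>j = 1..<Suc k. (int k - int j) * c j) = (\<Sum>j = 1..<k. (int k - int j) * c j)"
      by (cases k) auto
    ultimately show ?thesis by (simp add: m_def)
  qed
  have rec: "2 * m (Suc k) - m k - m (Suc (Suc k)) = c (Suc k)" for k
    using diff[of k] diff[of "Suc k"] by simp
  define h where "h k = (if k \<le> n then m k else 0)" for k
  have m01: "m 0 = 0" "m 1 = 0" by (simp_all add: m_def)
  have lc: "lat_coord n \<alpha> k = m k" if "k \<le> n" for k
    using that by (simp add: lat_coord_def m_def c_def)
  have "lat_coord n \<alpha> (Suc n) = - m (Suc n)"
    by (simp add: lat_coord_def m_def c_def atLeastLessThanSuc_atLeastAtMost)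
  then have "(\<Sum>k = 2..Suc n. lat_coord n \<alpha> k * Poly_Mapping.lookup (lat_gen n k) j) =
     (\<Sum>k = 2..n. lat_coord n \<alpha> k * Poly_Mapping.lookup (lat_gen n k) j) - (if j = n then m (Suc n) else 0)"
    using n by (simp add: lat_gen_def lookup_fund_weight)
  also have "(\<Sum>k = 2..n. lat_coord n \<alpha> k * Poly_Mapping.lookup (lat_gen n k) j) =
     (\<Sum>k = 2..n. of_int (cartan j k) * h k)"
    using True by (intro sum.cong) (auto simp: lc lat_gen_def lookup_simple_root cartan_sym h_def)
  also have "\<dots> = (\<Sum>k = 1..n. of_int (cartan j k) * h k)"
    using n m01 by (subst (2) sum.atLeast_Suc_atMost) (simp_all add: h_def numeral_2_eq_2)
  also have "\<dots> = 2 * h j - h (j - 1) - h (Suc j)"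
    by (rule sum_cartan[OF True]) (auto simp: h_def m01)
  also have "\<dots> - (if j = n then m (Suc n) else 0) = c j"
    using True rec[of "j - 1"] by (auto simp: h_def)
  finally show ?thesis by (simp add: c_def)
qed

lemma lat_coord_gen:
  assumes "k \<in> {2..Suc n}" and "l \<in> {2..Suc n}"
  shows "lat_coord n (lat_gen n k) l = (if k = l then 1 else 0)"
proof (cases "k = Suc n")
  case True
  then show ?thesis using assms
    by (auto simp: lat_coord_def lat_gen_def lookup_fund_weight if_distrib if_distribR cong: if_cong)
next
  case False
  then have k: "k \<in> {1..n}" "k \<ge> 2" using assms by auto
  define h where "h j = (if 1 \<le> j \<and> j < l then int l - int j else 0)" for j
  have "(\<Sum>j = 1..n. of_int (cartan k j) * h j) = 2 * h k - h (k - 1) - h (Suc k)"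
    by (rule sum_cartan[OF k(1)]) (use assms in \<open>auto simp: h_def\<close>)
  also have "\<dots> = (if k = l then - 1 else 0)"
    using k by (auto simp: h_def)
  finally have *: "(\<Sum>j = 1..n. of_int (cartan k j) * h j) = (if k = l then - 1 else 0)" .
  have "(\<Sum>j = 1..<l. (int l - int j) * Poly_Mapping.lookup (simple_root n k) j) =
     (\<Sum>j = 1..n. of_int (cartan k j) * h j)"
    by (rule sum.mono_neutral_cong_left) (use assms in \<open>auto simp: h_def lookup_simple_root\<close>)
  with * have "(\<Sum>j = 1..<l. (int l - int j) * Poly_Mapping.lookup (simple_root n k) j) = (if k = l then - 1 else 0)"
    by simp
  then show ?thesis using False
    by (auto simp: lat_coord_def lat_gen_def atLeastLessThanSuc_atLeastAtMost)
qed

lemma lat_coord_add: "lat_coord n (\<alpha> + \<beta>) k = lat_coord n \<alpha> k + lat_coord n \<beta> k"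
  by (simp add: lat_coord_def lookup_add ring_distribs sum.distrib)

lemma lat_sign_add_left: "lat_sign n (\<alpha> + \<alpha>') \<beta> = lat_sign n \<alpha> \<beta> * lat_sign n \<alpha>' \<beta>"
  by (simp add: lat_sign_def lat_coord_add algebra_simps sum.distrib power_int_add)

lemma lat_sign_add_right: "lat_sign n \<alpha> (\<beta> + \<beta>') = lat_sign n \<alpha> \<beta> * lat_sign n \<alpha> \<beta>'"
  by (simp add: lat_sign_def lat_coord_add algebra_simps sum.distrib power_int_add)

lemma lookup_lat_mult:
  "Poly_Mapping.lookup (lat_mult n \<alpha> v) \<beta> =
     kconst (lat_sign n \<alpha> (\<beta> - \<alpha>)) * Poly_Mapping.lookup v (\<beta> - \<alpha>)"
proof -
  have "Poly_Mapping.lookup (lat_mult n \<alpha> v) \<beta> = (\<Sum>\<gamma> \<in> Poly_Mapping.keys v.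
     if \<gamma> = \<beta> - \<alpha> then kconst (lat_sign n \<alpha> (\<beta> - \<alpha>)) * Poly_Mapping.lookup v (\<beta> - \<alpha>) else 0)"
    unfolding lat_mult_def lookup_sum
    by (rule sum.cong[OF refl]) (auto simp: lookup_single when_def algebra_simps)
  then show ?thesis by (auto simp: in_keys_iff)
qed

lemma kconst_mult: "kconst (a * b) = kconst a * kconst b"
  by (simp add: kconst_def mult_single)

lemma lat_mult_lat_mult:
  "lat_mult n \<alpha> (lat_mult n \<beta> v) = vscale (lat_sign n \<alpha> \<beta>) (lat_mult n (\<alpha> + \<beta>) v)"
proof (rule poly_mapping_eqI)
  fix \<gamma>
  have "lat_sign n \<alpha> (\<gamma> - \<alpha>) = lat_sign n \<alpha> \<beta> * lat_sign n \<alpha> (\<gamma> - (\<alpha> + \<beta>))"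
    by (simp add: lat_sign_add_right[symmetric] algebra_simps)
  then show "Poly_Mapping.lookup (lat_mult n \<alpha> (lat_mult n \<beta> v)) \<gamma> =
     Poly_Mapping.lookup (vscale (lat_sign n \<alpha> \<beta>) (lat_mult n (\<alpha> + \<beta>) v)) \<gamma>"
    by (simp add: lookup_lat_mult lookup_vscale lat_sign_add_left kconst_mult algebra_simps diff_diff_eq)
qed

lemma lat_mult_zero: "lat_mult n 0 v = v"
  by (rule poly_mapping_eqI)
     (simp add: lookup_lat_mult lat_sign_def lat_coord_def kconst_def flip: one_poly_mapping.abs_eq)

lemma lat_sign_gen:
  assumes "k \<in> {2..Suc n}" and "l \<in> {2..Suc n}"
  shows "lat_sign n (lat_gen n k) (lat_gen n l) = (if l < k then (- 1) powi comm_exp n k l else 1)"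
proof -
  have "(\<Sum>i = 2..Suc n. \<Sum>j = 2..<i. lat_coord n (lat_gen n k) i * lat_coord n (lat_gen n l) j * comm_exp n i j) =
    (\<Sum>i = 2..Suc n. if i = k then (\<Sum>j = 2..<i. if j = l then comm_exp n k l else 0) else 0)"
  proof (rule sum.cong[OF refl])
    fix i assume i: "i \<in> {2..Suc n}"
    show "(\<Sum>j = 2..<i. lat_coord n (lat_gen n k) i * lat_coord n (lat_gen n l) j * comm_exp n i j) =
      (if i = k then (\<Sum>j = 2..<i. if j = l then comm_exp n k l else 0) else 0)"
    proof (cases "i = k")
      case True
      have "lat_coord n (lat_gen n k) i * lat_coord n (lat_gen n l) j * comm_exp n i j =
        (if j = l then comm_exp n k l else 0)" if "j \<in> {2..<i}" for j
        using that i assms True by (simp add: lat_coord_gen)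
      then have "(\<Sum>j = 2..<i. lat_coord n (lat_gen n k) i * lat_coord n (lat_gen n l) j * comm_exp n i j) =
        (\<Sum>j = 2..<i. if j = l then comm_exp n k l else 0)"
        by (rule sum.cong[OF refl])
      then show ?thesis using True by simp
    next
      case False
      then have "lat_coord n (lat_gen n k) i = 0" using lat_coord_gen[OF assms(1) i] by simp
      then show ?thesis using False by simp
    qed
  qed
  also have "\<dots> = (if l < k then comm_exp n k l else 0)"
    using assms by simp
  finally show ?thesis by (simp add: lat_sign_def)
qed

text \<open>The defining relations of \<open>\<complex>{P}\<close>.\<close>

lemma lat_gen_commute:
  assumes "k \<in> {2..Suc n}" and "l \<in> {2..Suc n}"
  shows "lat_mult n (lat_gen n k) (lat_mult n (lat_gen n l) v) =
    vscale ((- 1) powi comm_exp n k l) (lat_mult n (lat_gen n l) (lat_mult n (lat_gen n k) v))"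
proof -
  have sym: "comm_exp n k l = comm_exp n l k" by (auto simp: comm_exp_def cartan_sym)
  have sq: "(- 1 :: qf) powi m * (- 1) powi m = 1" for m
    by (simp add: power_int_mult_distrib[symmetric])
  have "(- 1 :: qf) powi comm_exp n k k = 1" by (simp add: comm_exp_def cartan_def)
  then have "lat_sign n (lat_gen n k) (lat_gen n l) =
     (- 1) powi comm_exp n k l * lat_sign n (lat_gen n l) (lat_gen n k)"
    using assms by (cases k l rule: linorder_cases) (auto simp: lat_sign_gen sym sq)
  then show ?thesis
    by (intro poly_mapping_eqI)
       (simp add: lat_mult_lat_mult lookup_vscale kconst_mult add.commute mult.assoc)
qed

text \<open>No sign arises when the factors are multiplied in increasing order.\<close>

lemma lat_sign_ordered:
  assumes "\<And>l k. lat_coord n \<alpha> l \<noteq> 0 \<Longrightarrow> lat_coord n \<beta> k \<noteq> 0 \<Longrightarrow> l \<le> k"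
  shows "lat_sign n \<alpha> \<beta> = 1"
proof -
  have "(\<Sum>l = 2..Suc n. \<Sum>k = 2..<l. lat_coord n \<alpha> l * lat_coord n \<beta> k * comm_exp n l k) = 0"
  proof (intro sum.neutral ballI)
    fix l k :: nat assume "k \<in> {2..<l}"
    then have "lat_coord n \<alpha> l = 0 \<or> lat_coord n \<beta> k = 0" using assms[of l k] by force
    then show "lat_coord n \<alpha> l * lat_coord n \<beta> k * comm_exp n l k = 0" by auto
  qed
  then show ?thesis by (simp add: lat_sign_def)
qed

text \<open>The coefficient of \<open>z\<^sup>s\<close> in \<open>z\<^bsup>\<partial>\<^sub>\<alpha>\<^esup> v\<close>.\<close>

definition zpart :: "nat \<Rightarrow> wt \<Rightarrow> vsp \<Rightarrow> rat \<Rightarrow> vsp" where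
  "zpart n \<alpha> v s = (\<Sum>\<beta> \<in> {\<beta> \<in> Poly_Mapping.keys v. wform n \<alpha> \<beta> = s}.
     Poly_Mapping.single \<beta> (Poly_Mapping.lookup v \<beta>))"

text \<open>The operator \<open>(-1)\<^bsup>m \<partial>\<^sub>\<alpha>\<^esup>\<close>.\<close>

definition sign_part :: "nat \<Rightarrow> nat \<Rightarrow> wt \<Rightarrow> vsp \<Rightarrow> vsp" where
  "sign_part n m \<alpha> v = (\<Sum>\<beta> \<in> Poly_Mapping.keys v. Poly_Mapping.single \<beta>
     (kconst (qconst (exp (of_real pi * \<i> * of_rat (of_nat m * wform n \<alpha> \<beta>)))) *
       Poly_Mapping.lookup v \<beta>))"


section \<open>Vertex operators\<close>

text \<open>A formal series \<open>a(z) = \<Sum>\<^sub>s a\<^sub>s z\<^sup>s\<close> with rational exponents, acting on \<open>V\<close>: \<open>a v s\<close> is the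
  coefficient of \<open>z\<^sup>s\<close> in \<open>a(z) v\<close>. Such series are considered only as maps on \<open>Vspace n\<close>.\<close>

type_synonym vfield = "vsp \<Rightarrow> rat \<Rightarrow> vsp"

text \<open>Membership of a series in \<open>W((z\<^bsup>1/N\<^esup>))\<close>.\<close>

definition laurent :: "nat \<Rightarrow> 'w::zero set \<Rightarrow> (rat \<Rightarrow> 'w) \<Rightarrow> bool" where
  "laurent N W c \<longleftrightarrow> (\<forall>s. c s \<in> W) \<and> (\<forall>s. c s \<noteq> 0 \<longrightarrow> of_nat N * s \<in> \<int>) \<and>
     (\<exists>B. \<forall>s. c s \<noteq> 0 \<longrightarrow> B \<le> s)"

text \<open>\<open>Hom(V, V((z\<^bsup>1/N\<^esup>)))\<close>\<close>

definition Hom_laurent :: "nat \<Rightarrow> nat \<Rightarrow> vfield set" where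
  "Hom_laurent n N = {a.
     (\<forall>v \<in> Vspace n. \<forall>w \<in> Vspace n. \<forall>s. a (v + w) s = a v s + a w s) \<and>
     (\<forall>c. \<forall>v \<in> Vspace n. \<forall>s. a (vscale c v) s = vscale c (a v s)) \<and>
     (\<forall>v \<in> Vspace n. laurent N (Vspace n) (a v))}"

definition vfield_zero :: "nat \<Rightarrow> vfield \<Rightarrow> bool" where
  "vfield_zero n a \<longleftrightarrow> (\<forall>v \<in> Vspace n. \<forall>s. a v s = 0)"

text \<open>Exponential of an operator valued power series \<open>A(w) = \<Sum>\<^sub>r\<^sub>\<ge>\<^sub>1 A\<^sub>r w\<^sup>r\<close> without constant term:
  \<open>op_pow A k m\<close> and \<open>op_exp A m\<close> are the coefficients of \<open>w\<^sup>m\<close> in \<open>A(w)\<^sup>k\<close> and in \<open>exp(A(w))\<close>.\<close>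

primrec op_pow :: "(nat \<Rightarrow> vsp \<Rightarrow> vsp) \<Rightarrow> nat \<Rightarrow> nat \<Rightarrow> vsp \<Rightarrow> vsp" where
  "op_pow A 0 m v = (if m = 0 then v else 0)"
| "op_pow A (Suc k) m v = (\<Sum>r = 1..m. A r (op_pow A k (m - r) v))"

definition op_exp :: "(nat \<Rightarrow> vsp \<Rightarrow> vsp) \<Rightarrow> nat \<Rightarrow> vsp \<Rightarrow> vsp" where
  "op_exp A m v = (\<Sum>k \<le> m. vscale (1 / of_nat (fact k)) (op_pow A k m v))"

text \<open>\<open>exp(\<Sum>\<^sub>r A\<^sub>r z\<^sup>r) exp(\<Sum>\<^sub>r B\<^sub>r z\<^bsup>-r\<^esup>) L(z)\<close>. The operators \<open>B\<^sub>r\<close> are locally nilpotent,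
  so only finitely many terms contribute to each coefficient of the series applied to a vector;
  \<open>Sum_any\<close> is the sum over the nonzero terms.\<close>

definition vertex_op :: "(nat \<Rightarrow> vsp \<Rightarrow> vsp) \<Rightarrow> (nat \<Rightarrow> vsp \<Rightarrow> vsp) \<Rightarrow> vfield \<Rightarrow> vfield" where
  "vertex_op A B L v s = Sum_any (\<lambda>(m::nat, l::nat).
     op_exp A m (op_exp B l (L v (s - of_nat m + of_nat l))))"

definition x_minus :: "nat \<Rightarrow> nat \<Rightarrow> vfield" where
  "x_minus n j = vertex_op
     (\<lambda>r v. vscale (- (qh ^ r / qint (int r))) (heis n j (- int r) v))
     (\<lambda>r v. vscale (qh ^ r / qint (int r)) (heis n j (int r) v))
     (\<lambda>v s. lat_mult n (- simple_root n j) (zpart n (- simple_root n j) v s))"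

definition Y_op :: "nat \<Rightarrow> nat \<Rightarrow> vfield" where
  "Y_op n i = vertex_op
     (\<lambda>r v. vscale (qh ^ r / qint (int r)) (heis_star n i (- int r) v))
     (\<lambda>r v. vscale (- (qh ^ r / qint (int r))) (heis_star n i (int r) v))
     (\<lambda>v s. lat_mult n (fund_weight i)
        (sign_part n (if i = n then 0 else i) (fund_weight n) (zpart n (fund_weight i) v s)))"


section \<open>Products of vertex operators\<close>

text \<open>A polynomial \<open>p(z\<^sub>1, z\<^sub>2)\<close> is an element of \<open>F[z\<^sub>2][z\<^sub>1]\<close>. A series in \<open>z\<^sub>1, z\<^sub>2\<close> with
  coefficients in \<open>V\<close> is a function of two exponents.\<close>

definition comp2 :: "vfield \<Rightarrow> vfield \<Rightarrow> vsp \<Rightarrow> rat \<Rightarrow> rat \<Rightarrow> vsp" where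
  "comp2 a b v r s = a (b v s) r"

definition pmult2 :: "qf poly poly \<Rightarrow> (rat \<Rightarrow> rat \<Rightarrow> vsp) \<Rightarrow> rat \<Rightarrow> rat \<Rightarrow> vsp" where
  "pmult2 p c r s = (\<Sum>i \<le> degree p. \<Sum>j \<le> degree (coeff p i).
     vscale (coeff (coeff p i) j) (c (r - of_nat i) (s - of_nat j)))"

text \<open>Membership of a series in \<open>V((z\<^sub>1, z\<^sub>2\<^bsup>1/(n+1)\<^esup>))\<close>.\<close>

definition laurent2 :: "nat \<Rightarrow> (rat \<Rightarrow> rat \<Rightarrow> vsp) \<Rightarrow> bool" where
  "laurent2 n c \<longleftrightarrow> (\<forall>r s. c r s \<in> Vspace n) \<and>
     (\<forall>r s. c r s \<noteq> 0 \<longrightarrow> r \<in> \<int> \<and> of_nat (n + 1) * s \<in> \<int>) \<and>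
     (\<exists>B. \<forall>r s. c r s \<noteq> 0 \<longrightarrow> B \<le> r \<and> B \<le> s)"

definition quasi_compatible_by :: "nat \<Rightarrow> qf poly poly \<Rightarrow> vfield \<Rightarrow> vfield \<Rightarrow> bool" where
  "quasi_compatible_by n p a b \<longleftrightarrow>
     a \<in> Hom_laurent n 1 \<and> b \<in> Hom_laurent n (n + 1) \<and> p \<noteq> 0 \<and>
     (\<forall>v \<in> Vspace n. laurent2 n (pmult2 p (comp2 a b v)))"

text \<open>The inverse of \<open>p(z\<^sub>0 + z, z)\<close> in \<open>F((z))((z\<^sub>0))\<close>; the outer series are in \<open>z\<^sub>0\<close>.\<close>

definition iota_inverse :: "qf poly poly \<Rightarrow> qf fls fls" where
  "iota_inverse p = inverse (\<Sum>i \<le> degree p. \<Sum>j \<le> degree (coeff p i).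
     fls_const (fls_const (coeff (coeff p i) j)) *
     (fls_X + fls_const fls_X) ^ i * fls_const fls_X ^ j)"

text \<open>The coefficient of \<open>z\<^sub>0\<^sup>m z\<^sup>t\<close> after substituting \<open>z\<^sub>1 = z + z\<^sub>0\<close>, \<open>z\<^sub>2 = z\<close>, with
  \<open>(z + z\<^sub>0)\<^sup>r = \<Sum>\<^sub>m (r choose m) z\<^bsup>r-m\<^esup> z\<^sub>0\<^sup>m\<close>.\<close>

definition subst_sum :: "(rat \<Rightarrow> rat \<Rightarrow> vsp) \<Rightarrow> nat \<Rightarrow> rat \<Rightarrow> vsp" where
  "subst_sum c m t = Sum_any (\<lambda>r::int.
     vscale (qconst (of_int r gchoose m)) (c (of_int r) (t + of_nat m - of_int r)))"

text \<open>The product \<open>a(z)\<^sub>k b(z)\<close>, the coefficient of \<open>z\<^sub>0\<^bsup>-k-1\<^esup>\<close>. It does not depend on the choice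
  of \<open>p\<close> and is meaningful for quasi compatible pairs only.\<close>

definition nth_product :: "nat \<Rightarrow> vfield \<Rightarrow> int \<Rightarrow> vfield \<Rightarrow> vfield" where
  "nth_product n a k b v s =
     (let p = SOME p. quasi_compatible_by n p a b in
      Sum_any (\<lambda>(m::nat, l::int).
        vscale (fls_nth (fls_nth (iota_inverse p) (- k - 1 - int m)) l)
          (subst_sum (pmult2 p (comp2 a b v)) m (s - of_int l))))"

definition has_weight :: "nat \<Rightarrow> vfield \<Rightarrow> wt \<Rightarrow> bool" where
  "has_weight n c \<alpha> \<longleftrightarrow> \<alpha> \<in> weight_lattice n \<and>
     (\<exists>d. laurent (n + 1) (Kspace n) d \<and> (\<forall>s. c vac s = Poly_Mapping.single \<alpha> (d s)))"

text \<open>If \<open>c(z) 1 \<noteq> 0\<close>, there is at most one weight.\<close>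

definition field_weight :: "nat \<Rightarrow> vfield \<Rightarrow> wt" where
  "field_weight n c = (THE \<alpha>. has_weight n c \<alpha>)"

text \<open>The series \<open>a(z q\<^bsup>u/2\<^esup>)\<close> for a series \<open>a(z)\<close> with integral exponents.\<close>

definition qshift :: "int \<Rightarrow> vfield \<Rightarrow> vfield" where
  "qshift u a v r = vscale (qh powi (u * \<lfloor>r\<rfloor>)) (a v r)"

text \<open>The sum is over \<open>t = u / 2\<close>. As \<open>a(z)\<close> has integral exponents, its weight lies in the root
  lattice and the exponent \<open>d = (wt a(z), wt b(z)) + 1\<close> is an integer. If \<open>b(z) = 0\<close> the result
  is \<open>0\<close> whatever the value of \<open>field_weight n b\<close>, see \<open>bullet_zero\<close>.\<close>

definition bullet :: "nat \<Rightarrow> vfield \<Rightarrow> vfield \<Rightarrow> vfield" where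
  "bullet n a b v s =
     (let d = wform n (field_weight n a) (field_weight n b) + 1 in
      Sum_any (\<lambda>u::int.
        vscale (qh powi (- u * \<lfloor>d\<rfloor>) * qh powi u)
          (nth_product n (qshift u a) 0 b v (s + d))))"


lemma vscale_zero [simp]: "vscale c 0 = 0"
  by (rule poly_mapping_eqI) (simp add: lookup_vscale)

lemma bullet_zero:
  assumes a: "a \<in> Hom_laurent n 1" and b: "vfield_zero n b"
  shows "vfield_zero n (bullet n a b)"
proof -
  have "0 \<in> Vspace n" by (simp add: Vspace_def Kspace_def)
  moreover have "\<forall>v \<in> Vspace n. \<forall>w \<in> Vspace n. \<forall>s. a (v + w) s = a v s + a w s"
    using a unfolding Hom_laurent_def by blast
  ultimately have "a (0 + 0) s = a 0 s + a 0 s" for s by blast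
  then have a0: "a 0 s = 0" for s by simp
  have "nth_product n (qshift u a) 0 b v s = 0" if v: "v \<in> Vspace n" for u v s
  proof -
    have "comp2 (qshift u a) b v = (\<lambda>r s. 0)"
      using b v by (simp add: fun_eq_iff comp2_def qshift_def vfield_zero_def a0)
    then show ?thesis
      by (simp add: nth_product_def subst_sum_def pmult2_def Let_def case_prod_unfold)
  qed
  then show ?thesis by (simp add: vfield_zero_def bullet_def)
qed


section \<open>Modules over the quantum group\<close>

text \<open>A module over the algebra presented by the generators \<open>e\<^sub>i, f\<^sub>i, K\<^sub>i, K\<^sub>i\<^sup>-\<^sup>1\<close> is a vector space
  over \<open>F\<close> with linear operators satisfying the defining relations.\<close>

definition q_serre :: "nat \<Rightarrow> (qf \<Rightarrow> 'v \<Rightarrow> 'v::ab_group_add) \<Rightarrow> (nat \<Rightarrow> 'v \<Rightarrow> 'v) \<Rightarrow> bool" where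
  "q_serre n scale y \<longleftrightarrow> (\<forall>i \<in> {1..n}. \<forall>j \<in> {1..n}. i \<noteq> j \<longrightarrow>
     (\<forall>w. let m = nat (1 - cartan i j) in
       (\<Sum>s = 0..m. scale ((- 1) ^ s * (qfact m / (qfact s * qfact (m - s))))
          ((y i ^^ (m - s)) (y j ((y i ^^ s) w)))) = 0))"

definition Uq_module :: "nat \<Rightarrow> (qf \<Rightarrow> 'v \<Rightarrow> 'v::ab_group_add) \<Rightarrow> (nat \<Rightarrow> 'v \<Rightarrow> 'v) \<Rightarrow>
    (nat \<Rightarrow> 'v \<Rightarrow> 'v) \<Rightarrow> (nat \<Rightarrow> 'v \<Rightarrow> 'v) \<Rightarrow> (nat \<Rightarrow> 'v \<Rightarrow> 'v) \<Rightarrow> bool" where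
  "Uq_module n scale e f K Kinv \<longleftrightarrow>
     vector_space scale \<and>
     (\<forall>i \<in> {1..n}. Vector_Spaces.linear scale scale (e i) \<and> Vector_Spaces.linear scale scale (f i) \<and>
        Vector_Spaces.linear scale scale (K i) \<and> Vector_Spaces.linear scale scale (Kinv i)) \<and>
     (\<forall>i \<in> {1..n}. \<forall>w. K i (Kinv i w) = w \<and> Kinv i (K i w) = w) \<and>
     (\<forall>i \<in> {1..n}. \<forall>j \<in> {1..n}. \<forall>w.
        K i (K j w) = K j (K i w) \<and>
        K i (e j (Kinv i w)) = scale (qq powi cartan i j) (e j w) \<and>
        K i (f j (Kinv i w)) = scale (qq powi (- cartan i j)) (f j w) \<and>
        e i (f j w) - f j (e i w) =
          (if i = j then scale (1 / (qq - qq powi (- 1))) (K i w - Kinv i w) else 0)) \<and>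
     q_serre n scale e \<and> q_serre n scale f"

definition Uq_irreducible :: "nat \<Rightarrow> (qf \<Rightarrow> 'v \<Rightarrow> 'v::ab_group_add) \<Rightarrow> (nat \<Rightarrow> 'v \<Rightarrow> 'v) \<Rightarrow>
    (nat \<Rightarrow> 'v \<Rightarrow> 'v) \<Rightarrow> (nat \<Rightarrow> 'v \<Rightarrow> 'v) \<Rightarrow> (nat \<Rightarrow> 'v \<Rightarrow> 'v) \<Rightarrow> bool" where
  "Uq_irreducible n scale e f K Kinv \<longleftrightarrow>
     (UNIV :: 'v set) \<noteq> {0} \<and>
     (\<forall>W. module.subspace scale W \<and>
        (\<forall>i \<in> {1..n}. e i ` W \<subseteq> W \<and> f i ` W \<subseteq> W \<and> K i ` W \<subseteq> W \<and> Kinv i ` W \<subseteq> W)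
        \<longrightarrow> W = {0} \<or> W = UNIV)"

text \<open>The module \<open>L(\<lambda>\<^sub>i)\<close> with highest weight vector \<open>v\<close>. The highest weight vector generates the
  module because of irreducibility.\<close>

definition is_fund_module :: "nat \<Rightarrow> nat \<Rightarrow> (qf \<Rightarrow> 'v \<Rightarrow> 'v::ab_group_add) \<Rightarrow> (nat \<Rightarrow> 'v \<Rightarrow> 'v) \<Rightarrow>
    (nat \<Rightarrow> 'v \<Rightarrow> 'v) \<Rightarrow> (nat \<Rightarrow> 'v \<Rightarrow> 'v) \<Rightarrow> (nat \<Rightarrow> 'v \<Rightarrow> 'v) \<Rightarrow> 'v \<Rightarrow> bool" where
  "is_fund_module n i scale e f K Kinv v \<longleftrightarrow>
     Uq_module n scale e f K Kinv \<and> Uq_irreducible n scale e f K Kinv \<and> v \<noteq> 0 \<and>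
     (\<forall>j \<in> {1..n}. e j v = 0 \<and> K j v = scale (if j = i then qq else 1) v)"

end

theory Submission
  imports Defs
begin

text \<open>
  The module \<open>L(\<lambda>\<^sub>i)\<close> is minuscule. If a product of \<open>f\<^sub>j\<close>, with \<open>f\<^sub>l\<close> occurring \<open>m\<^sub>l\<close> times, does
  not annihilate the highest weight vector, then \<open>\<mu> = \<lambda>\<^sub>i - \<Sum> m\<^sub>l \<alpha>\<^sub>l\<close> pairs with each simple root to
  -1, 0 or 1, and a further \<open>f\<^sub>j\<close> gives a nonzero vector if and only if \<open>(\<mu>, \<alpha>\<^sub>j) = 1\<close>; otherwise the
  result would be a singular vector of smaller weight (up to terms handled by induction).

  The iterated products obey the same rule. The product belonging to \<open>m\<close> is, up to a nonzero
  scalar, the normal ordered product of \<open>Y\<^sub>i(z)\<close> and the operators \<open>x\<^sub>l\<^sup>-(z q\<^sup>c)\<close>,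
  \<open>c = |l - i| + 1 + 2 t\<close>, \<open>0 \<le> t < m\<^sub>l\<close>, and all factors of its contraction with \<open>x\<^sub>j\<^sup>-(z\<^sub>1)\<close> cancel
  except for \<open>(z\<^sub>1 - q\<^sup>c z)\<^sup>-\<^sup>p\<close> with \<open>p = (\<mu>, \<alpha>\<^sub>j)\<close> and \<open>c = |j - i| + 1 + 2 m\<^sub>j\<close>. So a pole, and hence a
  nonzero residue, is present if and only if \<open>p = 1\<close>. In that case it is simple, and only the summand
  with the shift by \<open>q\<^sup>c\<close> contributes to the product.
\<close>

text \<open>The module is given by its axioms alone, without a basis, so every vanishing relation
  has to be deduced from irreducibility. The relations for a vector of level \<open>N\<close> need
  one another at smaller levels, hence a simultaneous induction. On the other side the invariant
  \<open>vstate\<close> records only the weight and the contractions with the operators x_l^-. Put x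
  = z / z_1. A new factor x_j^-(q^C z) multiplies the contraction with x_l^-(z_1) by (1 - q^C x)(1 -
  q^(C+2) x) if l = j, by 1 / (1 - q^(C+1) x) if l is a neighbour of j, and by 1 otherwise. For l =
  j the first factor cancels the pole just used; for a neighbour of pairing -1 the existing zero
  lies exactly at the new pole. The number |l - i| + 1 + 2 m_l solves both recursions, starting from
  the contraction 1 / (1 - q x) of x_i^- and Y_i. Poles have order at most one, so a polynomial of
  degree at most one in z_1 witnesses quasi compatibility. The definition of the products selects
  some unknown polynomial, so independence of this choice is proved before any residue is
  computed.\<close>

abbreviation "lookup \<equiv> Poly_Mapping.lookup"
abbreviation "keys \<equiv> Poly_Mapping.keys"
abbreviation "single \<equiv> Poly_Mapping.single"

section \<open>Fundamental modules\<close>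

lemma qh_nonzero [simp]: "qh \<noteq> 0"
  by (simp add: qh_def Zero_fract_def eq_fract)

lemma qq_nonzero [simp]: "qq \<noteq> 0"
  by (simp add: qq_def)

lemma qh_power: "qh ^ k = Fract ([:0, 1:] ^ k) 1"
  by (induction k) (simp_all add: qh_def One_fract_def)

text \<open>An indeterminate is not a root of unity: compare degrees.\<close>

lemma qh_power_eq_1_iff: "qh ^ k = 1 \<longleftrightarrow> k = 0"
proof
  assume "qh ^ k = 1"
  then have "([:0, 1:] :: complex poly) ^ k = 1"
    by (simp add: qh_power One_fract_def eq_fract)
  then have "degree (([:0, 1:] :: complex poly) ^ k) = 0" by simp
  then show "k = 0" by (simp add: degree_power_eq)
qed simp

lemma qh_powi_eq_1_iff: "qh powi k = 1 \<longleftrightarrow> k = 0"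
  by (auto simp: power_int_def qh_power_eq_1_iff power_inverse)

lemma qh_powi_eq_iff: "qh powi a = qh powi b \<longleftrightarrow> a = b"
proof
  assume "qh powi a = qh powi b"
  then have "qh powi (a - b) = 1" by (simp add: power_int_diff)
  then show "a = b" by (simp add: qh_powi_eq_1_iff)
qed simp

lemma qq_powi: "qq powi a = qh powi (2 * a)"
  by (simp add: qq_def power_int_mult power_int_power')

lemma qq_powi_eq_iff: "qq powi a = qq powi b \<longleftrightarrow> a = b"
  by (simp add: qq_powi qh_powi_eq_iff)

lemma qq_diff_nonzero: "qq - qq powi (- 1) \<noteq> 0"
  using qq_powi_eq_iff[of 1 "- 1"] by simp

lemma qint_0 [simp]: "qint 0 = 0"
  by (simp add: qint_def)

lemma qint_1 [simp]: "qint 1 = 1"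
  using qq_diff_nonzero by (simp add: qint_def)

lemma qint_minus: "qint (- m) = - qint m"
  by (simp add: qint_def minus_divide_left)

lemma qint_eq_0_iff [simp]: "qint m = 0 \<longleftrightarrow> m = 0"
  using qq_diff_nonzero qq_powi_eq_iff[of m "- m"] by (auto simp: qint_def)

section \<open>Weights as subsets of {1..n+1}\<close>

text \<open>For the weights \<open>\<lambda>\<^sub>i - \<Sum> m\<^sub>l \<alpha>\<^sub>l\<close> of the \<open>i\<close>-th exterior power of the vector representation,
  \<open>eps i m\<close> is the indicator function of the corresponding \<open>i\<close>-element subset of \<open>{1..n+1}\<close>.\<close>

definition eps :: "nat \<Rightarrow> (nat \<Rightarrow> int) \<Rightarrow> nat \<Rightarrow> int" where
  "eps i m l = (if l \<le> i then 1 else 0) - m l + m (l - 1)"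

text \<open>This is (\<mu>, \<alpha>_l) in the coordinates \<open>eps\<close>;
  \<open>pairing_eq\<close> gives the same number through the Cartan matrix.\<close>

definition pairing :: "nat \<Rightarrow> (nat \<Rightarrow> int) \<Rightarrow> nat \<Rightarrow> int" where
  "pairing i m l = eps i m l - eps i m (Suc l)"

text \<open>The two boundary values make the sum of \<open>eps i m\<close> over {1..n+1} telescope
  to \<open>i\<close>, so 0/1 values single out exactly the \<open>i\<close>-element
  subsets.\<close>

definition admissible :: "nat \<Rightarrow> nat \<Rightarrow> (nat \<Rightarrow> int) \<Rightarrow> bool" where
  "admissible n i m \<longleftrightarrow> m 0 = 0 \<and> m (Suc n) = 0 \<and> (\<forall>l \<in> {1..Suc n}. eps i m l \<in> {0, 1})"

lemma pairing_eq: "l \<ge> 1 \<Longrightarrow> pairing i m l = (if l = i then 1 else 0) - 2 * m l + m (l - 1) + m (Suc l)"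
  by (auto simp: pairing_def eps_def)

lemma admissible_0:
  assumes "i \<in> {1..n}" shows "admissible n i (\<lambda>_. 0)"
  by (simp add: admissible_def eps_def)

lemma admissible_pairing: "admissible n i m \<Longrightarrow> l \<in> {1..n} \<Longrightarrow> pairing i m l \<in> {- 1, 0, 1}"
proof -
  assume "admissible n i m" "l \<in> {1..n}"
  then have "eps i m l \<in> {0, 1}" "eps i m (Suc l) \<in> {0, 1}" by (auto simp: admissible_def)
  then show ?thesis by (auto simp: pairing_def)
qed

lemma pairing_update:
  assumes "j \<in> {1..n}" "l \<in> {1..n}"
  shows "pairing i (m(j := m j + a)) l = pairing i m l - a * cartan l j"
proof -
  obtain k where "l = Suc k" using assms by (cases l) auto
  then show ?thesis by (auto simp: pairing_eq cartan_def)
qed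

text \<open>Pairing 1 means that \<open>j\<close> lies in the subset and \<open>j + 1\<close> does
  not. Raising \<open>m j\<close> exchanges the two.\<close>

lemma admissible_update:
  assumes "admissible n i m" "j \<in> {1..n}" "pairing i m j = 1"
  shows "admissible n i (m(j := m j + 1))"
proof -
  have "eps i m j \<in> {0, 1}" "eps i m (Suc j) \<in> {0, 1}"
    using assms by (auto simp: admissible_def)
  then have e: "eps i m j = 1" "eps i m (Suc j) = 0"
    using assms(3) by (auto simp: pairing_def)
  have "eps i (m(j := m j + 1)) l \<in> {0, 1}" if l: "l \<in> {1..Suc n}" for l
  proof -
    have "eps i m l \<in> {0, 1}" using assms l by (auto simp: admissible_def)
    consider "l = j" | "l = Suc j" | "l \<noteq> j" "l \<noteq> Suc j" by blast
    then show ?thesis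
    proof cases
      case 1
      then show ?thesis using e l assms by (auto simp: eps_def)
    next
      case 2
      then show ?thesis using e l assms by (auto simp: eps_def)
    next
      case 3
      then have "l - 1 \<noteq> j" using l by auto
      then show ?thesis using 3 \<open>eps i m l \<in> {0, 1}\<close> by (simp add: eps_def)
    qed
  qed
  then show ?thesis using assms by (auto simp: admissible_def)
qed

text \<open>Pairing -1 means \<open>eps\<close> is 0 at \<open>j\<close> and 1 at
  \<open>j + 1\<close>. A neighbour \<open>l\<close> shares one of these positions, and there the
  value excludes -1.\<close>

lemma pairing_adjacent:
  assumes "admissible n i m" "j \<in> {1..n}" "l \<in> {1..n}" "pairing i m j = - 1" "cartan l j < 0"
  shows "pairing i m l \<ge> 0"
proof -
  have e: "eps i m k \<in> {0, 1}" if "k \<in> {1..Suc n}" for k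
    using assms that by (auto simp: admissible_def)
  have "eps i m j = 0" "eps i m (Suc j) = 1"
    using e[of j] e[of "Suc j"] assms by (auto simp: pairing_def)
  moreover have "l = Suc j \<or> j = Suc l" using assms(5) by (auto simp: cartan_def split: if_splits)
  ultimately show ?thesis
    using e[of l] e[of "Suc l"] assms by (auto simp: pairing_def)
qed

text \<open>The coefficients l (n + 1 - l) are those of the sum 2\<rho> of the positive roots in
  terms of simple roots, and (2\<rho>, \<alpha>_j) = 2.\<close>

lemma sum_dominant_cartan:
  assumes "j \<in> {1..n}"
  shows "(\<Sum>l = 1..n. int l * (int (Suc n) - int l) * cartan l j) = 2"
proof -
  have "(\<Sum>l = 1..n. of_int (cartan j l) * (int l * (int (Suc n) - int l))) = 2"
    by (subst sum_cartan[OF assms]) (use assms in \<open>auto simp: of_nat_diff algebra_simps\<close>)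
  then show ?thesis by (simp add: cartan_sym[of j] mult.commute)
qed

lemma linear_add_scale:
  assumes "Vector_Spaces.linear s1 s2 h"
  shows "h (x + y) = h x + h y" and "h (s1 c x) = s2 c (h x)"
proof -
  interpret Vector_Spaces.linear s1 s2 h by fact
  show "h (x + y) = h x + h y" "h (s1 c x) = s2 c (h x)" by (rule add, rule scale)
qed

section \<open>Consequences of the module axioms\<close>

locale fund_module =
  fixes n i :: nat and scale :: "qf \<Rightarrow> 'v \<Rightarrow> 'v::ab_group_add"
    and e f K Kinv :: "nat \<Rightarrow> 'v \<Rightarrow> 'v" and v :: 'v
  assumes i: "i \<in> {1..n}" and fund: "is_fund_module n i scale e f K Kinv v"
begin

sublocale vector_space scale
  using fund by (simp add: is_fund_module_def Uq_module_def)

context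
  fixes j assumes j: "j \<in> {1..n}"
begin

lemma linear_ops:
  "Vector_Spaces.linear scale scale (e j)" "Vector_Spaces.linear scale scale (f j)"
  "Vector_Spaces.linear scale scale (K j)" "Vector_Spaces.linear scale scale (Kinv j)"
  using fund j by (simp_all add: is_fund_module_def Uq_module_def)

lemma op_scale:
  "e j (scale c w) = scale c (e j w)" "f j (scale c w) = scale c (f j w)"
  "K j (scale c w) = scale c (K j w)" "Kinv j (scale c w) = scale c (Kinv j w)"
  by (rule linear_add_scale(2)[OF linear_ops(1)] linear_add_scale(2)[OF linear_ops(2)]
      linear_add_scale(2)[OF linear_ops(3)] linear_add_scale(2)[OF linear_ops(4)])+

lemma op_zero: "e j 0 = 0" "f j 0 = 0" "K j 0 = 0" "Kinv j 0 = 0"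
  using op_scale[of 0 0] by simp_all

lemma op_add:
  "e j (w + w') = e j w + e j w'" "f j (w + w') = f j w + f j w'"
  "K j (w + w') = K j w + K j w'" "Kinv j (w + w') = Kinv j w + Kinv j w'"
  by (rule linear_add_scale(1)[OF linear_ops(1)] linear_add_scale(1)[OF linear_ops(2)]
      linear_add_scale(1)[OF linear_ops(3)] linear_add_scale(1)[OF linear_ops(4)])+

lemma op_diff:
  "e j (w - w') = e j w - e j w'" "f j (w - w') = f j w - f j w'"
  "K j (w - w') = K j w - K j w'" "Kinv j (w - w') = Kinv j w - Kinv j w'"
  using op_add[of "w - w'" w'] by simp_all

lemma Kinv_eigen:
  assumes "K j w = scale (qq powi a) w"
  shows "Kinv j w = scale (qq powi (- a)) w"
proof -
  have "w = Kinv j (K j w)" using fund j by (simp add: is_fund_module_def Uq_module_def)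
  also have "\<dots> = scale (qq powi a) (Kinv j w)" by (simp add: assms op_scale)
  finally have "scale (qq powi (- a)) w = scale (qq powi (- a) * qq powi a) (Kinv j w)"
    by (metis scale_scale)
  then show ?thesis by (simp add: power_int_minus)
qed

lemma e_f_relation:
  assumes "l \<in> {1..n}"
  shows "e l (f j w) - f j (e l w) =
    (if l = j then scale (1 / (qq - qq powi (- 1))) (K l w - Kinv l w) else 0)"
  using fund j assms unfolding is_fund_module_def Uq_module_def by blast

lemma e_f_commute: "l \<in> {1..n} \<Longrightarrow> l \<noteq> j \<Longrightarrow> e l (f j w) = f j (e l w)"
  using e_f_relation[of l w] by simp

lemma e_f_same:
  assumes "K j w = scale (qq powi a) w"
  shows "e j (f j w) = f j (e j w) + scale (qint a) w"
proof -
  have "e j (f j w) - f j (e j w) = scale (1 / (qq - qq powi (- 1))) (K j w - Kinv j w)"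
    using e_f_relation[OF j] by simp
  also have "\<dots> = scale (qint a) w"
    by (simp add: assms Kinv_eigen[OF assms] qint_def flip: scale_left_diff_distrib)
  finally show ?thesis by (simp add: algebra_simps)
qed

lemma K_f:
  assumes l: "l \<in> {1..n}" and w: "K l w = scale (qq powi a) w"
  shows "K l (f j w) = scale (qq powi (a - cartan l j)) (f j w)"
proof -
  have "K l (f j (Kinv l y)) = scale (qq powi (- cartan l j)) (f j y)" for y
    using fund j l unfolding is_fund_module_def Uq_module_def by blast
  then have "K l (f j (Kinv l (K l w))) = scale (qq powi (- cartan l j)) (f j (K l w))" .
  moreover have "Kinv l (K l w) = w" using fund l by (simp add: is_fund_module_def Uq_module_def)
  ultimately show ?thesis by (simp add: w op_scale flip: power_int_add)
qed

text \<open>For orthogonal simple roots the q-Serre relation has \<open>m = 1\<close> and is the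
  commutator.\<close>

lemma e_e_commute:
  assumes "l \<in> {1..n}" "l \<noteq> j" "cartan l j = 0"
  shows "e l (e j w) = e j (e l w)"
proof -
  have "q_serre n scale e" using fund by (simp add: is_fund_module_def Uq_module_def)
  then have "\<forall>w. let m = nat (1 - cartan l j) in
     (\<Sum>s = 0..m. scale ((- 1) ^ s * (qfact m / (qfact s * qfact (m - s))))
          ((e l ^^ (m - s)) (e j ((e l ^^ s) w)))) = 0"
    unfolding q_serre_def using assms(1,2) j by blast
  then have "(\<Sum>s = 0..1. scale ((- 1) ^ s * (qfact 1 / (qfact s * qfact (1 - s))))
      ((e l ^^ (1 - s)) (e j ((e l ^^ s) w)))) = 0"
    unfolding Let_def assms(3) by (simp del: One_nat_def add: One_nat_def[symmetric])
  moreover have "qfact 0 = 1" "qfact 1 = 1" by (simp_all add: qfact_def)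
  ultimately show ?thesis by simp
qed

end

text \<open>This is the Cartan element q^(2\<rho>). On a vector of weight \<mu> it acts by q to the
  power (2\<rho>, \<mu>), which is \<open>rho_weight\<close>, and every \<open>f j\<close> lowers
  this exponent by 2. So one operator measures the depth of a weight.\<close>

definition rho_op :: "'v \<Rightarrow> 'v" where
  "rho_op = fold (\<lambda>l. K l ^^ (l * (Suc n - l))) [1..<Suc n]"

definition rho_weight :: "(nat \<Rightarrow> int) \<Rightarrow> int" where
  "rho_weight a = (\<Sum>l = 1..n. int l * (int (Suc n) - int l) * a l)"

lemma rho_op_linear:
  "rho_op (scale c w) = scale c (rho_op w)" "rho_op (w + w') = rho_op w + rho_op w'"
proof -
  have p: "(K l ^^ k) (scale c w) = scale c ((K l ^^ k) w)"
    "(K l ^^ k) (w + w') = (K l ^^ k) w + (K l ^^ k) w'" if "l \<in> {1..n}" for l k c w w'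
    by (induction k) (use that in \<open>simp_all add: op_scale op_add\<close>)
  have "fold (\<lambda>l. K l ^^ (l * (Suc n - l))) xs (scale c w) = scale c (fold (\<lambda>l. K l ^^ (l * (Suc n - l))) xs w)"
    "fold (\<lambda>l. K l ^^ (l * (Suc n - l))) xs (w + w') =
       fold (\<lambda>l. K l ^^ (l * (Suc n - l))) xs w + fold (\<lambda>l. K l ^^ (l * (Suc n - l))) xs w'"
    if "set xs \<subseteq> {1..n}" for xs
    using that by (induction xs arbitrary: w w') (simp_all add: p)
  from this[of "[1..<Suc n]"]
  show "rho_op (scale c w) = scale c (rho_op w)" "rho_op (w + w') = rho_op w + rho_op w'"
    by (simp_all add: rho_op_def atLeastLessThanSuc_atLeastAtMost del: upt_Suc)
qed

lemma rho_op_eigen: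
  assumes "\<And>l. l \<in> {1..n} \<Longrightarrow> K l w = scale (qq powi a l) w"
  shows "rho_op w = scale (qq powi rho_weight a) w"
proof -
  have p: "(K l ^^ k) (scale c w) = scale (c * qq powi (int k * a l)) w" if "l \<in> {1..n}" for l k c
    by (induction k) (use that in \<open>simp_all add: op_scale assms algebra_simps power_int_add\<close>)
  have "fold (\<lambda>l. K l ^^ (l * (Suc n - l))) xs (scale c w) =
     scale (c * qq powi (\<Sum>l\<leftarrow>xs. int l * (int (Suc n) - int l) * a l)) w" if "set xs \<subseteq> {1..n}" for xs c
    using that
  proof (induction xs arbitrary: c)
    case (Cons l xs)
    have "int (l * (Suc n - l)) = int l * (int (Suc n) - int l)" using Cons.prems by (auto simp: of_nat_diff)
    then show ?case using Cons by (simp add: p power_int_add mult.assoc del: of_nat_mult of_nat_Suc)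
  qed simp
  from this[of "[1..<Suc n]" 1] show ?thesis
    by (simp add: rho_op_def rho_weight_def interv_sum_list_conv_sum_set_nat
        atLeastLessThanSuc_atLeastAtMost del: upt_Suc)
qed

text \<open>The product of \<open>rho_op\<close> minus q^(T - k) over k = 1, ..., N, with T = i (n +
  1 - i) the exponent on \<open>v\<close>. It kills vectors of exponents T - 1, ..., T - N but not
  \<open>v\<close>; thus sums of weight vectors are handled without a weight space
  decomposition.\<close>

primrec rho_annihilator :: "nat \<Rightarrow> 'v \<Rightarrow> 'v" where
  "rho_annihilator 0 w = w"
| "rho_annihilator (Suc N) w = rho_op (rho_annihilator N w) -
     scale (qq powi (int i * (int (Suc n) - int i) - int (Suc N))) (rho_annihilator N w)"

lemma rho_op_zero: "rho_op 0 = 0"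
  using rho_op_linear(1)[of 0 0] by simp

lemma rho_annihilator_linear:
  "rho_annihilator N (scale c w) = scale c (rho_annihilator N w)"
  "rho_annihilator N (w + w') = rho_annihilator N w + rho_annihilator N w'"
  by (induction N)
     (simp_all add: rho_op_linear scale_right_diff_distrib scale_left_commute algebra_simps)

lemma rho_annihilator_mono: "rho_annihilator N w = 0 \<Longrightarrow> N \<le> N' \<Longrightarrow> rho_annihilator N' w = 0"
  by (induction N') (auto simp: rho_op_zero elim!: le_SucE)

lemma rho_annihilator_eigen:
  assumes "rho_op w = scale (qq powi t) w"
  shows "rho_annihilator N w =
    scale (\<Prod>k = 1..N. qq powi t - qq powi (int i * (int (Suc n) - int i) - int k)) w"
  by (induction N) (simp_all add: rho_op_linear assms scale_left_diff_distrib algebra_simps)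


text \<open>Since the eigenvalue of the operator \<open>rho_op\<close> on \<open>v\<close> does not occur on the submodule
  generated by a singular vector of smaller weight, this submodule is proper.\<close>

lemma singular_vector_zero:
  assumes e0: "\<And>l. l \<in> {1..n} \<Longrightarrow> e l x = 0"
    and K: "\<And>l. l \<in> {1..n} \<Longrightarrow> K l x = scale (qq powi a l) x"
    and a: "rho_weight a < int i * (int (Suc n) - int i)"
  shows "x = 0"
proof -
  define T where "T = int i * (int (Suc n) - int i)"
  \<comment> \<open>The span of \<open>G\<close> is the submodule generated by \<open>x\<close>:
    closure under \<open>f\<close> is built in, closure under \<open>K\<close> holds because the
    elements are weight vectors, and closure under \<open>e\<close> is the point to prove.\<close>
  define G where "G = {fold f ks x | ks. set ks \<subseteq> {1..n}}"
  have G_f: "f l y \<in> G" if "y \<in> G" "l \<in> {1..n}" for y l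
  proof -
    obtain ks where "y = fold f ks x" "set ks \<subseteq> {1..n}" using \<open>y \<in> G\<close> by (auto simp: G_def)
    then have "f l y = fold f (ks @ [l]) x" "set (ks @ [l]) \<subseteq> {1..n}" using that by auto
    then show ?thesis unfolding G_def by blast
  qed
  have weights: "\<exists>b. (\<forall>l \<in> {1..n}. K l (fold f ks x) = scale (qq powi b l) (fold f ks x)) \<and>
      rho_weight b = rho_weight a - 2 * int (length ks)" if "set ks \<subseteq> {1..n}" for ks
    using that
  proof (induction ks rule: rev_induct)
    case (snoc j ks)
    then obtain b where b: "\<forall>l \<in> {1..n}. K l (fold f ks x) = scale (qq powi b l) (fold f ks x)"
      "rho_weight b = rho_weight a - 2 * int (length ks)" by auto
    have "rho_weight (\<lambda>l. b l - cartan l j) = rho_weight b - 2"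
      using sum_dominant_cartan[of j n] snoc.prems
      by (simp add: rho_weight_def right_diff_distrib sum_subtractf)
    then show ?case using b snoc.prems
      by (intro exI[of _ "\<lambda>l. b l - cartan l j"]) (auto simp: K_f)
  qed (use K in auto)
  have span_op: "h y \<in> span G" if "y \<in> span G" "Vector_Spaces.linear scale scale h" "\<And>y. y \<in> G \<Longrightarrow> h y \<in> span G" for h y
    using that(1)
  proof (induction rule: span_induct_alt)
    case base
    have "h (scale 0 0) = scale 0 (h 0)" by (rule linear_add_scale(2)[OF that(2)])
    then show ?case by (simp add: span_zero)
  next
    case (step c y z)
    then show ?case using that(3)
      by (simp add: linear_add_scale[OF that(2)] span_add span_scale)
  qed
  \<comment> \<open>Move \<open>e l\<close> inwards past the operators \<open>f\<close>. Each
    commutator leaves a multiple of a shorter product, and at the end \<open>e l\<close> kills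
    \<open>x\<close>.\<close>
  have G_e: "e l (fold f ks x) \<in> span G" if "l \<in> {1..n}" "set ks \<subseteq> {1..n}" for l ks
    using that(2)
  proof (induction ks rule: rev_induct)
    case Nil
    then show ?case using e0 that by (simp add: span_zero)
  next
    case (snoc j ks)
    let ?y = "fold f ks x"
    have j: "j \<in> {1..n}" and y: "?y \<in> G" using snoc.prems by (auto simp: G_def)
    have *: "f j (e l ?y) \<in> span G"
    proof (rule span_op[OF _ linear_ops(2)[OF j]])
      show "e l ?y \<in> span G" using snoc by simp
      show "f j y \<in> span G" if "y \<in> G" for y using G_f[OF that j] by (rule span_base)
    qed
    show ?case
    proof (cases "l = j")
      case True
      obtain b where "\<forall>l \<in> {1..n}. K l ?y = scale (qq powi b l) ?y"
        using weights[of ks] snoc.prems by auto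
      then have "e l (f j ?y) = f j (e j ?y) + scale (qint (b j)) ?y"
        using True j e_f_same by blast
      moreover have "f j (e j ?y) + scale (qint (b j)) ?y \<in> span G"
        using * True by (intro span_add span_scale span_base[OF y]) simp
      ultimately show ?thesis using True by simp
    next
      case False
      then show ?thesis using * e_f_commute[OF j that(1) False] by simp
    qed
  qed
  have W: "span G = {0} \<or> span G = UNIV"
  proof -
    have "e l y \<in> span G" "f l y \<in> span G" "K l y \<in> span G" "Kinv l y \<in> span G"
      if l: "l \<in> {1..n}" and y: "y \<in> span G" for l y
    proof -
      show "e l y \<in> span G"
        by (rule span_op[OF y linear_ops(1)[OF l]]) (use l G_e in \<open>auto simp: G_def\<close>)
      show "f l y \<in> span G"
        by (rule span_op[OF y linear_ops(2)[OF l]]) (use l G_f in \<open>auto intro: span_base\<close>)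
      have "K l y \<in> span G \<and> Kinv l y \<in> span G" if "y \<in> G" for y
      proof -
        obtain ks where ks: "y = fold f ks x" "set ks \<subseteq> {1..n}" using \<open>y \<in> G\<close> by (auto simp: G_def)
        then obtain b where "K l y = scale (qq powi b) y" using weights[of ks] l by blast
        then show ?thesis using Kinv_eigen[OF l, of y b] span_scale[OF span_base[OF \<open>y \<in> G\<close>]] by simp
      qed
      then show "K l y \<in> span G" "Kinv l y \<in> span G"
        using span_op[OF y linear_ops(3)[OF l]] span_op[OF y linear_ops(4)[OF l]] by blast+
    qed
    then have "\<forall>l \<in> {1..n}. e l ` span G \<subseteq> span G \<and> f l ` span G \<subseteq> span G \<and>
        K l ` span G \<subseteq> span G \<and> Kinv l ` span G \<subseteq> span G"
      by blast
    then show ?thesis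
      using fund unfolding is_fund_module_def Uq_irreducible_def by blast
  qed
  \<comment> \<open>Every element of the span is a finite sum of vectors with exponents below T, so
    one sufficiently long product kills it; no such product kills \<open>v\<close>.\<close>
  have "\<exists>N. rho_annihilator N y = 0" if "y \<in> span G" for y
    using that
  proof (induction rule: span_induct_alt)
    case base
    show ?case by (intro exI[of _ 0]) simp
  next
    case (step c y z)
    then obtain ks where ks: "y = fold f ks x" "set ks \<subseteq> {1..n}" by (auto simp: G_def)
    then obtain b where b: "\<forall>l \<in> {1..n}. K l y = scale (qq powi b l) y"
      "rho_weight b = rho_weight a - 2 * int (length ks)"
      using weights by blast
    define k where "k = nat (T - rho_weight b)"
    have k: "rho_weight b = T - int k" "k \<ge> 1" using a b(2) by (auto simp: k_def T_def)
    have "rho_op y = scale (qq powi (T - int k)) y" using rho_op_eigen[of y b] b k by simp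
    then have "rho_annihilator k y = 0"
      using k by (subst rho_annihilator_eigen) (auto simp: T_def intro!: bexI[of _ k])
    moreover obtain N where "rho_annihilator N z = 0" using step by blast
    ultimately have "rho_annihilator (max k N) y = 0" "rho_annihilator (max k N) z = 0"
      using rho_annihilator_mono max.cobounded1 max.cobounded2 by blast+
    then show ?case by (intro exI[of _ "max k N"]) (simp add: rho_annihilator_linear)
  qed
  moreover have "rho_annihilator N v \<noteq> 0" for N
  proof -
    have "K l v = scale (qq powi (if l = i then 1 else 0)) v" if "l \<in> {1..n}" for l
      using fund that by (simp add: is_fund_module_def)
    from rho_op_eigen[OF this]
    have "rho_op v = scale (qq powi T) v"
      using i by (simp add: rho_weight_def T_def if_distrib cong: if_cong)
    moreover have "v \<noteq> 0" using fund by (simp add: is_fund_module_def)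
    ultimately show ?thesis
      by (subst rho_annihilator_eigen) (auto simp: T_def qq_powi_eq_iff)
  qed
  ultimately have "span G \<noteq> UNIV" by blast
  then have "span G = {0}" using W by blast
  moreover have "fold f [] x \<in> G" unfolding G_def by (intro CollectI exI[of _ "[]"]) simp
  then have "x \<in> span G" by (auto intro: span_base)
  ultimately show ?thesis by blast
qed

text \<open>Only steps of pairing 1 are taken, so the weights stay minuscule. \<open>m\<close>
  counts the uses of each \<open>f j\<close>, and the total \<open>N\<close> is the induction
  measure. Vectors with the same \<open>m\<close> reached along different paths are not assumed
  proportional, nor is \<open>w\<close> required to be nonzero.\<close>

inductive pathvec :: "nat \<Rightarrow> (nat \<Rightarrow> int) \<Rightarrow> 'v \<Rightarrow> bool" where
  pathvec_0: "pathvec 0 (\<lambda>_. 0) v"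
| pathvec_Suc: "pathvec N m w \<Longrightarrow> j \<in> {1..n} \<Longrightarrow> pairing i m j = 1 \<Longrightarrow>
    pathvec (Suc N) (m(j := m j + 1)) (f j w)"

lemma pathvec_admissible: "pathvec N m w \<Longrightarrow> admissible n i m"
proof (induction rule: pathvec.induct)
  case pathvec_0
  show ?case by (rule admissible_0[OF i])
next
  case (pathvec_Suc N m w j)
  show ?case by (rule admissible_update[OF pathvec_Suc.IH pathvec_Suc.hyps(2,3)])
qed

lemma pathvec_weight:
  "pathvec N m w \<Longrightarrow> l \<in> {1..n} \<Longrightarrow> K l w = scale (qq powi pairing i m l) w"
proof (induction rule: pathvec.induct)
  case pathvec_0
  then show ?case using fund by (auto simp: is_fund_module_def pairing_eq)
next
  case (pathvec_Suc N m w j)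
  then show ?case using pairing_update[of j n l i m 1] by (simp add: K_f fun_upd_def)
qed

lemma pathvec_rho_weight:
  "pathvec N m w \<Longrightarrow> rho_weight (pairing i m) = int i * (int (Suc n) - int i) - 2 * int N"
proof (induction rule: pathvec.induct)
  case pathvec_0
  have "rho_weight (pairing i (\<lambda>_. 0)) = rho_weight (\<lambda>l. if l = i then 1 else 0)"
    by (auto simp: rho_weight_def pairing_eq intro!: sum.cong)
  then show ?case using i by (simp add: rho_weight_def if_distrib cong: if_cong)
next
  case (pathvec_Suc N m w j)
  have "rho_weight (pairing i (m(j := m j + 1))) = rho_weight (\<lambda>l. pairing i m l - cartan l j)"
    unfolding rho_weight_def
    by (rule sum.cong[OF refl]) (use pathvec_Suc pairing_update[of j n _ i m 1] in auto)
  also have "\<dots> = rho_weight (pairing i m) - 2"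
    using sum_dominant_cartan[of j n] pathvec_Suc
    by (simp add: rho_weight_def right_diff_distrib sum_subtractf)
  finally show ?case using pathvec_Suc by (simp add: fun_upd_def)
qed

text \<open>The last two claims hold because \<open>w - f\<^sub>j e\<^sub>j w\<close> and \<open>f\<^sub>j w\<close> turn out to be singular vectors, by the
  claims for smaller \<open>N\<close>.\<close>

lemma pathvec_actions_all:
  "pathvec N m w \<Longrightarrow> (\<forall>l \<in> {1..n}. (pairing i m l \<ge> 0 \<longrightarrow> e l w = 0) \<and>
     (pairing i m l = - 1 \<longrightarrow> (\<exists>c w'. N > 0 \<and> pathvec (N - 1) (m(l := m l - 1)) w' \<and> e l w = scale c w'))) \<and>
    (\<forall>j \<in> {1..n}. pairing i m j = - 1 \<longrightarrow> f j (e j w) = w) \<and>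
    (\<forall>j \<in> {1..n}. pairing i m j \<le> 0 \<longrightarrow> f j w = 0)"
proof (induction N arbitrary: m w rule: less_induct)
  case (less N)
  note IH1 = less.IH[THEN conjunct1] and IH2 = less.IH[THEN conjunct2, THEN conjunct1]
    and IH3 = less.IH[THEN conjunct2, THEN conjunct2]
  note adm = pathvec_admissible[OF less.prems]
  note KW = pathvec_weight[OF less.prems]
  have dn: "pairing i (m(j := m j - 1)) l = pairing i m l + cartan l j"
    if "j \<in> {1..n}" "l \<in> {1..n}" for m :: "nat \<Rightarrow> int" and j l
    using pairing_update[OF that, of i m "- 1"] by simp
  have cartan_nonpos: "cartan l j \<le> 0" "cartan l j \<noteq> 0 \<Longrightarrow> cartan l j = - 1" if "l \<noteq> j" for l j
    using that by (auto simp: cartan_def split: if_splits)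
  have A: "\<forall>l \<in> {1..n}. (pairing i m l \<ge> 0 \<longrightarrow> e l w = 0) \<and>
     (pairing i m l = - 1 \<longrightarrow> (\<exists>c w'. N > 0 \<and> pathvec (N - 1) (m(l := m l - 1)) w' \<and> e l w = scale c w'))"
  proof
    fix l assume l: "l \<in> {1..n}"
    let ?goal = "(pairing i m l \<ge> 0 \<longrightarrow> e l w = 0) \<and>
     (pairing i m l = - 1 \<longrightarrow> (\<exists>c w'. N > 0 \<and> pathvec (N - 1) (m(l := m l - 1)) w' \<and> e l w = scale c w'))"
    from less.prems show ?goal
    proof cases
      case pathvec_0
      then show ?thesis using fund l by (auto simp: is_fund_module_def pairing_eq)
    next
      case (pathvec_Suc N' m0 w0 j)
      then have N': "N' < N" and w0: "pathvec N' m0 w0" and j: "j \<in> {1..n}" and p0: "pairing i m0 j = 1"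
        by auto
      have m: "pairing i m l = pairing i m0 l - cartan l j"
        using pairing_update[OF j l, of i m0 1] pathvec_Suc by simp
      have IH: "(pairing i m0 k \<ge> 0 \<longrightarrow> e k w0 = 0) \<and> (pairing i m0 k = - 1 \<longrightarrow>
        (\<exists>c w'. N' > 0 \<and> pathvec (N' - 1) (m0(k := m0 k - 1)) w' \<and> e k w0 = scale c w'))" if "k \<in> {1..n}" for k
        using IH1[OF N' w0] that by blast
      show ?thesis
      proof (cases "l = j")
        case True
        \<comment> \<open>The last step is undone by \<open>e j\<close>, because
          \<open>e j w0 = 0\<close> and [1] = 1.\<close>
        have "e j w = w0"
          using e_f_same[OF j pathvec_weight[OF w0 j]] IH[OF j] p0 pathvec_Suc by (simp add: op_zero[OF j])
        moreover have "m(j := m j - 1) = m0" using pathvec_Suc by auto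
        ultimately show ?thesis using m p0 True w0 pathvec_Suc
          by (auto simp: cartan_def intro!: exI[of _ 1] exI[of _ w0])
      next
        case False
        have ew: "e l w = f j (e l w0)" using e_f_commute[OF j l False] pathvec_Suc by simp
        consider "pairing i m0 l \<ge> 0" | "pairing i m0 l = - 1"
          using admissible_pairing[OF pathvec_admissible[OF w0] l] by auto
        then show ?thesis
        proof cases
          case 1
          then show ?thesis using IH[OF l] ew m cartan_nonpos[OF False] by (auto simp: op_zero[OF j])
        next
          case 2
          then obtain c w' where w': "N' > 0" "pathvec (N' - 1) (m0(l := m0 l - 1)) w'" "e l w0 = scale c w'"
            using IH[OF l] by blast
          \<comment> \<open>If \<alpha>_l is removed before the step \<open>j\<close>, the pairing
            with \<alpha>_j is 1 + (\<alpha>_l, \<alpha>_j). For orthogonal roots the step is still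
            allowed and yields a path vector of level \<open>N - 1\<close>; for neighbours it is
            not, and the third claim gives \<open>f j w' = 0\<close>.\<close>
          have pj: "pairing i (m0(l := m0 l - 1)) j = 1 + cartan l j"
            using dn[OF l j] p0 cartan_sym by metis
          have ew': "e l w = scale c (f j w')" using ew w' by (simp add: op_scale[OF j])
          show ?thesis
          proof (cases "cartan l j = 0")
            case True
            have "pathvec (Suc (N' - 1)) ((m0(l := m0 l - 1))(j := (m0(l := m0 l - 1)) j + 1)) (f j w')"
              using w' pj True j by (intro pathvec.intros) auto
            moreover have "(m0(l := m0 l - 1))(j := (m0(l := m0 l - 1)) j + 1) = m(l := m l - 1)"
              using pathvec_Suc False by auto
            ultimately have "pathvec (N - 1) (m(l := m l - 1)) (f j w')" using w'(1) pathvec_Suc by simp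
            moreover have "N > 0" using pathvec_Suc by simp
            ultimately show ?thesis using ew' 2 m True by auto
          next
            case nz: False
            then have "pairing i (m0(l := m0 l - 1)) j \<le> 0" using pj cartan_nonpos[OF False] by simp
            moreover have "N' - 1 < N" using N' by simp
            ultimately have "f j w' = 0" using IH3 w'(2) j by blast
            then show ?thesis using ew' m 2 cartan_nonpos(2)[OF False nz] by simp
          qed
        qed
      qed
    qed
  qed
  have D: "\<forall>j \<in> {1..n}. pairing i m j = - 1 \<longrightarrow> f j (e j w) = w"
  proof (intro ballI impI)
    fix j assume j: "j \<in> {1..n}" and pj: "pairing i m j = - 1"
    obtain c w1 where N: "N > 0" and w1: "pathvec (N - 1) (m(j := m j - 1)) w1" and ew: "e j w = scale c w1"
      using A j pj by blast
    have N1: "N - 1 < N" using N by simp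
    have p1: "pairing i (m(j := m j - 1)) j = 1" using dn[OF j j] pj by (simp add: cartan_def)
    have e1: "e l w1 = 0" if "l \<in> {1..n}" "pairing i (m(j := m j - 1)) l \<ge> 0" for l
      using IH1[OF N1 w1] that by blast
    have "w - f j (e j w) = 0"
    proof (rule singular_vector_zero[where a = "pairing i m"])
      show "rho_weight (pairing i m) < int i * (int (Suc n) - int i)"
        using pathvec_rho_weight[OF less.prems] N by simp
    next
      fix l assume l: "l \<in> {1..n}"
      have "K l (f j w1) = scale (qq powi pairing i m l) (f j w1)"
        using K_f[OF j l pathvec_weight[OF w1 l]] dn[OF j l] by simp
      then show "K l (w - f j (e j w)) = scale (qq powi pairing i m l) (w - f j (e j w))"
        by (simp add: ew op_diff[OF l] op_scale[OF l] op_scale[OF j] KW[OF l]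
            scale_right_diff_distrib scale_left_commute)
      show "e l (w - f j (e j w)) = 0"
      proof (cases "l = j")
        case True
        have "e j (f j w1) = w1"
          using e_f_same[OF j pathvec_weight[OF w1 j]] p1 e1[OF j] by (simp add: op_zero[OF j])
        then show ?thesis using True by (simp add: ew op_diff[OF j] op_scale[OF j])
      next
        case False
        have *: "e l (w - f j (e j w)) = e l w - f j (e l (e j w))"
          using e_f_commute[OF j l False] by (simp add: op_diff[OF l])
        show ?thesis
        proof (cases "cartan l j = 0")
          case True
          \<comment> \<open>Here \<open>e l\<close> passes \<open>e j\<close>, and
            \<open>e l w\<close> is zero or a multiple of a vector of level \<open>N - 1\<close>, on
            which \<open>f j\<close> undoes \<open>e j\<close> by the second claim.\<close>
          have comm: "e l (e j w) = e j (e l w)" by (rule e_e_commute[OF j l False True])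
          consider "pairing i m l \<ge> 0" | "pairing i m l = - 1"
            using admissible_pairing[OF adm l] by auto
          then show ?thesis
          proof cases
            case 1
            then have "e l w = 0" using A l by blast
            then show ?thesis using * comm by (simp add: op_zero[OF j])
          next
            case 2
            then obtain c' w2 where w2: "pathvec (N - 1) (m(l := m l - 1)) w2" "e l w = scale c' w2"
              using A l by blast
            have "pairing i (m(l := m l - 1)) j = - 1"
              using dn[OF l j] pj True by (simp add: cartan_sym)
            then have "f j (e j w2) = w2" using IH2[OF N1 w2(1)] j by blast
            then show ?thesis using * comm w2 by (simp add: op_scale[OF j])
          qed
        next
          case nz: False
          have ca: "cartan l j = - 1" by (rule cartan_nonpos(2)[OF False nz])
          then have "pairing i m l \<ge> 0" using pairing_adjacent[OF adm j l pj] by simp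
          then have "e l w = 0" using A l by blast
          \<comment> \<open>If \<open>e l w1\<close> is not zero for weight reasons, it has level
            \<open>N - 2\<close> and \<alpha>_j pairs to 0 with its weight, so the third claim
            applies.\<close>
          moreover have "f j (e l w1) = 0"
          proof -
            consider "pairing i (m(j := m j - 1)) l \<ge> 0" | "pairing i (m(j := m j - 1)) l = - 1"
              using admissible_pairing[OF pathvec_admissible[OF w1] l] by auto
            then show ?thesis
            proof cases
              case 1
              then show ?thesis using e1[OF l] by (simp add: op_zero[OF j])
            next
              case 2
              let ?m = "(m(j := m j - 1))(l := (m(j := m j - 1)) l - 1)"
              obtain c' w3 where w3: "N - 1 > 0" "pathvec (N - 1 - 1) ?m w3" "e l w1 = scale c' w3"
                using IH1[OF N1 w1] l 2 by blast
              have "pairing i ?m j = 0" using dn[OF l j, of "m(j := m j - 1)"] p1 ca cartan_sym[of l j] by simp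
              moreover have "N - 1 - 1 < N" using N by simp
              ultimately have "f j w3 = 0" using IH3 w3(2) j by (metis order_refl)
              then show ?thesis using w3 by (simp add: op_scale[OF j])
            qed
          qed
          ultimately show ?thesis using * ew by (simp add: op_scale[OF l] op_scale[OF j])
        qed
      qed
    qed
    then show "f j (e j w) = w" by simp
  qed
  have B: "\<forall>j \<in> {1..n}. pairing i m j \<le> 0 \<longrightarrow> f j w = 0"
  proof (intro ballI impI)
    fix j assume j: "j \<in> {1..n}" and pj: "pairing i m j \<le> 0"
    have pc: "pairing i m j = 0 \<or> pairing i m j = - 1"
      using admissible_pairing[OF adm j] pj by auto
    show "f j w = 0"
    proof (rule singular_vector_zero[where a = "\<lambda>l. pairing i m l - cartan l j"])
      have "rho_weight (\<lambda>l. pairing i m l - cartan l j) = rho_weight (pairing i m) - 2"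
        using sum_dominant_cartan[OF j] by (simp add: rho_weight_def right_diff_distrib sum_subtractf)
      then show "rho_weight (\<lambda>l. pairing i m l - cartan l j) < int i * (int (Suc n) - int i)"
        using pathvec_rho_weight[OF less.prems] by simp
    next
      fix l assume l: "l \<in> {1..n}"
      show "K l (f j w) = scale (qq powi (pairing i m l - cartan l j)) (f j w)"
        by (rule K_f[OF j l KW[OF l]])
      show "e l (f j w) = 0"
      proof (cases "l = j")
        case True
        \<comment> \<open>For pairing 0 both terms vanish; for pairing -1 the first is
          \<open>w\<close> by \<open>D\<close> and the second is [-1] \<open>w\<close>.\<close>
        have "e j (f j w) = f j (e j w) + scale (qint (pairing i m j)) w"
          by (rule e_f_same[OF j KW[OF j]])
        also have "\<dots> = 0" using pc A D j by (auto simp: op_zero[OF j] qint_minus)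
        finally show ?thesis using True by simp
      next
        case False
        have *: "e l (f j w) = f j (e l w)" by (rule e_f_commute[OF j l False])
        consider "pairing i m l \<ge> 0" | "pairing i m l = - 1"
          using admissible_pairing[OF adm l] by auto
        then show ?thesis
        proof cases
          case 1
          then show ?thesis using A l * by (auto simp: op_zero[OF j])
        next
          case 2
          then obtain c w' where w': "N > 0" "pathvec (N - 1) (m(l := m l - 1)) w'" "e l w = scale c w'"
            using A l by blast
          have "pairing i (m(l := m l - 1)) j \<le> 0"
            using dn[OF l j] pj cartan_nonpos(1)[OF False] by (simp add: cartan_sym)
          then have "f j w' = 0" using IH3[OF _ w'(2)] w'(1) j by (metis diff_less zero_less_one)
          then show ?thesis using * w' by (simp add: op_scale[OF j])
        qed
      qed
    qed
  qed
  from A D B show ?case by blast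
qed

lemmas pathvec_actions = pathvec_actions_all[THEN conjunct1]
  pathvec_actions_all[THEN conjunct2, THEN conjunct1]
  pathvec_actions_all[THEN conjunct2, THEN conjunct2]

text \<open>For pairing 1, \<open>e j\<close> kills \<open>w\<close> and sends \<open>f j w\<close>
  back to [1] \<open>w\<close>, so \<open>f j w\<close> cannot be zero.\<close>

lemma pathvec_f_nonzero_iff:
  assumes "pathvec N m w" "j \<in> {1..n}" "w \<noteq> 0"
  shows "f j w \<noteq> 0 \<longleftrightarrow> pairing i m j = 1"
proof
  assume "f j w \<noteq> 0"
  then show "pairing i m j = 1"
    using pathvec_actions(3)[OF assms(1)] admissible_pairing[OF pathvec_admissible[OF assms(1)] assms(2)]
      assms(2) by force
next
  assume p: "pairing i m j = 1"
  then have "e j w = 0" using pathvec_actions(1)[OF assms(1)] assms(2) by simp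
  then have "e j (f j w) = w"
    using e_f_same[OF assms(2) pathvec_weight[OF assms(1,2)]] p by (simp add: op_zero[OF assms(2)])
  then show "f j w \<noteq> 0" using assms by (auto simp: op_zero)
qed

end

section \<open>Exponentials of operators on the symmetric algebra\<close>

lemma sum_triangle_swap:
  fixes F :: "nat \<Rightarrow> nat \<Rightarrow> 'a::comm_monoid_add"
  shows "(\<Sum>r = 1..m. \<Sum>s = 1..m - r. F r s) = (\<Sum>s = 1..m. \<Sum>r = 1..m - s. F r s)"
proof -
  have "(\<Sum>s = 1..m - r. F r s) = (\<Sum>s = 1..m. if r + s \<le> m then F r s else 0)" for r
    by (rule sum.mono_neutral_cong_left) auto
  moreover have "(\<Sum>r = 1..m - s. F r s) = (\<Sum>r = 1..m. if r + s \<le> m then F r s else 0)" for s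
    by (rule sum.mono_neutral_cong_left) auto
  ultimately show ?thesis by (simp only:) (rule sum.swap)
qed

lemma sum_convolution_swap1:
  fixes F :: "nat \<Rightarrow> nat \<Rightarrow> nat \<Rightarrow> 'a::comm_monoid_add"
  shows "(\<Sum>a\<le>m. \<Sum>r = 1..a. F r (a - r) (m - a)) = (\<Sum>r = 1..m. \<Sum>a\<le>m - r. F r a (m - r - a))"
  unfolding sum.Sigma[OF finite_atMost ballI[OF finite_atLeastAtMost]]
    sum.Sigma[OF finite_atLeastAtMost ballI[OF finite_atMost]]
  by (rule sum.reindex_bij_witness[where i = "\<lambda>(r, a). (a + r, r)" and j = "\<lambda>(a, r). (r, a - r)"]) auto

lemma sum_convolution_swap2:
  fixes F :: "nat \<Rightarrow> nat \<Rightarrow> nat \<Rightarrow> 'a::comm_monoid_add"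
  shows "(\<Sum>a\<le>m. \<Sum>r = 1..m - a. F r a (m - a - r)) = (\<Sum>r = 1..m. \<Sum>a\<le>m - r. F r a (m - r - a))"
  unfolding sum.Sigma[OF finite_atMost ballI[OF finite_atLeastAtMost]]
    sum.Sigma[OF finite_atLeastAtMost ballI[OF finite_atMost]]
  by (rule sum.reindex_bij_witness[where i = "\<lambda>(r, a). (a, r)" and j = "\<lambda>(a, r). (r, a)"])
     (auto simp: diff_commute add.commute)

lemma of_nat_qf: "(of_nat k :: qf) = Fract (of_nat k) 1"
  by (induction k) (simp_all add: Zero_fract_def One_fract_def)

lemma of_nat_qf_eq_0_iff [simp]: "(of_nat k :: qf) = 0 \<longleftrightarrow> k = 0"
  by (simp add: of_nat_qf Zero_fract_def eq_fract)

lemma kconst_0 [simp]: "kconst 0 = 0" and kconst_1 [simp]: "kconst 1 = 1"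
  by (simp_all add: kconst_def)

lemma kconst_add: "kconst (a + b) = kconst a + kconst b"
  by (simp add: kconst_def single_add)

lemma kconst_of_nat: "kconst (of_nat k) = of_nat k"
  by (induction k) (simp_all add: kconst_add)

lemma kconst_mult_left: "kconst a * (kconst b * u) = kconst (a * b) * u"
  by (simp add: kconst_mult mult.assoc)

text \<open>Characteristic zero: this is what allows the recursions below to be solved for their
  \<open>m\<close>-th coefficient.\<close>

lemma of_nat_kalg_cancel:
  fixes x y :: kalg
  assumes "of_nat m * x = of_nat m * y" and "m > 0"
  shows "x = y"
proof -
  have "(of_nat m :: qf) \<noteq> 0" using assms(2) by simp
  then have "z = kconst (1 / of_nat m) * (of_nat m * z)" for z :: kalg
    by (simp add: kconst_mult_left flip: kconst_of_nat)
  then show ?thesis using assms(1) by metis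
qed

section \<open>Exponentials through their differential equation\<close>

definition klinear :: "(kalg \<Rightarrow> kalg) \<Rightarrow> bool" where
  "klinear T \<longleftrightarrow> (\<forall>u w. T (u + w) = T u + T w) \<and> (\<forall>c u. T (kconst c * u) = kconst c * T u)"

lemma klinear_add: "klinear T \<Longrightarrow> T (u + w) = T u + T w"
  and klinear_scale: "klinear T \<Longrightarrow> T (kconst c * u) = kconst c * T u"
  by (simp_all add: klinear_def)

lemma klinear_0: "klinear T \<Longrightarrow> T 0 = 0"
  using klinear_add[of T 0 0] by simp

lemma klinear_sum: "klinear T \<Longrightarrow> T (sum g A) = (\<Sum>x\<in>A. T (g x))"
  by (induction A rule: infinite_finite_induct) (simp_all add: klinear_0 klinear_add)

lemma klinear_of_nat: "klinear T \<Longrightarrow> T (of_nat k * u) = of_nat k * T u"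
  using klinear_scale[of T "of_nat k" u] by (simp add: kconst_of_nat)

text \<open>\<open>kpow\<close> and \<open>kexp\<close> repeat \<open>op_pow\<close> and
  \<open>op_exp\<close> on a single component in K(1), where all computations take place;
  \<open>lookup_op_exp\<close> transfers the results.\<close>

primrec kpow :: "(nat \<Rightarrow> kalg \<Rightarrow> kalg) \<Rightarrow> nat \<Rightarrow> nat \<Rightarrow> kalg \<Rightarrow> kalg" where
  "kpow D 0 m u = (if m = 0 then u else 0)"
| "kpow D (Suc k) m u = (\<Sum>r = 1..m. D r (kpow D k (m - r) u))"

definition kexp :: "(nat \<Rightarrow> kalg \<Rightarrow> kalg) \<Rightarrow> nat \<Rightarrow> kalg \<Rightarrow> kalg" where
  "kexp D m u = (\<Sum>k \<le> m. kconst (1 / of_nat (fact k)) * kpow D k m u)"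

lemma kpow_eq_0: "m < k \<Longrightarrow> (\<And>r. klinear (D r)) \<Longrightarrow> kpow D k m u = 0"
proof (induction k arbitrary: m)
  case (Suc k)
  have "D r (kpow D k (m - r) u) = 0" if "r \<in> {1..m}" for r
    using Suc that by (subst Suc.IH) (auto intro: klinear_0)
  then show ?case by simp
qed simp

text \<open>Coefficient of w^m in w (d/dw) A^(k+1) = (k + 1) (w A') A^k, valid because the modes
  commute. In the induction \<open>m\<close> is split as \<open>r + (m - r)\<close>, that is, the
  first factor and the remaining ones are differentiated separately.\<close>

lemma kpow_ode:
  assumes lin: "\<And>r. klinear (D r)" and comm: "\<And>r s u. D r (D s u) = D s (D r u)"
  shows "of_nat m * kpow D (Suc k) m u = of_nat (Suc k) * (\<Sum>r = 1..m. of_nat r * D r (kpow D k (m - r) u))"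
proof (induction k arbitrary: m)
  case 0
  have "of_nat m * D r (kpow D 0 (m - r) u) = of_nat r * D r (kpow D 0 (m - r) u)"
    if "r \<in> {1..m}" for r
    using that klinear_0[OF lin] by (cases "r = m") simp_all
  then have "(\<Sum>r = 1..m. of_nat m * D r (kpow D 0 (m - r) u)) = (\<Sum>r = 1..m. of_nat r * D r (kpow D 0 (m - r) u))"
    by (rule sum.cong[OF refl])
  then show ?case by (simp only: kpow.simps(2) sum_distrib_left) simp
next
  case (Suc k)
  have "of_nat m * kpow D (Suc (Suc k)) m u = (\<Sum>r = 1..m. of_nat m * D r (kpow D (Suc k) (m - r) u))"
    by (simp only: kpow.simps(2) sum_distrib_left)
  also have "\<dots> = (\<Sum>r = 1..m. of_nat r * D r (kpow D (Suc k) (m - r) u) +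
      D r (of_nat (m - r) * kpow D (Suc k) (m - r) u))"
    by (rule sum.cong[OF refl])
       (simp only: klinear_of_nat[OF lin] distrib_right[symmetric] of_nat_add[symmetric], simp)
  also have "\<dots> = (\<Sum>r = 1..m. of_nat r * D r (kpow D (Suc k) (m - r) u)) +
      (\<Sum>r = 1..m. D r (of_nat (Suc k) * (\<Sum>s = 1..m - r. of_nat s * D s (kpow D k (m - r - s) u))))"
    by (simp only: Suc sum.distrib)
  also have "(\<Sum>r = 1..m. D r (of_nat (Suc k) * (\<Sum>s = 1..m - r. of_nat s * D s (kpow D k (m - r - s) u)))) =
     of_nat (Suc k) * (\<Sum>r = 1..m. \<Sum>s = 1..m - r. of_nat s * D r (D s (kpow D k (m - r - s) u)))"
    by (simp only: klinear_of_nat[OF lin] klinear_sum[OF lin] sum_distrib_left)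
  also have "(\<Sum>r = 1..m. \<Sum>s = 1..m - r. of_nat s * D r (D s (kpow D k (m - r - s) u))) =
    (\<Sum>s = 1..m. \<Sum>r = 1..m - s. of_nat s * D s (D r (kpow D k (m - s - r) u)))"
  proof -
    have "D r (D s (kpow D k (m - r - s) u)) = D s (D r (kpow D k (m - s - r) u))" for r s
      by (simp only: comm[of r s] diff_commute[of m r s])
    then show ?thesis by (subst sum_triangle_swap) simp
  qed
  also have "\<dots> = (\<Sum>s = 1..m. of_nat s * D s (kpow D (Suc k) (m - s) u))"
    by (simp only: kpow.simps(2) klinear_sum[OF lin] sum_distrib_left)
  finally show ?case by (simp add: algebra_simps)
qed

lemma kexp_0 [simp]: "kexp D 0 u = u"
  by (simp add: kexp_def)

text \<open>The equation w E' = (w A') E for E = exp A. Its coefficients form a recursion that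
  determines E from its constant term (\<open>ode_unique\<close>), so identities of exponentials
  follow without expanding powers.\<close>

lemma kexp_ode:
  assumes lin: "\<And>r. klinear (D r)" and comm: "\<And>r s u. D r (D s u) = D s (D r u)"
  shows "of_nat m * kexp D m u = (\<Sum>r = 1..m. of_nat r * D r (kexp D (m - r) u))"
proof -
  have "of_nat m * kexp D m u = (\<Sum>k\<le>m. kconst (1 / of_nat (fact k)) * (of_nat m * kpow D k m u))"
    by (simp add: kexp_def sum_distrib_left mult.left_commute)
  also have "\<dots> = (\<Sum>k<m. kconst (1 / of_nat (fact (Suc k))) * (of_nat m * kpow D (Suc k) m u))"
    by (simp add: lessThan_Suc_atMost[symmetric] sum.lessThan_Suc_shift
        del: kpow.simps(2) sum.lessThan_Suc of_nat_Suc of_nat_fact fact_Suc)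
  also have "\<dots> = (\<Sum>k<m. \<Sum>r = 1..m. kconst (1 / of_nat (fact k)) * (of_nat r * D r (kpow D k (m - r) u)))"
  proof (rule sum.cong[OF refl])
    fix k
    have "(of_nat (Suc k) :: qf) \<noteq> 0" by (simp del: of_nat_Suc)
    moreover have "(of_nat (fact (Suc k)) :: qf) = of_nat (Suc k) * of_nat (fact k)"
      by (simp only: fact_Suc of_nat_mult of_nat_id)
    ultimately have "1 / of_nat (fact (Suc k)) * of_nat (Suc k) = (1 / of_nat (fact k) :: qf)"
      by (simp del: of_nat_Suc fact_Suc)
    then have "kconst (1 / of_nat (fact (Suc k))) * of_nat (Suc k) = kconst (1 / of_nat (fact k))"
      by (metis kconst_mult kconst_of_nat)
    then show "kconst (1 / of_nat (fact (Suc k))) * (of_nat m * kpow D (Suc k) m u) =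
      (\<Sum>r = 1..m. kconst (1 / of_nat (fact k)) * (of_nat r * D r (kpow D k (m - r) u)))"
      by (simp only: kpow_ode[OF lin comm] mult.assoc[symmetric] sum_distrib_left)
  qed
  also have "\<dots> = (\<Sum>r = 1..m. of_nat r * D r (\<Sum>k<m. kconst (1 / of_nat (fact k)) * kpow D k (m - r) u))"
    by (subst sum.swap) (simp only: klinear_sum[OF lin] klinear_scale[OF lin] sum_distrib_left mult.left_commute)
  also have "\<dots> = (\<Sum>r = 1..m. of_nat r * D r (kexp D (m - r) u))"
  proof (rule sum.cong[OF refl])
    fix r assume "r \<in> {1..m}"
    then have "(\<Sum>k<m. kconst (1 / of_nat (fact k)) * kpow D k (m - r) u) = kexp D (m - r) u"
      unfolding kexp_def by (intro sum.mono_neutral_right) (auto simp: kpow_eq_0[OF _ lin])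
    then show "of_nat r * D r (\<Sum>k<m. kconst (1 / of_nat (fact k)) * kpow D k (m - r) u) =
       of_nat r * D r (kexp D (m - r) u)" by simp
  qed
  finally show ?thesis .
qed

lemma ode_unique:
  fixes g h :: "nat \<Rightarrow> kalg"
  assumes "g 0 = h 0"
    and "\<And>m. m > 0 \<Longrightarrow> of_nat m * g m = (\<Sum>r = 1..m. of_nat r * D r (g (m - r)))"
    and "\<And>m. m > 0 \<Longrightarrow> of_nat m * h m = (\<Sum>r = 1..m. of_nat r * D r (h (m - r)))"
  shows "g m = h m"
proof (induction m rule: less_induct)
  case (less m)
  show ?case
  proof (cases "m = 0")
    case False
    then have "of_nat m * g m = of_nat m * h m"
      using less by (simp add: assms(2,3))
    then show ?thesis by (rule of_nat_kalg_cancel) (use False in simp)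
  qed (use assms in simp)
qed

lemma klinear_comp: "klinear S \<Longrightarrow> klinear T \<Longrightarrow> klinear (\<lambda>u. S (T u))"
  by (simp add: klinear_def)

lemma klinear_kpow: "(\<And>r. klinear (D r)) \<Longrightarrow> klinear (kpow D k m)"
proof (induction k arbitrary: m)
  case (Suc k)
  then have "klinear (\<lambda>u. D r (kpow D k (m - r) u))" for r by (simp add: klinear_comp)
  then show ?case by (simp add: klinear_def sum.distrib sum_distrib_left)
qed (simp add: klinear_def)

lemma klinear_kexp: "(\<And>r. klinear (D r)) \<Longrightarrow> klinear (kexp D m)"
  using klinear_kpow[of D]
  by (simp add: klinear_def kexp_def sum.distrib sum_distrib_left algebra_simps)

lemma kpow_commute:
  assumes "klinear T" "\<And>r u. r \<ge> 1 \<Longrightarrow> D r (T u) = T (D r u)"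
  shows "kpow D k m (T u) = T (kpow D k m u)"
  by (induction k arbitrary: m) (simp_all add: assms klinear_0 klinear_sum)

lemma kexp_commute:
  assumes "klinear T" "\<And>r u. r \<ge> 1 \<Longrightarrow> D r (T u) = T (D r u)"
  shows "kexp D m (T u) = T (kexp D m u)"
  by (simp add: kexp_def kpow_commute[OF assms(1), of D] assms(2) klinear_sum[OF assms(1)] klinear_scale[OF assms(1)])

lemma kpow_cong: "(\<And>r u. r \<ge> 1 \<Longrightarrow> D r u = D' r u) \<Longrightarrow> kpow D k m u = kpow D' k m u"
  by (induction k arbitrary: m) simp_all

lemma kexp_cong: "(\<And>r u. r \<ge> 1 \<Longrightarrow> D r u = D' r u) \<Longrightarrow> kexp D m u = kexp D' m u"
  by (simp add: kexp_def kpow_cong[of D D'])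

lemma kpow_scale_power:
  assumes "\<And>r. klinear (D r)"
  shows "kpow (\<lambda>r u. kconst (c ^ r) * D r u) k m u = kconst (c ^ m) * kpow D k m u"
proof (induction k arbitrary: m)
  case (Suc k)
  have "kconst (c ^ r) * D r (kconst (c ^ (m - r)) * kpow D k (m - r) u) = kconst (c ^ m) * D r (kpow D k (m - r) u)"
    if "r \<in> {1..m}" for r
    using that by (simp add: klinear_scale[OF assms] kconst_mult_left flip: power_add)
  then show ?case by (simp add: Suc sum_distrib_left)
qed simp

lemma kexp_scale_power:
  assumes "\<And>r. klinear (D r)"
  shows "kexp (\<lambda>r u. kconst (c ^ r) * D r u) m u = kconst (c ^ m) * kexp D m u"
  by (simp add: kexp_def kpow_scale_power[OF assms] sum_distrib_left mult.left_commute)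

text \<open>Both sides solve the equation of the summed modes: on the right \<open>m\<close> is
  split as \<open>a + (m - a)\<close>, and each exponential contributes its own recursion.\<close>

lemma kexp_sum:
  assumes lin: "\<And>r. klinear (D r)" "\<And>r. klinear (D' r)"
    and comm: "\<And>r s u. D r (D s u) = D s (D r u)" "\<And>r s u. D' r (D' s u) = D' s (D' r u)"
      "\<And>r s u. D r (D' s u) = D' s (D r u)"
  shows "kexp (\<lambda>r u. D r u + D' r u) m u = (\<Sum>a\<le>m. kexp D a (kexp D' (m - a) u))"
proof (rule ode_unique[where D = "\<lambda>r u. D r u + D' r u" and g = "\<lambda>m. kexp (\<lambda>r u. D r u + D' r u) m u"])
  fix m :: nat
  have "klinear (\<lambda>u. D r u + D' r u)" for r
    using lin[of r] by (simp add: klinear_def distrib_left)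
  then show "of_nat m * kexp (\<lambda>r u. D r u + D' r u) m u =
      (\<Sum>r = 1..m. of_nat r * (D r (kexp (\<lambda>r u. D r u + D' r u) (m - r) u) + D' r (kexp (\<lambda>r u. D r u + D' r u) (m - r) u)))"
    by (rule kexp_ode) (simp add: comm klinear_add[OF lin(1)] klinear_add[OF lin(2)])
  have commute: "kexp D a (D' r w) = D' r (kexp D a w)" for a r w
    by (rule kexp_commute[OF lin(2)]) (rule comm(3))
  have "of_nat m * (\<Sum>a\<le>m. kexp D a (kexp D' (m - a) u)) =
     (\<Sum>a\<le>m. of_nat a * kexp D a (kexp D' (m - a) u) + kexp D a (of_nat (m - a) * kexp D' (m - a) u))"
    unfolding sum_distrib_left
    by (rule sum.cong[OF refl])
       (simp only: klinear_of_nat[OF klinear_kexp[OF lin(1)]] distrib_right[symmetric] of_nat_add[symmetric], simp)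
  also have "\<dots> = (\<Sum>a\<le>m. \<Sum>r = 1..a. of_nat r * D r (kexp D (a - r) (kexp D' (m - a) u))) +
     (\<Sum>a\<le>m. \<Sum>r = 1..m - a. of_nat r * D' r (kexp D a (kexp D' (m - a - r) u)))"
    by (simp only: kexp_ode[OF lin(1) comm(1)] kexp_ode[OF lin(2) comm(2)] sum.distrib
        klinear_sum[OF klinear_kexp[OF lin(1)]] klinear_of_nat[OF klinear_kexp[OF lin(1)]]
        commute)
  also have "\<dots> = (\<Sum>r = 1..m. \<Sum>a\<le>m - r. of_nat r * D r (kexp D a (kexp D' (m - r - a) u))) +
     (\<Sum>r = 1..m. \<Sum>a\<le>m - r. of_nat r * D' r (kexp D a (kexp D' (m - r - a) u)))"
    by (simp only: sum_convolution_swap1[where F = "\<lambda>r a b. of_nat r * D r (kexp D a (kexp D' b u))"]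
      sum_convolution_swap2[where F = "\<lambda>r a b. of_nat r * D' r (kexp D a (kexp D' b u))"])
  finally show "of_nat m * (\<Sum>a\<le>m. kexp D a (kexp D' (m - a) u)) =
     (\<Sum>r = 1..m. of_nat r * (D r (\<Sum>a\<le>m - r. kexp D a (kexp D' (m - r - a) u)) +
        D' r (\<Sum>a\<le>m - r. kexp D a (kexp D' (m - r - a) u))))"
    by (simp only: klinear_sum[OF lin(1)] klinear_sum[OF lin(2)] sum_distrib_left distrib_left sum.distrib)
qed simp

text \<open>Exponentials of derivations are multiplicative: the product rule in w on the right
  matches the Leibniz rule of each \<open>D r\<close> on the left.\<close>

lemma kexp_leibniz:
  assumes lin: "\<And>r. klinear (D r)" and comm: "\<And>r s u. D r (D s u) = D s (D r u)"
    and der: "\<And>r u w. D r (u * w) = D r u * w + u * D r w"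
  shows "kexp D m (u * w) = (\<Sum>a\<le>m. kexp D a u * kexp D (m - a) w)"
proof (rule ode_unique[where D = D and g = "\<lambda>m. kexp D m (u * w)"])
  fix m :: nat
  show "of_nat m * kexp D m (u * w) = (\<Sum>r = 1..m. of_nat r * D r (kexp D (m - r) (u * w)))"
    by (rule kexp_ode[OF lin comm])
  have "of_nat m * (\<Sum>a\<le>m. kexp D a u * kexp D (m - a) w) =
     (\<Sum>a\<le>m. (of_nat a * kexp D a u) * kexp D (m - a) w + kexp D a u * (of_nat (m - a) * kexp D (m - a) w))"
    unfolding sum_distrib_left
  proof (rule sum.cong[OF refl])
    fix a assume "a \<in> {..m}"
    then have "of_nat m = (of_nat a + of_nat (m - a) :: kalg)" by (simp flip: of_nat_add)
    then show "of_nat m * (kexp D a u * kexp D (m - a) w) =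
      (of_nat a * kexp D a u) * kexp D (m - a) w + kexp D a u * (of_nat (m - a) * kexp D (m - a) w)"
      by (simp only: algebra_simps)
  qed
  also have "\<dots> = (\<Sum>a\<le>m. \<Sum>r = 1..a. of_nat r * (D r (kexp D (a - r) u) * kexp D (m - a) w)) +
     (\<Sum>a\<le>m. \<Sum>r = 1..m - a. of_nat r * (kexp D a u * D r (kexp D (m - a - r) w)))"
    by (simp only: kexp_ode[OF lin comm] sum.distrib sum_distrib_left sum_distrib_right mult.assoc mult.left_commute)
  also have "\<dots> = (\<Sum>r = 1..m. \<Sum>a\<le>m - r. of_nat r * (D r (kexp D a u) * kexp D (m - r - a) w)) +
     (\<Sum>r = 1..m. \<Sum>a\<le>m - r. of_nat r * (kexp D a u * D r (kexp D (m - r - a) w)))"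
    by (simp only: sum_convolution_swap1[where F = "\<lambda>r a b. of_nat r * (D r (kexp D a u) * kexp D b w)"]
      sum_convolution_swap2[where F = "\<lambda>r a b. of_nat r * (kexp D a u * D r (kexp D b w))"])
  finally show "of_nat m * (\<Sum>a\<le>m. kexp D a u * kexp D (m - a) w) =
     (\<Sum>r = 1..m. of_nat r * D r (\<Sum>a\<le>m - r. kexp D a u * kexp D (m - r - a) w))"
    by (simp only: klinear_sum[OF lin] der sum_distrib_left distrib_left sum.distrib)
qed simp

text \<open>Evaluation at 1 loses nothing, since the exponential of multiplication operators is
  again a multiplication, see \<open>kexp_mult\<close>.\<close>

definition crexp :: "(nat \<Rightarrow> kalg) \<Rightarrow> nat \<Rightarrow> kalg" where
  "crexp p m = kexp (\<lambda>r u. p r * u) m 1"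

lemma klinear_mult: "klinear ((*) p)"
  by (simp add: klinear_def distrib_left mult.left_commute)

lemma crexp_0 [simp]: "crexp p 0 = 1"
  by (simp add: crexp_def)

lemma crexp_ode: "of_nat m * crexp p m = (\<Sum>r = 1..m. of_nat r * (p r * crexp p (m - r)))"
  unfolding crexp_def by (rule kexp_ode) (simp_all add: klinear_mult mult.left_commute)

lemma kexp_mult: "kexp (\<lambda>r u. p r * u) m u = crexp p m * u"
proof -
  have "kexp (\<lambda>r u. p r * u) m (u * 1) = u * kexp (\<lambda>r u. p r * u) m 1"
    by (rule kexp_commute) (simp_all add: klinear_mult mult.left_commute)
  then show ?thesis by (simp add: crexp_def mult.commute)
qed

lemma crexp_cong: "(\<And>r. r \<ge> 1 \<Longrightarrow> p r = p' r) \<Longrightarrow> crexp p m = crexp p' m"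
  unfolding crexp_def by (rule kexp_cong) simp

lemma crexp_scale_power: "crexp (\<lambda>r. kconst (c ^ r) * p r) m = kconst (c ^ m) * crexp p m"
  using kexp_scale_power[of "\<lambda>r u. p r * u" c m 1] by (simp add: crexp_def klinear_mult mult.assoc)

lemma crexp_sum: "crexp (\<lambda>r. p r + p' r) m = (\<Sum>a\<le>m. crexp p a * crexp p' (m - a))"
  using kexp_sum[of "\<lambda>r u. p r * u" "\<lambda>r u. p' r * u" m 1]
  by (simp add: klinear_mult mult.left_commute kexp_mult distrib_right crexp_def[of "\<lambda>r. p r + p' r"])

text \<open>For P(w) = \<Sum> p_s w^s one has D exp(P) = D(P) exp(P), and D(P) is the single term c
  w^r.\<close>

lemma derivation_crexp:
  assumes lin: "klinear D" and der: "\<And>u w. D (u * w) = D u * w + u * D w"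
    and p: "\<And>s. s \<ge> 1 \<Longrightarrow> D (p s) = (if s = r then kconst c else 0)" and r: "r \<ge> 1"
  shows "D (crexp p m) = (if r \<le> m then kconst c * crexp p (m - r) else 0)"
proof (induction m rule: less_induct)
  case (less m)
  have D1: "D 1 = 0" using der[of 1 1] by simp
  show ?case
  proof (cases "m = 0")
    case False
    have "of_nat m * D (crexp p m) = (\<Sum>s = 1..m. of_nat s * D (p s * crexp p (m - s)))"
      by (simp only: klinear_of_nat[OF lin, symmetric] crexp_ode klinear_sum[OF lin])
    also have "\<dots> = (\<Sum>s = 1..m. if s = r then of_nat r * (kconst c * crexp p (m - r)) else 0) +
       (\<Sum>s = 1..m. of_nat s * (p s * (if r \<le> m - s then kconst c * crexp p (m - s - r) else 0)))"
      unfolding sum.distrib[symmetric]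
      by (rule sum.cong[OF refl]) (simp add: der p less distrib_left)
    also have "(\<Sum>s = 1..m. of_nat s * (p s * (if r \<le> m - s then kconst c * crexp p (m - s - r) else 0))) =
       (if r \<le> m then kconst c * (\<Sum>s = 1..m - r. of_nat s * (p s * crexp p (m - r - s))) else 0)"
    proof -
      have "(\<Sum>s = 1..m. of_nat s * (p s * (if r \<le> m - s then kconst c * crexp p (m - s - r) else 0))) =
        (\<Sum>s = 1..m - r. of_nat s * (p s * (kconst c * crexp p (m - r - s))))"
        by (rule sum.mono_neutral_cong_right) (use r in \<open>auto simp: diff_commute add.commute\<close>)
      then show ?thesis using r by (auto simp: sum_distrib_left mult.left_commute)
    qed
    also have "(\<Sum>s = 1..m - r. of_nat s * (p s * crexp p (m - r - s))) = of_nat (m - r) * crexp p (m - r)"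
      by (simp only: crexp_ode)
    also have "(\<Sum>s = 1..m. if s = r then of_nat r * (kconst c * crexp p (m - r)) else 0) +
       (if r \<le> m then kconst c * (of_nat (m - r) * crexp p (m - r)) else 0) =
       of_nat m * (if r \<le> m then kconst c * crexp p (m - r) else 0)"
      using r by (auto simp: of_nat_diff algebra_simps)
    finally show ?thesis by (rule of_nat_kalg_cancel) (use False in simp)
  qed (use r D1 in simp)
qed

text \<open>Each \<open>D r\<close> acts on exp(P(w)) as the scalar c_r w^r. Hence exp(\<Sum> D_r
  x^r) multiplies exp(P(w)) by \<rho>(x w), where \<rho>(x) = exp(\<Sum> c_r x^r).\<close>

lemma kexp_crexp:
  assumes lin: "\<And>r. klinear (D r)" and comm: "\<And>r s u. D r (D s u) = D s (D r u)"
    and der: "\<And>r u w. D r (u * w) = D r u * w + u * D r w"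
    and p: "\<And>r s. r \<ge> 1 \<Longrightarrow> s \<ge> 1 \<Longrightarrow> D r (p s) = (if s = r then kconst (c r) else 0)"
    and rho: "\<rho> 0 = 1" "\<And>l. l > 0 \<Longrightarrow> of_nat l * \<rho> l = (\<Sum>r = 1..l. of_nat r * c r * \<rho> (l - r))"
  shows "kexp D l (crexp p m) = (if l \<le> m then kconst (\<rho> l) * crexp p (m - l) else 0)"
proof (rule ode_unique[where D = D and g = "\<lambda>l. kexp D l (crexp p m)"])
  fix l :: nat assume l: "l > 0"
  show "of_nat l * kexp D l (crexp p m) = (\<Sum>r = 1..l. of_nat r * D r (kexp D (l - r) (crexp p m)))"
    by (rule kexp_ode[OF lin comm])
  have Dr: "D r (crexp p m) = (if r \<le> m then kconst (c r) * crexp p (m - r) else 0)" if "r \<ge> 1" for r m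
    by (rule derivation_crexp[OF lin der p[OF that] that])
  show "of_nat l * (if l \<le> m then kconst (\<rho> l) * crexp p (m - l) else 0) =
     (\<Sum>r = 1..l. of_nat r * D r (if l - r \<le> m then kconst (\<rho> (l - r)) * crexp p (m - (l - r)) else 0))"
  proof -
    have "D r (if l - r \<le> m then kconst (\<rho> (l - r)) * crexp p (m - (l - r)) else 0) =
      (if l \<le> m then kconst (c r * \<rho> (l - r)) * crexp p (m - l) else 0)" if "r \<in> {1..l}" for r
    proof (cases "l - r \<le> m")
      case True
      then have "r \<le> m - (l - r) \<longleftrightarrow> l \<le> m" "l \<le> m \<Longrightarrow> m - (l - r) - r = m - l" using that by auto
      then show ?thesis using True that
        by (auto simp: klinear_scale[OF lin] Dr kconst_mult_left mult.commute)
    next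
      case False
      then show ?thesis using that by (simp add: klinear_0[OF lin])
    qed
    then have "(\<Sum>r = 1..l. of_nat r * D r (if l - r \<le> m then kconst (\<rho> (l - r)) * crexp p (m - (l - r)) else 0)) =
      (\<Sum>r = 1..l. if l \<le> m then kconst (of_nat r * c r * \<rho> (l - r)) * crexp p (m - l) else 0)"
      by (intro sum.cong[OF refl]) (simp add: kconst_mult kconst_of_nat mult.assoc)
    also have "\<dots> = (if l \<le> m then kconst (of_nat l * \<rho> l) * crexp p (m - l) else 0)"
    proof -
      have ks: "kconst (sum g A) = (\<Sum>x\<in>A. kconst (g x))" for g :: "nat \<Rightarrow> qf" and A
        by (induction A rule: infinite_finite_induct) (simp_all add: kconst_add)
      show ?thesis by (simp add: rho(2)[OF l] ks sum_distrib_right)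
    qed
    finally show ?thesis by (simp add: kconst_mult kconst_of_nat mult.assoc)
  qed
qed (simp add: rho)

section \<open>Expansions in two variables\<close>

lemma qconst_simps [simp]: "qconst 0 = 0" "qconst 1 = 1"
  by (simp_all add: qconst_def Zero_fract_def One_fract_def flip: one_pCons)

lemma qconst_add: "qconst (a + b) = qconst a + qconst b"
  by (simp add: qconst_def)

lemma qconst_eq_0_iff [simp]: "qconst a = 0 \<longleftrightarrow> a = 0"
  by (simp add: qconst_def Zero_fract_def eq_fract)

text \<open>The exponent may be negative, as (z + z_0)^r is expanded in powers of z_0 for every
  integer r.\<close>

definition binq :: "int \<Rightarrow> nat \<Rightarrow> qf" where
  "binq r m = qconst (of_int r gchoose m)"

lemma binq_0 [simp]: "binq r 0 = 1"
  by (simp add: binq_def)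

lemma binq_Suc: "binq r (Suc m) = binq (r - 1) m + binq (r - 1) (Suc m)"
  using gbinomial_Suc_Suc[of "of_int (r - 1) :: complex" m]
  by (simp add: binq_def flip: qconst_add)

lemma binq_nat: "binq (int r) m = (if r < m then 0 else qconst (of_nat (r choose m)))"
  by (simp add: binq_def binomial_eq_0 flip: binomial_gbinomial)

definition bounded2_by :: "int \<Rightarrow> (int \<Rightarrow> int \<Rightarrow> qf) \<Rightarrow> bool" where
  "bounded2_by B c \<longleftrightarrow> (\<forall>r k. c r k \<noteq> 0 \<longrightarrow> B \<le> r \<and> B \<le> k)"

text \<open>The coefficient of \<open>z\<^sub>0\<^sup>m z\<^sup>t\<close> in \<open>c(z + z\<^sub>0, z)\<close>.\<close>

definition subst_coeff :: "(int \<Rightarrow> int \<Rightarrow> qf) \<Rightarrow> nat \<Rightarrow> int \<Rightarrow> qf" where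
  "subst_coeff c m t = Sum_any (\<lambda>r. binq r m * c r (t + int m - r))"

text \<open>The outer variable is z_0 and the inner one z. The required lower bounds for the
  coefficients come from \<open>bounded2_by\<close>, which therefore accompanies every use.\<close>

definition subst_series :: "(int \<Rightarrow> int \<Rightarrow> qf) \<Rightarrow> qf fls fls" where
  "subst_series c = Abs_fls (\<lambda>m. if m < 0 then 0 else Abs_fls (subst_coeff c (nat m)))"

lemma subst_coeff_eq_sum:
  assumes "bounded2_by B c"
  shows "subst_coeff c m t = (\<Sum>r = B..t + int m - B. binq r m * c r (t + int m - r))"
  unfolding subst_coeff_def
proof (rule Sum_any.expand_superset)
  have "r \<in> {B..t + int m - B}" if "c r (t + int m - r) \<noteq> 0" for r
  proof -
    have "B \<le> r \<and> B \<le> t + int m - r" using assms that unfolding bounded2_by_def by blast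
    then show ?thesis by auto
  qed
  then show "{r. binq r m * c r (t + int m - r) \<noteq> 0} \<subseteq> {B..t + int m - B}" by auto
qed simp

lemma subst_coeff_eq_sum_le:
  assumes "bounded2_by B c" "B' \<le> B" "t + int m - B \<le> C"
  shows "subst_coeff c m t = (\<Sum>r = B'..C. binq r m * c r (t + int m - r))"
proof -
  have "binq r m * c r (t + int m - r) = 0" if "r \<in> {B'..C} - {B..t + int m - B}" for r
  proof -
    have "\<not> (B \<le> r \<and> B \<le> t + int m - r)" using that by auto
    then have "c r (t + int m - r) = 0" using assms(1) unfolding bounded2_by_def by blast
    then show ?thesis by simp
  qed
  then show ?thesis
    unfolding subst_coeff_eq_sum[OF assms(1)]
    by (intro sum.mono_neutral_left) (use assms in auto)
qed

lemma subst_series_nth: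
  assumes "bounded2_by B c"
  shows "fls_nth (fls_nth (subst_series c) m) t = (if m < 0 then 0 else subst_coeff c (nat m) t)"
proof -
  have z: "subst_coeff c k t = 0" if "t < 2 * B - int k" for k t
    using that by (simp add: subst_coeff_eq_sum[OF assms])
  have "fls_nth (Abs_fls (subst_coeff c k)) t = subst_coeff c k t" for k t
    by (rule nth_Abs_fls_lower_bound[of "2 * B - int k"]) (use z in auto)
  moreover have "fls_nth (subst_series c) m = (if m < 0 then 0 else Abs_fls (subst_coeff c (nat m)))"
    unfolding subst_series_def by (subst nth_Abs_fls_lower_bound[of 0]) auto
  ultimately show ?thesis by simp
qed

lemma bounded2_by_shift:
  assumes "bounded2_by B c"
  shows "bounded2_by B (\<lambda>r k. c (r - int i) (k - int j))"
  unfolding bounded2_by_def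
proof (intro allI impI)
  fix r k assume "c (r - int i) (k - int j) \<noteq> 0"
  then have "B \<le> r - int i \<and> B \<le> k - int j" using assms unfolding bounded2_by_def by blast
  then show "B \<le> r \<and> B \<le> k" by auto
qed

lemma fls_fls_eqI: "(\<And>m t. fls_nth (fls_nth f m) t = fls_nth (fls_nth g m) t) \<Longrightarrow> f = g"
  by (intro fls_eqI) auto

text \<open>Multiplication by z_1 turns into multiplication by z + z_0; on coefficients this is
  Pascal's rule \<open>binq_Suc\<close>.\<close>

lemma subst_series_shift1:
  assumes "bounded2_by B c"
  shows "subst_series (\<lambda>r k. c (r - 1) k) = (fls_X + fls_const fls_X) * subst_series c"
proof (rule fls_fls_eqI)
  fix m t
  have b: "bounded2_by B (\<lambda>r k. c (r - 1) k)"
    using bounded2_by_shift[OF assms, of 1 0] by simp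
  have rhs: "fls_nth (fls_nth ((fls_X + fls_const fls_X) * subst_series c) m) t =
     fls_nth (fls_nth (subst_series c) (m - 1)) t + fls_nth (fls_nth (subst_series c) m) (t - 1)"
    by (simp add: distrib_right fls_X_times_conv_shift)
  have shift: "(\<Sum>r = B..C. binq r k * c (r - 1) (C' - r)) = (\<Sum>r = B - 1..C - 1. binq (r + 1) k * c r (C' - 1 - r))" for k C C'
    by (rule sum.reindex_bij_witness[of _ "\<lambda>r. r + 1" "\<lambda>r. r - 1"]) (auto simp: algebra_simps)
  show "fls_nth (fls_nth (subst_series (\<lambda>r k. c (r - 1) k)) m) t =
     fls_nth (fls_nth ((fls_X + fls_const fls_X) * subst_series c) m) t"
  proof (cases "m < 0")
    case True
    then show ?thesis unfolding rhs by (simp add: subst_series_nth[OF b] subst_series_nth[OF assms])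
  next
    case False
    then obtain k where m: "m = int k" by (metis nonneg_int_cases not_less)
    show ?thesis
    proof (cases k)
      case 0
      have "subst_coeff (\<lambda>r k. c (r - 1) k) 0 t = subst_coeff c 0 (t - 1)"
        by (simp only: subst_coeff_eq_sum_le[OF b order_refl order_refl] shift
            subst_coeff_eq_sum_le[OF assms, of "B - 1" "t - 1" 0 "t - B - 1"])
           (simp add: subst_coeff_eq_sum_le[OF assms, of "B - 1" "t - 1" 0 "t - B - 1"] algebra_simps)
      then show ?thesis unfolding rhs by (simp add: subst_series_nth[OF b] subst_series_nth[OF assms] m 0)
    next
      case (Suc l)
      let ?C = "t + int l - B"
      have "subst_coeff (\<lambda>r k. c (r - 1) k) (Suc l) t =
        (\<Sum>r = B - 1..?C. binq (r + 1) (Suc l) * c r (t + int l - r))"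
        by (simp only: subst_coeff_eq_sum_le[OF b order_refl order_refl] shift) (simp add: algebra_simps)
      also have "\<dots> = (\<Sum>r = B - 1..?C. binq r l * c r (t + int l - r)) +
          (\<Sum>r = B - 1..?C. binq r (Suc l) * c r (t + int l - r))"
        by (simp add: binq_Suc[of "_ + 1"] distrib_right sum.distrib)
      also have "(\<Sum>r = B - 1..?C. binq r l * c r (t + int l - r)) = subst_coeff c l t"
        by (rule subst_coeff_eq_sum_le[OF assms, symmetric]) auto
      also have "(\<Sum>r = B - 1..?C. binq r (Suc l) * c r (t + int l - r)) = subst_coeff c (Suc l) (t - 1)"
        by (subst subst_coeff_eq_sum_le[OF assms, of "B - 1" _ _ ?C]) (auto simp: algebra_simps)
      finally show ?thesis unfolding rhs
        by (simp add: subst_series_nth[OF b] subst_series_nth[OF assms] m Suc nat_add_distrib)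
    qed
  qed
qed

lemma subst_series_shift2:
  assumes "bounded2_by B c"
  shows "subst_series (\<lambda>r k. c r (k - 1)) = fls_const fls_X * subst_series c"
proof (rule fls_fls_eqI)
  fix m t
  have b: "bounded2_by B (\<lambda>r k. c r (k - 1))"
    using bounded2_by_shift[OF assms, of 0 1] by simp
  show "fls_nth (fls_nth (subst_series (\<lambda>r k. c r (k - 1))) m) t = fls_nth (fls_nth (fls_const fls_X * subst_series c) m) t"
    by (simp add: fls_X_times_conv_shift subst_series_nth[OF b] subst_series_nth[OF assms] subst_coeff_def algebra_simps)
qed

lemma subst_series_scale:
  assumes "bounded2_by B c"
  shows "subst_series (\<lambda>r k. a * c r k) = fls_const (fls_const a) * subst_series c"
proof (rule fls_fls_eqI)
  fix m t
  have b: "bounded2_by B (\<lambda>r k. a * c r k)" using assms unfolding bounded2_by_def by auto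
  show "fls_nth (fls_nth (subst_series (\<lambda>r k. a * c r k)) m) t = fls_nth (fls_nth (fls_const (fls_const a) * subst_series c) m) t"
    by (simp add: subst_series_nth[OF b] subst_series_nth[OF assms] subst_coeff_eq_sum[OF b]
        subst_coeff_eq_sum[OF assms] sum_distrib_left mult.left_commute)
qed

lemma bounded2_by_sum: "(\<And>x. x \<in> A \<Longrightarrow> bounded2_by B (c x)) \<Longrightarrow> bounded2_by B (\<lambda>r k. \<Sum>x\<in>A. c x r k)"
  unfolding bounded2_by_def by (metis (mono_tags, lifting) sum.neutral)

lemma subst_series_sum:
  assumes "\<And>x. x \<in> A \<Longrightarrow> bounded2_by B (c x)"
  shows "subst_series (\<lambda>r k. \<Sum>x\<in>A. c x r k) = (\<Sum>x\<in>A. subst_series (c x))"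
proof (rule fls_fls_eqI)
  fix m t
  note b = bounded2_by_sum[of A B c, OF assms]
  have "subst_coeff (\<lambda>r k. \<Sum>x\<in>A. c x r k) k t = (\<Sum>x\<in>A. subst_coeff (c x) k t)" for k
    by (simp add: subst_coeff_eq_sum[OF b] subst_coeff_eq_sum[OF assms] sum_distrib_left)
       (rule sum.swap)
  then show "fls_nth (fls_nth (subst_series (\<lambda>r k. \<Sum>x\<in>A. c x r k)) m) t = fls_nth (fls_nth (\<Sum>x\<in>A. subst_series (c x)) m) t"
    by (simp add: fls_nth_sum subst_series_nth[OF b] subst_series_nth[OF assms])
qed

lemma subst_series_shift:
  assumes "bounded2_by B c"
  shows "subst_series (\<lambda>r k. c (r - int i) (k - int j)) =
    (fls_X + fls_const fls_X) ^ i * fls_const fls_X ^ j * subst_series c"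
proof (induction i)
  case 0
  show ?case
  proof (induction j)
    case (Suc j)
    have "subst_series (\<lambda>r k. c (r - int 0) (k - int (Suc j))) =
      subst_series (\<lambda>r k. (\<lambda>r k. c (r - int 0) (k - int j)) r (k - 1))" by (simp add: algebra_simps)
    also have "\<dots> = fls_const fls_X * subst_series (\<lambda>r k. c (r - int 0) (k - int j))"
      by (rule subst_series_shift2[OF bounded2_by_shift[OF assms]])
    finally show ?case by (simp only: Suc) (simp only: power_0 power_Suc mult_1 mult.assoc)
  qed simp
next
  case (Suc i)
  have "subst_series (\<lambda>r k. c (r - int (Suc i)) (k - int j)) =
    subst_series (\<lambda>r k. (\<lambda>r k. c (r - int i) (k - int j)) (r - 1) k)" by (simp add: algebra_simps)
  also have "\<dots> = (fls_X + fls_const fls_X) * subst_series (\<lambda>r k. c (r - int i) (k - int j))"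
    by (rule subst_series_shift1[OF bounded2_by_shift[OF assms]])
  finally show ?case by (simp only: Suc) (simp only: power_Suc mult.assoc)
qed

section \<open>Multiplication by polynomials and inversion after substitution\<close>

definition series_mult :: "qf poly poly \<Rightarrow> (int \<Rightarrow> int \<Rightarrow> qf) \<Rightarrow> int \<Rightarrow> int \<Rightarrow> qf" where
  "series_mult p c r k = (\<Sum>i \<le> degree p. \<Sum>j \<le> degree (coeff p i).
     coeff (coeff p i) j * c (r - int i) (k - int j))"

text \<open>This is p(z + z_0, z), the series whose inverse is
  \<open>iota_inverse p\<close>.\<close>

definition subst_poly :: "qf poly poly \<Rightarrow> qf fls fls" where
  "subst_poly p = (\<Sum>i \<le> degree p. \<Sum>j \<le> degree (coeff p i).
     fls_const (fls_const (coeff (coeff p i) j)) * (fls_X + fls_const fls_X) ^ i * fls_const fls_X ^ j)"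

lemma iota_inverse_eq: "iota_inverse p = inverse (subst_poly p)"
  by (simp add: iota_inverse_def subst_poly_def)

lemma bounded2_by_scale: "bounded2_by B c \<Longrightarrow> bounded2_by B (\<lambda>r k. a * c r k)"
  unfolding bounded2_by_def by auto

lemma bounded2_by_series_mult: "bounded2_by B c \<Longrightarrow> bounded2_by B (series_mult p c)"
  unfolding series_mult_def by (intro bounded2_by_sum bounded2_by_scale bounded2_by_shift)

lemma subst_series_mult:
  assumes "bounded2_by B c"
  shows "subst_series (series_mult p c) = subst_poly p * subst_series c"
proof -
  have "subst_series (series_mult p c) = (\<Sum>i \<le> degree p. subst_series (\<lambda>r k. \<Sum>j \<le> degree (coeff p i).
     coeff (coeff p i) j * c (r - int i) (k - int j)))"
    unfolding series_mult_def
    by (rule subst_series_sum[of _ B]) (intro bounded2_by_sum bounded2_by_scale bounded2_by_shift assms)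
  also have "\<dots> = (\<Sum>i \<le> degree p. \<Sum>j \<le> degree (coeff p i). subst_series (\<lambda>r k.
     coeff (coeff p i) j * c (r - int i) (k - int j)))"
    by (rule sum.cong[OF refl], rule subst_series_sum[of _ B])
       (intro bounded2_by_scale bounded2_by_shift assms)
  also have "\<dots> = subst_poly p * subst_series c"
    by (simp only: subst_series_scale[OF bounded2_by_shift[OF assms]] subst_series_shift[OF assms]
        subst_poly_def sum_distrib_right mult.assoc)
  finally show ?thesis .
qed

lemma series_mult_commute: "series_mult p (series_mult p' c) = series_mult p' (series_mult p c)"
proof (intro ext)
  fix r k
  define A where "A p = Sigma {..degree p} (\<lambda>i. {..degree (coeff p i)})" for p :: "qf poly poly"
  have e: "series_mult p c r k = (\<Sum>(i, j)\<in>A p. coeff (coeff p i) j * c (r - int i) (k - int j))" for p c r k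
    by (simp add: series_mult_def A_def sum.Sigma)
  have "series_mult p (series_mult p' c) r k = (\<Sum>x\<in>A p. \<Sum>y\<in>A p'.
     coeff (coeff p (fst x)) (snd x) * (coeff (coeff p' (fst y)) (snd y) *
       c (r - int (fst x) - int (fst y)) (k - int (snd x) - int (snd y))))"
    by (simp add: e case_prod_unfold sum_distrib_left)
  also have "\<dots> = (\<Sum>y\<in>A p'. \<Sum>x\<in>A p.
     coeff (coeff p' (fst y)) (snd y) * (coeff (coeff p (fst x)) (snd x) *
       c (r - int (fst y) - int (fst x)) (k - int (snd y) - int (snd x))))"
    by (subst sum.swap) (simp add: mult.left_commute diff_diff_eq add.commute)
  also have "\<dots> = series_mult p' (series_mult p c) r k"
    by (simp add: e case_prod_unfold sum_distrib_left)
  finally show "series_mult p (series_mult p' c) r k = series_mult p' (series_mult p c) r k" .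
qed

text \<open>Look at the coefficient of z_0^d z^t, where d is the degree in z_1 and t that of the
  leading coefficient. Powers z_1^r with r < d do not reach z_0^d and there are none with r > d, so
  it is the top coefficient of p. The series \<delta> is 1, which turns p into a coefficient
  function.\<close>

lemma subst_poly_nonzero:
  assumes "p \<noteq> 0"
  shows "subst_poly p \<noteq> 0"
proof -
  define \<delta> :: "int \<Rightarrow> int \<Rightarrow> qf" where "\<delta> r k = (if r = 0 \<and> k = 0 then 1 else 0)" for r k
  have b: "bounded2_by 0 \<delta>" by (simp add: bounded2_by_def \<delta>_def)
  note bp = bounded2_by_series_mult[OF b, of p]
  define d where "d = degree p"
  define t where "t = degree (lead_coeff p)"
  have sm: "series_mult p \<delta> (int i) (int j) = coeff (coeff p i) j" for i j
  proof -
    have "series_mult p \<delta> (int i) (int j) = (\<Sum>i' \<le> degree p. if i' = i then coeff (coeff p i) j else 0)"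
      unfolding series_mult_def
    proof (rule sum.cong[OF refl])
      fix i'
      have "(\<Sum>j' \<le> degree (coeff p i'). coeff (coeff p i') j' * \<delta> (int i - int i') (int j - int j')) =
        (\<Sum>j' \<le> degree (coeff p i'). if j' = j then (if i' = i then coeff (coeff p i) j else 0) else 0)"
        by (rule sum.cong[OF refl]) (auto simp: \<delta>_def)
      also have "\<dots> = (if i' = i then coeff (coeff p i) j else 0)"
        by (auto simp: coeff_eq_0)
      finally show "(\<Sum>j' \<le> degree (coeff p i'). coeff (coeff p i') j' * \<delta> (int i - int i') (int j - int j')) =
        (if i' = i then coeff (coeff p i) j else 0)" .
    qed
    also have "\<dots> = coeff (coeff p i) j" by (auto simp: coeff_eq_0)
    finally show ?thesis .
  qed
  have "subst_coeff (series_mult p \<delta>) d (int t) = (\<Sum>r = 0..int t + int d. binq r d * series_mult p \<delta> r (int t + int d - r))"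
    using subst_coeff_eq_sum[OF bp] by simp
  also have "\<dots> = (\<Sum>r = 0..t + d. binq (int r) d * series_mult p \<delta> (int r) (int (t + d - r)))"
    by (rule sum.reindex_bij_witness[of _ int nat]) auto
  also have "\<dots> = (\<Sum>r = 0..t + d. if r = d then coeff (coeff p d) t else 0)"
  proof (rule sum.cong[OF refl])
    fix r
    show "binq (int r) d * series_mult p \<delta> (int r) (int (t + d - r)) = (if r = d then coeff (coeff p d) t else 0)"
    proof (cases "r < d")
      case False
      then show ?thesis by (cases "r = d") (simp_all add: binq_nat sm d_def coeff_eq_0)
    qed (simp add: binq_nat)
  qed
  also have "\<dots> = coeff (coeff p d) t" by simp
  also have "\<dots> \<noteq> 0" using assms by (simp add: d_def t_def)
  finally have "fls_nth (fls_nth (subst_series (series_mult p \<delta>)) (int d)) (int t) \<noteq> 0"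
    by (simp add: subst_series_nth[OF bp])
  then have "subst_series (series_mult p \<delta>) \<noteq> 0" by auto
  then show ?thesis using subst_series_mult[OF b, of p] by auto
qed

text \<open>Any lower bounds may replace the subdegrees, so that the same range serves for series
  whose exact order is unknown.\<close>

lemma fls_times_nth_sum:
  fixes f g :: "'a::semiring_0 fls"
  assumes "\<And>k. k < a \<Longrightarrow> fls_nth f k = 0" "\<And>k. k < b \<Longrightarrow> fls_nth g k = 0"
  shows "fls_nth (f * g) k = (\<Sum>i = b..k - a. fls_nth f (k - i) * fls_nth g i)"
proof -
  let ?h = "\<lambda>i. fls_nth f (k - i) * fls_nth g i"
  have supp: "{i. ?h i \<noteq> 0} \<subseteq> {b..k - a}" "{i. ?h i \<noteq> 0} \<subseteq> {fls_subdegree g..k - fls_subdegree f}"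
  proof -
    have "b \<le> i \<and> i \<le> k - a \<and> fls_subdegree g \<le> i \<and> i \<le> k - fls_subdegree f" if "?h i \<noteq> 0" for i
    proof -
      have "fls_nth f (k - i) \<noteq> 0" "fls_nth g i \<noteq> 0" using that by auto
      then have "\<not> k - i < a" "\<not> i < b" "\<not> k - i < fls_subdegree f" "\<not> i < fls_subdegree g"
        using assms fls_eq0_below_subdegree by blast+
      then show ?thesis by auto
    qed
    then show "{i. ?h i \<noteq> 0} \<subseteq> {b..k - a}" "{i. ?h i \<noteq> 0} \<subseteq> {fls_subdegree g..k - fls_subdegree f}"
      by auto
  qed
  have "fls_nth (f * g) k = (\<Sum>i = fls_subdegree f..k - fls_subdegree g. fls_nth f i * fls_nth g (k - i))"
    by (rule fls_times_nth(2))
  also have "\<dots> = (\<Sum>i = fls_subdegree g..k - fls_subdegree f. ?h i)"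
    by (rule sum.reindex_bij_witness[of _ "\<lambda>i. k - i" "\<lambda>i. k - i"]) auto
  also have "\<dots> = (\<Sum>i\<in>{i. ?h i \<noteq> 0}. ?h i)"
    by (rule sum.mono_neutral_right) (use supp in auto)
  also have "\<dots> = (\<Sum>i = b..k - a. ?h i)"
    by (rule sum.mono_neutral_left) (use supp in auto)
  finally show ?thesis .
qed

text \<open>The only pole of the expansion of \<open>1 / (z\<^sub>1 - \<kappa> z)\<close> at \<open>z\<^sub>1 = z\<close> occurs for \<open>\<kappa> = 1\<close>.\<close>

lemma subst_poly_linear:
  "subst_poly [:[:0, - \<kappa>:], 1:] = fls_X + fls_const (fls_const (1 - \<kappa>) * fls_X)"
proof -
  have "degree [:[:0, - \<kappa>:], 1:] = 1" by simp
  then have "subst_poly [:[:0, - \<kappa>:], 1:] = (\<Sum>j \<le> degree [:0, - \<kappa>:].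
     fls_const (fls_const (coeff [:0, - \<kappa>:] j)) * fls_const fls_X ^ j) + (fls_X + fls_const fls_X)"
    by (simp add: subst_poly_def)
  also have "(\<Sum>j \<le> degree [:0, - \<kappa>:]. fls_const (fls_const (coeff [:0, - \<kappa>:] j)) * fls_const fls_X ^ j) =
     fls_const (fls_const (- \<kappa>) * fls_X)"
    by (cases "\<kappa> = 0") (simp_all add: atMost_Suc)
  finally have "subst_poly [:[:0, - \<kappa>:], 1:] = fls_const (fls_const (- \<kappa>) * fls_X) + (fls_X + fls_const fls_X)" .
  also have "\<dots> = fls_X + fls_const (fls_const (- \<kappa>) * fls_X + fls_X)"
    by (intro fls_eqI) (simp add: algebra_simps)
  also have "fls_const (- \<kappa>) * fls_X + fls_X = fls_const (1 - \<kappa>) * fls_X"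
    by (intro fls_eqI) simp
  finally show ?thesis .
qed

text \<open>After substitution the divisor is z_0 + (1 - \<kappa>) z: either z_0 itself, or a unit
  among the power series in z_0, whose inverse has no pole.\<close>

lemma linear_inverse_residue:
  assumes "\<And>m. m < 0 \<Longrightarrow> fls_nth f m = 0"
  shows "fls_nth (inverse (subst_poly [:[:0, - \<kappa>:], 1:]) * f) (- 1) = (if \<kappa> = 1 then fls_nth f 0 else 0)"
proof (cases "\<kappa> = 1")
  case True
  then show ?thesis by (simp add: subst_poly_linear fls_inverse_X fls_X_inv_times_conv_shift)
next
  case False
  define g where "g = subst_poly [:[:0, - \<kappa>:], 1:]"
  have g0: "fls_nth g 0 \<noteq> 0" using False by (simp add: g_def subst_poly_linear fls_X_times_conv_shift fls_shift_eq0_iff fls_mult_fls_X_nonzero fls_const_nonzero)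
  have "fls_nth g m = 0" if "m < 0" for m using that by (simp add: g_def subst_poly_linear)
  then have "fls_subdegree g = 0" using g0 by (intro fls_subdegree_eqI) auto
  then have "fls_subdegree (inverse g) = 0" by simp
  then have "fls_nth (inverse g) m = 0" if "m < 0" for m using that by simp
  then have "fls_nth (inverse g * f) (- 1) = 0"
    using assms by (subst fls_times_nth_sum[of 0 _ 0]) auto
  then show ?thesis using False by (simp add: g_def)
qed

section \<open>Derivations and degrees\<close>

lemma lookup_kconst_mult: "lookup (kconst c * u) M = c * lookup u M"
proof -
  have "kconst c * u = (\<Sum>N \<in> keys u. kconst c * single N (lookup u N))"
    by (subst (1) kalg_monomials[of u]) (rule sum_distrib_left)
  also have "\<dots> = (\<Sum>N \<in> keys u. single N (c * lookup u N))"
    by (simp add: kconst_def mult_single)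
  finally show ?thesis
    by (simp add: lookup_sum lookup_single when_def in_keys_iff)
qed

text \<open>K(1) is generated by its variables; this reduces the Leibniz rule
  \<open>kpderiv_mult\<close> to multiplication by one variable.\<close>

lemma kalg_induct [case_names const kvar add]:
  assumes const: "\<And>c. P (kconst c)" and kvar: "\<And>j s u. P u \<Longrightarrow> P (kvar j s * u)"
    and add: "\<And>u w. P u \<Longrightarrow> P w \<Longrightarrow> P (u + w)"
  shows "P u"
proof -
  have mono: "P (single M c)" for M :: mono and c
  proof (induction "\<Sum>x \<in> keys M. lookup M x" arbitrary: M)
    case 0
    then have "M = 0" by (intro poly_mapping_eqI) (auto simp: in_keys_iff)
    then show ?case using const[of c] by (simp add: kconst_def)
  next
    case (Suc k)
    then have "keys M \<noteq> {}" by (metis sum.empty Zero_not_Suc)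
    then obtain x where x: "x \<in> keys M" by blast
    obtain j s where js: "x = (j, s)" by (cases x)
    define M' where "M' = M - single x 1"
    have M: "M = single x 1 + M'"
      using x by (intro poly_mapping_eqI) (auto simp: M'_def lookup_add lookup_minus lookup_single when_def in_keys_iff)
    have sub: "keys M' \<subseteq> keys M"
      by (auto simp: M'_def in_keys_iff lookup_minus)
    have "(\<Sum>y \<in> keys M. lookup M y) =
      (\<Sum>y \<in> keys M. (if y = x then 1 else 0) + lookup M' y)"
      by (rule sum.cong[OF refl], subst M) (auto simp: lookup_add lookup_single when_def)
    also have "\<dots> = 1 + (\<Sum>y \<in> keys M'. lookup M' y)"
      using x sub by (simp add: sum.distrib) (rule sum.mono_neutral_right, auto simp: in_keys_iff)
    finally have "P (single M' c)" using Suc by (intro Suc.hyps) simp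
    then have "P (kvar j s * single M' c)" by (rule kvar)
    then show ?case by (subst M) (simp add: kvar_def mult_single js)
  qed
  have "P (\<Sum>N \<in> A. single N (lookup u N))" if "finite A" for A
    using that
  proof (induction A)
    case empty
    then show ?case using const[of 0] by simp
  qed (simp add: add mono)
  then show ?thesis by (subst kalg_monomials[of u]) simp
qed

lemma kpderiv_kconst_mult: "kpderiv x (kconst c * u) = kconst c * kpderiv x u"
  by (rule poly_mapping_eqI) (simp add: kpderiv_lookup lookup_kconst_mult mult.left_commute)

lemma kpderiv_mult: "kpderiv x (u * w) = kpderiv x u * w + u * kpderiv x w"
proof (induction u arbitrary: w rule: kalg_induct)
  case (const c)
  have "kpderiv x (kconst c) = 0" using kpderiv_kconst_mult[of x c 1] by (simp add: kpderiv_one)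
  then show ?case by (simp add: kpderiv_kconst_mult)
next
  case (kvar j s u)
  have "kpderiv x (kvar j s * u * w) = kvar j s * kpderiv x (u * w) + (if x = (j, s) then u * w else 0)"
    by (simp only: mult.assoc kpderiv_kvar_mult)
  also have "\<dots> = kpderiv x (kvar j s * u) * w + kvar j s * u * kpderiv x w"
    by (simp add: kvar kpderiv_kvar_mult distrib_left distrib_right mult.assoc)
  finally show ?case .
qed (simp add: distrib_right kpderiv_add algebra_simps)

lemma kpderiv_commute: "kpderiv x (kpderiv y u) = kpderiv y (kpderiv x u)"
proof (rule poly_mapping_eqI)
  fix M
  show "lookup (kpderiv x (kpderiv y u)) M = lookup (kpderiv y (kpderiv x u)) M"
    by (cases "x = y")
       (simp_all add: kpderiv_lookup lookup_add lookup_single when_def add.assoc add.commute add.left_commute mult.left_commute)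
qed

lemma klinear_kpderiv: "klinear (kpderiv x)"
  by (simp add: klinear_def kpderiv_add kpderiv_kconst_mult)

lemma klinear_sumI: "(\<And>x. x \<in> A \<Longrightarrow> klinear (T x)) \<Longrightarrow> klinear (\<lambda>u. \<Sum>x\<in>A. T x u)"
  by (simp add: klinear_def sum.distrib sum_distrib_left)

lemma klinear_scaleI: "klinear T \<Longrightarrow> klinear (\<lambda>u. kconst c * T u)"
  by (simp add: klinear_def distrib_left mult.left_commute)

text \<open>A family \<open>c :: modes\<close> stands for \<open>\<Sum> c\<^sub>r\<^sub>l a\<^sub>l(\<plusminus>r)\<close>. The values at \<open>r = 0\<close> are irrelevant.\<close>

type_synonym modes = "nat \<Rightarrow> nat \<Rightarrow> qf"

definition creation :: "nat \<Rightarrow> modes \<Rightarrow> nat \<Rightarrow> kalg" where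
  "creation n pc r = (\<Sum>l = 1..n. kconst (pc r l) * kvar l r)"

definition annihilation :: "nat \<Rightarrow> modes \<Rightarrow> nat \<Rightarrow> kalg \<Rightarrow> kalg" where
  "annihilation n dc r u = (\<Sum>l = 1..n. kconst (dc r l) * kann n l r u)"

text \<open>The scalar commutator of the mode \<open>r\<close> annihilation part with the mode
  \<open>r\<close> creation part, see \<open>annihilation_creation\<close>.\<close>

definition contraction :: "nat \<Rightarrow> modes \<Rightarrow> modes \<Rightarrow> nat \<Rightarrow> qf" where
  "contraction n dc pc r = (\<Sum>l = 1..n. \<Sum>l' = 1..n. dc r l * pc r l' *
     (qint (cartan l l' * int r) * qint (int r) / of_nat r))"

lemma klinear_kann: "klinear (kann n j r)"
  unfolding kann_def[abs_def] by (intro klinear_sumI klinear_scaleI klinear_kpderiv)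

lemma klinear_annihilation: "klinear (annihilation n dc r)"
  unfolding annihilation_def[abs_def] by (intro klinear_sumI klinear_scaleI klinear_kann)

lemma kann_mult: "kann n j r (u * w) = kann n j r u * w + u * kann n j r w"
  by (simp add: kann_def kpderiv_mult distrib_left sum.distrib sum_distrib_left sum_distrib_right mult.assoc mult.left_commute)

lemma annihilation_mult: "annihilation n dc r (u * w) = annihilation n dc r u * w + u * annihilation n dc r w"
  by (simp add: annihilation_def kann_mult distrib_left sum.distrib sum_distrib_left sum_distrib_right mult.assoc mult.left_commute)

lemma klinear_sum_commute:
  assumes S: "\<And>x. klinear (S x)" and T: "\<And>y. klinear (T y)" and comm: "\<And>x y u. S x (T y u) = T y (S x u)"
  shows "(\<Sum>x\<in>A. kconst (c x) * S x (\<Sum>y\<in>B. kconst (d y) * T y u)) =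
    (\<Sum>y\<in>B. kconst (d y) * T y (\<Sum>x\<in>A. kconst (c x) * S x u))"
proof -
  have "(\<Sum>x\<in>A. kconst (c x) * S x (\<Sum>y\<in>B. kconst (d y) * T y u)) =
    (\<Sum>x\<in>A. \<Sum>y\<in>B. kconst (d y) * (kconst (c x) * T y (S x u)))"
    by (simp only: klinear_sum[OF S] klinear_scale[OF S] sum_distrib_left comm mult.left_commute)
  also have "\<dots> = (\<Sum>y\<in>B. kconst (d y) * T y (\<Sum>x\<in>A. kconst (c x) * S x u))"
    by (subst sum.swap) (simp only: klinear_sum[OF T] klinear_scale[OF T] sum_distrib_left)
  finally show ?thesis .
qed

lemma kann_commute: "kann n j r (kann n j' s u) = kann n j' s (kann n j r u)"
  unfolding kann_def by (rule klinear_sum_commute) (rule klinear_kpderiv kpderiv_commute)+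

lemma annihilation_commute:
  "annihilation n dc r (annihilation n dc' s u) = annihilation n dc' s (annihilation n dc r u)"
  unfolding annihilation_def by (rule klinear_sum_commute) (rule klinear_kann kann_commute)+

lemma kconst_sum: "kconst (sum g A) = (\<Sum>x\<in>A. kconst (g x))"
  by (induction A rule: infinite_finite_induct) (simp_all add: kconst_add)

lemma annihilation_creation:
  "annihilation n dc r (creation n pc s) = (if s = r then kconst (contraction n dc pc r) else 0)"
proof -
  have kv: "kann n l r (kvar l' s) = kconst (if s = r then qint (cartan l l' * int r) * qint (int r) / of_nat r else 0)"
    if "l' \<in> {1..n}" for l l'
    using kann_kvar_mult[OF that, of l r s 1] by (auto simp: kann_one)
  have "annihilation n dc r (creation n pc s) = (\<Sum>l = 1..n. \<Sum>l' = 1..n.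
     kconst (dc r l) * (kconst (pc s l') * kann n l r (kvar l' s)))"
    by (simp only: annihilation_def creation_def klinear_sum[OF klinear_kann] klinear_scale[OF klinear_kann] sum_distrib_left)
  also have "\<dots> = (\<Sum>l = 1..n. \<Sum>l' = 1..n. kconst (if s = r then dc r l * pc r l' *
     (qint (cartan l l' * int r) * qint (int r) / of_nat r) else 0))"
    by (intro sum.cong refl) (auto simp: kv mult.assoc simp flip: kconst_mult)
  also have "\<dots> = (if s = r then kconst (contraction n dc pc r) else 0)"
    by (simp add: contraction_def kconst_sum)
  finally show ?thesis .
qed

text \<open>The degree of \<open>a\<^sub>i(-r)\<close> is \<open>r\<close>; negative bounds are allowed and force the element to vanish.\<close>

definition mdeg :: "mono \<Rightarrow> nat" where
  "mdeg M = (\<Sum>x \<in> keys M. snd x * lookup M x)"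

definition kdeg_le :: "int \<Rightarrow> kalg \<Rightarrow> bool" where
  "kdeg_le d u \<longleftrightarrow> (\<forall>M \<in> keys u. int (mdeg M) \<le> d)"

lemma mdeg_superset:
  "finite A \<Longrightarrow> keys M \<subseteq> A \<Longrightarrow> mdeg M = (\<Sum>x \<in> A. snd x * lookup M x)"
  unfolding mdeg_def by (rule sum.mono_neutral_left) (auto simp: in_keys_iff)

lemma mdeg_add: "mdeg (M + N) = mdeg M + mdeg N"
proof -
  let ?A = "keys M \<union> keys N"
  have "keys (M + N) \<subseteq> ?A" by (rule keys_add)
  then show ?thesis
    by (subst (1 2 3) mdeg_superset[of ?A]) (auto simp: lookup_add sum.distrib distrib_left)
qed

lemma mdeg_single: "mdeg (single x k) = snd x * k"
  by (simp add: mdeg_def)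

lemma mdeg_0 [simp]: "mdeg 0 = 0"
  by (simp add: mdeg_def)

lemma kdeg_le_neg: "kdeg_le d u \<Longrightarrow> d < 0 \<Longrightarrow> u = 0"
  by (force simp: kdeg_le_def simp flip: keys_eq_empty)

lemma kdeg_le_0 [simp]: "kdeg_le d 0"
  by (simp add: kdeg_le_def)

lemma kdeg_le_mono: "kdeg_le d u \<Longrightarrow> d \<le> d' \<Longrightarrow> kdeg_le d' u"
  by (force simp: kdeg_le_def)

lemma kdeg_le_add: "kdeg_le d u \<Longrightarrow> kdeg_le d w \<Longrightarrow> kdeg_le d (u + w)"
  using keys_add[of u w] by (auto simp: kdeg_le_def)

lemma kdeg_le_mult: "kdeg_le d u \<Longrightarrow> kdeg_le d' w \<Longrightarrow> kdeg_le (d + d') (u * w)"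
  using keys_mult[of u w] by (force simp: kdeg_le_def mdeg_add)

lemma kdeg_le_kconst: "kdeg_le 0 (kconst c)"
  by (simp add: kdeg_le_def kconst_def)

lemma kdeg_le_kconst_mult: "kdeg_le d u \<Longrightarrow> kdeg_le d (kconst c * u)"
  using kdeg_le_mult[OF kdeg_le_kconst, of d u c] by simp

lemma kdeg_le_kvar: "kdeg_le (int r) (kvar j r)"
  by (simp add: kdeg_le_def kvar_def mdeg_single)

lemma kdeg_le_kpderiv: "kdeg_le d u \<Longrightarrow> kdeg_le (d - int r) (kpderiv (j, r) u)"
  unfolding kdeg_le_def
proof
  fix M assume u: "\<forall>M \<in> keys u. int (mdeg M) \<le> d" and "M \<in> keys (kpderiv (j, r) u)"
  then have "M + single (j, r) 1 \<in> keys u"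
    by (auto simp: in_keys_iff kpderiv_lookup)
  then have "int (mdeg (M + single (j, r) 1)) \<le> d" using u by blast
  then show "int (mdeg M) \<le> d - int r" by (simp add: mdeg_add mdeg_single)
qed

definition kdeg :: "kalg \<Rightarrow> nat" where
  "kdeg u = (LEAST d. kdeg_le (int d) u)"

lemma kdeg_le_kdeg: "kdeg_le (int (kdeg u)) u"
proof -
  have "kdeg_le (int (\<Sum>M \<in> keys u. mdeg M)) u"
    unfolding kdeg_le_def by (auto intro!: member_le_sum)
  then show ?thesis unfolding kdeg_def by (rule LeastI)
qed

lemma kdeg_leI: "kdeg_le (int d) u \<Longrightarrow> kdeg u \<le> d"
  unfolding kdeg_def by (rule Least_le)

text \<open>One induction for three gradings: s = -1 for annihilation, s = 1 for creation, and s = 0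
  for membership in \<open>Kspace n\<close>.\<close>

lemma kexp_graded:
  assumes P0: "\<And>d. P d 0" and add: "\<And>d u w. P d u \<Longrightarrow> P d w \<Longrightarrow> P d (u + w)"
    and scale: "\<And>d c u. P d u \<Longrightarrow> P d (kconst c * u)"
    and D: "\<And>d r u. r \<ge> 1 \<Longrightarrow> P d u \<Longrightarrow> P (d + s * int r) (D r u)"
    and u: "P d u"
  shows "P (d + s * int m) (kexp D m u)"
proof -
  have sum: "P d (\<Sum>x\<in>A. g x)" if "\<And>x. x \<in> A \<Longrightarrow> P d (g x)" for d and A :: "nat set" and g
    using that by (induction A rule: infinite_finite_induct) (auto intro: P0 add)
  have "P (d + s * int m) (kpow D k m u)" for k m
  proof (induction k arbitrary: m)
    case 0
    then show ?case using u by (simp add: P0)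
  next
    case (Suc k)
    have "P (d + s * int m) (D r (kpow D k (m - r) u))" if "r \<in> {1..m}" for r
      using D[OF _ Suc, of r "m - r"] that by (simp add: of_nat_diff algebra_simps)
    then show ?case unfolding kpow.simps by (rule sum)
  qed
  then show ?thesis unfolding kexp_def by (intro sum scale)
qed

lemma kdeg_le_annihilation: "kdeg_le d u \<Longrightarrow> kdeg_le (d + - 1 * int r) (annihilation n dc r u)"
proof -
  assume "kdeg_le d u"
  have sum: "kdeg_le d (\<Sum>x\<in>A. g x)" if "\<And>x. x \<in> A \<Longrightarrow> kdeg_le d (g x)" for d and A :: "nat set" and g
    using that by (induction A rule: infinite_finite_induct) (auto intro: kdeg_le_add)
  show ?thesis unfolding annihilation_def kann_def
    by (intro sum kdeg_le_kconst_mult) (use kdeg_le_kpderiv[OF \<open>kdeg_le d u\<close>] in simp)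
qed

lemma kdeg_le_creation: "kdeg_le (int r) (creation n pc r)"
proof -
  have sum: "kdeg_le d (\<Sum>x\<in>A. g x)" if "\<And>x. x \<in> A \<Longrightarrow> kdeg_le d (g x)" for d and A :: "nat set" and g
    using that by (induction A rule: infinite_finite_induct) (auto intro: kdeg_le_add)
  show ?thesis unfolding creation_def by (intro sum kdeg_le_kconst_mult kdeg_le_kvar)
qed

lemma kdeg_le_kexp_annihilation:
  assumes "kdeg_le d u" shows "kdeg_le (d - int l) (kexp (annihilation n dc) l u)"
  using kexp_graded[where P = kdeg_le and s = "- 1" and D = "annihilation n dc", OF kdeg_le_0 kdeg_le_add
      kdeg_le_kconst_mult kdeg_le_annihilation assms] by simp

lemma kdeg_le_crexp: "kdeg_le (int m) (crexp (creation n pc) m)"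
proof -
  have "kdeg_le (0 + 1 * int m) (kexp (\<lambda>r u. creation n pc r * u) m 1)"
  proof (rule kexp_graded[where P = kdeg_le])
    show "kdeg_le (d + 1 * int r) (creation n pc r * u)" if "kdeg_le d u" for d r u
      using kdeg_le_mult[OF kdeg_le_creation that] by (simp add: add.commute)
    show "kdeg_le 0 1" using kdeg_le_kconst[of 1] by simp
  qed (auto intro: kdeg_le_add kdeg_le_kconst_mult)
  then show ?thesis by (simp add: crexp_def)
qed

section \<open>Invariance of the subspace \<open>Kspace n\<close>\<close>

lemma Kspace_add: "u \<in> Kspace n \<Longrightarrow> w \<in> Kspace n \<Longrightarrow> u + w \<in> Kspace n"
  using keys_add[of u w] by (fastforce simp: Kspace_def)

lemma Kspace_mult: "u \<in> Kspace n \<Longrightarrow> w \<in> Kspace n \<Longrightarrow> u * w \<in> Kspace n"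
proof -
  assume u: "u \<in> Kspace n" and w: "w \<in> Kspace n"
  have "keys M \<subseteq> {1..n} \<times> {1..}" if "M \<in> keys (u * w)" for M
  proof -
    have "M \<in> {a + b |a b. a \<in> keys u \<and> b \<in> keys w}"
      using that keys_mult by (rule subsetD[rotated])
    then obtain M1 M2 where "M = M1 + M2" "M1 \<in> keys u" "M2 \<in> keys w"
      by blast
    moreover have "keys (M1 + M2) \<subseteq> keys M1 \<union> keys M2"
      by (rule keys_add)
    ultimately show ?thesis using u w by (auto simp: Kspace_def)
  qed
  then show ?thesis by (simp add: Kspace_def)
qed

lemma Kspace_kconst: "kconst c \<in> Kspace n"
  by (simp add: Kspace_def kconst_def)

lemma Kspace_0 [simp]: "0 \<in> Kspace n"
  by (simp add: Kspace_def)

lemma Kspace_sum: "(\<And>x. x \<in> A \<Longrightarrow> g x \<in> Kspace n) \<Longrightarrow> sum g A \<in> Kspace n"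
  by (induction A rule: infinite_finite_induct) (auto intro: Kspace_add)

lemma Kspace_kpderiv: "u \<in> Kspace n \<Longrightarrow> kpderiv x u \<in> Kspace n"
proof -
  assume u: "u \<in> Kspace n"
  have "keys M \<subseteq> {1..n} \<times> {1..}" if "M \<in> keys (kpderiv x u)" for M
  proof -
    have "M + single x 1 \<in> keys u"
      using that by (auto simp: in_keys_iff kpderiv_lookup)
    then have "keys (M + single x 1) \<subseteq> {1..n} \<times> {1..}"
      using u unfolding Kspace_def by blast
    moreover have "keys M \<subseteq> keys (M + single x 1)"
      by (auto simp: in_keys_iff lookup_add)
    ultimately show ?thesis by blast
  qed
  then show ?thesis by (simp add: Kspace_def)
qed

lemma Kspace_kexp_annihilation: "u \<in> Kspace n \<Longrightarrow> kexp (annihilation n dc) l u \<in> Kspace n"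
proof -
  assume u: "u \<in> Kspace n"
  show ?thesis
    by (rule kexp_graded[where P = "\<lambda>d u. u \<in> Kspace n" and s = 0 and d = 0])
       (auto intro!: Kspace_add Kspace_mult Kspace_kconst Kspace_sum Kspace_kpderiv u
         simp: annihilation_def kann_def)
qed

lemma Kspace_crexp_creation: "crexp (creation n pc) m \<in> Kspace n"
proof -
  have kv: "kvar l r \<in> Kspace n" if "l \<in> {1..n}" "r \<ge> 1" for l r
    using that by (auto simp: Kspace_def kvar_def)
  have "kexp (\<lambda>r u. creation n pc r * u) m 1 \<in> Kspace n"
    by (rule kexp_graded[where P = "\<lambda>d u. u \<in> Kspace n" and s = 0 and d = 0])
       (use Kspace_kconst[of 1 n] in \<open>auto intro!: Kspace_add Kspace_mult Kspace_kconst Kspace_sum kv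
         simp: creation_def\<close>)
  then show ?thesis by (simp add: crexp_def)
qed

section \<open>Composition of vertex operators on the symmetric algebra\<close>

abbreviation aexp :: "nat \<Rightarrow> modes \<Rightarrow> nat \<Rightarrow> kalg \<Rightarrow> kalg" where
  "aexp n dc \<equiv> kexp (annihilation n dc)"

text \<open>Extension by 0 to negative exponents lets the index be shifted freely by annihilation
  and contraction modes.\<close>

definition icrexp :: "nat \<Rightarrow> modes \<Rightarrow> int \<Rightarrow> kalg" where
  "icrexp n pc k = (if k < 0 then 0 else crexp (creation n pc) (nat k))"

text \<open>The coefficient of \<open>z\<^sup>k\<close> in \<open>exp(\<Sum> pc\<^sub>r\<^sub>l a\<^sub>l(-r) z\<^sup>r) exp(\<Sum> dc\<^sub>r\<^sub>l a\<^sub>l(r) z\<^bsup>-r\<^esup>) u\<close>.\<close>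

definition vcoeff :: "nat \<Rightarrow> modes \<Rightarrow> modes \<Rightarrow> kalg \<Rightarrow> int \<Rightarrow> kalg" where
  "vcoeff n pc dc u k = (\<Sum>l\<le>kdeg u. icrexp n pc (k + int l) * aexp n dc l u)"

text \<open>The coefficient of z_1^r z_2^k in the product with all creation parts to the left. The
  number \<open>d\<close> truncates both annihilation sums and is meant to bound the degree of
  \<open>u\<close>.\<close>

definition normal_ordered :: "nat \<Rightarrow> modes \<Rightarrow> modes \<Rightarrow> modes \<Rightarrow>
    modes \<Rightarrow> nat \<Rightarrow> kalg \<Rightarrow> int \<Rightarrow> int \<Rightarrow> kalg" where
  "normal_ordered n pa da pb db d u r k = (\<Sum>l'\<le>d. \<Sum>l\<le>d.
     icrexp n pa (r + int l') * icrexp n pb (k + int l) * aexp n da l' (aexp n db l u))"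

text \<open>\<open>\<rho>(x) = exp(\<Sum> c\<^sub>r x\<^sup>r)\<close>, expressed by the differential equation \<open>x \<rho>' = (\<Sum> r c\<^sub>r x\<^sup>r) \<rho>\<close>.\<close>

definition exp_series :: "(nat \<Rightarrow> qf) \<Rightarrow> (nat \<Rightarrow> qf) \<Rightarrow> bool" where
  "exp_series c \<rho> \<longleftrightarrow> \<rho> 0 = 1 \<and> (\<forall>l>0. of_nat l * \<rho> l = (\<Sum>r = 1..l. of_nat r * c r * \<rho> (l - r)))"

lemma aexp_eq_0: "kdeg_le d u \<Longrightarrow> d < int l \<Longrightarrow> aexp n dc l u = 0"
  using kdeg_le_neg[OF kdeg_le_kexp_annihilation] by simp

lemma klinear_aexp: "klinear (aexp n dc l)"
  by (rule klinear_kexp[OF klinear_annihilation])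

lemma icrexp_neg [simp]: "k < 0 \<Longrightarrow> icrexp n pc k = 0"
  by (simp add: icrexp_def)

lemma kdeg_le_icrexp: "kdeg_le k (icrexp n pc k)"
  using kdeg_le_crexp[of "nat k" n pc] by (cases "k < 0") (simp_all add: icrexp_def)

lemma Kspace_icrexp: "icrexp n pc k \<in> Kspace n"
  by (simp add: icrexp_def Kspace_crexp_creation)

lemma vcoeff_eq:
  assumes "kdeg_le (int d) u"
  shows "vcoeff n pc dc u k = (\<Sum>l\<le>d. icrexp n pc (k + int l) * aexp n dc l u)"
  unfolding vcoeff_def
  by (rule sum.mono_neutral_left) (use kdeg_leI[OF assms] aexp_eq_0[OF kdeg_le_kdeg] in auto)

lemma vcoeff_0 [simp]: "vcoeff n pc dc 0 k = 0"
  by (simp add: vcoeff_def klinear_0[OF klinear_aexp])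

lemma vcoeff_add: "vcoeff n pc dc (u + w) k = vcoeff n pc dc u k + vcoeff n pc dc w k"
proof -
  define d where "d = max (kdeg u) (kdeg w)"
  have u: "kdeg_le (int d) u" and w: "kdeg_le (int d) w"
    using kdeg_le_mono[OF kdeg_le_kdeg] by (simp_all add: d_def)
  show ?thesis
    unfolding vcoeff_eq[OF u] vcoeff_eq[OF w] vcoeff_eq[OF kdeg_le_add[OF u w]]
    by (simp add: klinear_add[OF klinear_aexp] distrib_left sum.distrib)
qed

lemma vcoeff_scale: "vcoeff n pc dc (kconst c * u) k = kconst c * vcoeff n pc dc u k"
  unfolding vcoeff_eq[OF kdeg_le_kdeg[of u]] vcoeff_eq[OF kdeg_le_kconst_mult[OF kdeg_le_kdeg[of u]]]
  by (simp add: klinear_scale[OF klinear_aexp] sum_distrib_left mult.left_commute)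

lemma kdeg_le_sum: "(\<And>x. x \<in> A \<Longrightarrow> kdeg_le d (g x)) \<Longrightarrow> kdeg_le d (sum g A)"
  by (induction A rule: infinite_finite_induct) (auto intro: kdeg_le_add)

lemma kdeg_le_vcoeff:
  assumes "kdeg_le (int d) u" shows "kdeg_le (k + int d) (vcoeff n pc dc u k)"
  unfolding vcoeff_eq[OF assms]
proof (rule kdeg_le_sum)
  fix l
  show "kdeg_le (k + int d) (icrexp n pc (k + int l) * aexp n dc l u)"
    using kdeg_le_mult[OF kdeg_le_icrexp kdeg_le_kexp_annihilation[OF assms]] by (rule kdeg_le_mono) simp
qed

lemma vcoeff_eq_0: "kdeg_le (int d) u \<Longrightarrow> k < - int d \<Longrightarrow> vcoeff n pc dc u k = 0"
  using kdeg_le_neg[OF kdeg_le_vcoeff] by force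

lemma Kspace_vcoeff: "u \<in> Kspace n \<Longrightarrow> vcoeff n pc dc u k \<in> Kspace n"
  unfolding vcoeff_def by (intro Kspace_sum Kspace_mult Kspace_icrexp Kspace_kexp_annihilation)

lemma vcoeff_1: "vcoeff n pc dc 1 0 = 1"
proof -
  have "kdeg_le (int 0) 1" using kdeg_le_kconst[of 1] by simp
  then show ?thesis using vcoeff_eq[of 0 1 n pc dc 0] by (simp add: icrexp_def)
qed

lemma normal_ordered_eq_0:
  "r < - int d \<or> k < - int d \<Longrightarrow> normal_ordered n pa da pb db d u r k = 0"
  unfolding normal_ordered_def by (intro sum.neutral ballI) auto

text \<open>The case distinction of \<open>kexp_crexp\<close> disappears into the convention for
  negative indices.\<close>

lemma aexp_icrexp:
  assumes "exp_series c \<rho>"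
    and "\<And>r. r \<ge> 1 \<Longrightarrow> c r = contraction n da pb r"
  shows "aexp n da i (icrexp n pb x) = kconst (\<rho> i) * icrexp n pb (x - int i)"
proof (cases "x < 0")
  case False
  have "aexp n da i (crexp (creation n pb) (nat x)) =
     (if i \<le> nat x then kconst (\<rho> i) * crexp (creation n pb) (nat x - i) else 0)"
    by (rule kexp_crexp[OF klinear_annihilation annihilation_commute annihilation_mult, where c = c])
       (use assms in \<open>auto simp: annihilation_creation exp_series_def\<close>)
  moreover have "nat x - i = nat (x - int i)" by simp
  ultimately show ?thesis using False by (auto simp: icrexp_def)
qed (simp add: klinear_0[OF klinear_aexp])

text \<open>In generating series: a(z_1) b(z_2) equals \<rho>(z_2 / z_1) times the normal ordered
  product. The term z_2^i / z_1^i shifts the exponents to \<open>r + i\<close> and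
  \<open>k - i\<close>, and beyond \<open>I\<close> the second one is too low to contribute.\<close>

lemma vcoeff_vcoeff:
  assumes rho: "exp_series c \<rho>" "\<And>r. r \<ge> 1 \<Longrightarrow> c r = contraction n da pb r"
    and d: "kdeg_le (int d) u" and I: "k + int d \<le> int I"
  shows "vcoeff n pa da (vcoeff n pb db u k) r =
    (\<Sum>i\<le>I. kconst (\<rho> i) * normal_ordered n pa da pb db d u (r + int i) (k - int i))"
proof -
  \<comment> \<open>\<open>i\<close> is the part of the annihilation index spent on the contraction,
    \<open>a\<close> the part that reaches \<open>u\<close>.\<close>
  define F where "F i a = (\<Sum>l\<le>d. kconst (\<rho> i) * (icrexp n pa (r + int i + int a) *
     icrexp n pb (k - int i + int l) * aexp n da a (aexp n db l u)))" for i a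
  have F0: "F i a = 0" if "i > I \<or> a > d" for i a
    unfolding F_def
  proof (intro sum.neutral ballI)
    fix l assume l: "l \<in> {..d}"
    show "kconst (\<rho> i) * (icrexp n pa (r + int i + int a) * icrexp n pb (k - int i + int l) *
       aexp n da a (aexp n db l u)) = 0"
    proof (cases "i > I")
      case True
      then have "k - int i + int l < 0" using I l by auto
      then show ?thesis by simp
    next
      case False
      then have "aexp n da a (aexp n db l u) = 0"
        using that by (intro aexp_eq_0[OF kdeg_le_kexp_annihilation[OF d]]) simp
      then show ?thesis by simp
    qed
  qed
  have "kdeg_le (int (I + d)) (vcoeff n pb db u k)"
    by (rule kdeg_le_mono[OF kdeg_le_vcoeff[OF d]]) (use I in simp)
  then have "vcoeff n pa da (vcoeff n pb db u k) r =
     (\<Sum>l'\<le>I + d. icrexp n pa (r + int l') * aexp n da l' (vcoeff n pb db u k))"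
    by (rule vcoeff_eq)
  also have "\<dots> = (\<Sum>l'\<le>I + d. \<Sum>i\<le>l'. F i (l' - i))"
  proof (rule sum.cong[OF refl])
    fix l'
    have "aexp n da l' (vcoeff n pb db u k) = (\<Sum>l\<le>d. \<Sum>i\<le>l'.
       kconst (\<rho> i) * icrexp n pb (k + int l - int i) * aexp n da (l' - i) (aexp n db l u))"
      by (simp only: vcoeff_eq[OF d] klinear_sum[OF klinear_aexp]
          kexp_leibniz[OF klinear_annihilation annihilation_commute annihilation_mult] aexp_icrexp[OF rho])
    also have "\<dots> = (\<Sum>i\<le>l'. \<Sum>l\<le>d.
       kconst (\<rho> i) * icrexp n pb (k + int l - int i) * aexp n da (l' - i) (aexp n db l u))"
      by (rule sum.swap)
    finally have "icrexp n pa (r + int l') * aexp n da l' (vcoeff n pb db u k) = (\<Sum>i\<le>l'. \<Sum>l\<le>d.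
       icrexp n pa (r + int l') * (kconst (\<rho> i) * icrexp n pb (k + int l - int i) * aexp n da (l' - i) (aexp n db l u)))"
      by (simp add: sum_distrib_left)
    also have "\<dots> = (\<Sum>i\<le>l'. F i (l' - i))"
      unfolding F_def by (intro sum.cong refl) (simp add: of_nat_diff mult.assoc mult.left_commute diff_add_eq)
    finally show "icrexp n pa (r + int l') * aexp n da l' (vcoeff n pb db u k) = (\<Sum>i\<le>l'. F i (l' - i))" .
  qed
  also have "\<dots> = (\<Sum>(l', i) \<in> Sigma {..I + d} (\<lambda>l'. {..l'}). F i (l' - i))"
    by (simp add: sum.Sigma)
  also have "\<dots> = (\<Sum>(i, a) \<in> {(i, a). i + a \<le> I + d}. F i a)"
    by (rule sum.reindex_bij_witness[of _ "\<lambda>(i, a). (i + a, i)" "\<lambda>(l', i). (i, l' - i)"]) auto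
  also have "\<dots> = (\<Sum>(i, a) \<in> {..I} \<times> {..d}. F i a)"
  proof (rule sum.mono_neutral_right)
    show "finite {(i, a). i + a \<le> I + d}"
      by (rule finite_subset[of _ "{..I + d} \<times> {..I + d}"]) auto
  next
    have "i \<le> I \<and> a \<le> d" if "F i a \<noteq> 0" for i a using F0[of i a] that by (meson not_le)
    then show "\<forall>x \<in> {(i, a). i + a \<le> I + d} - {..I} \<times> {..d}. (case x of (i, a) \<Rightarrow> F i a) = 0"
      by auto
  qed auto
  also have "\<dots> = (\<Sum>i\<le>I. \<Sum>a\<le>d. F i a)" by (simp add: sum.cartesian_product)
  also have "\<dots> = (\<Sum>i\<le>I. kconst (\<rho> i) * normal_ordered n pa da pb db d u (r + int i) (k - int i))"
    by (simp add: normal_ordered_def F_def sum_distrib_left)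
  finally show ?thesis .
qed

text \<open>This and the next two lemmas give (1 - \<kappa> x)^(-p) for p = 1, 0, -1 as the
  exponential of p \<Sum> (\<kappa> x)^r / r.\<close>

lemma exp_series_geometric:
  assumes "\<And>r. r \<ge> 1 \<Longrightarrow> c r = \<kappa> ^ r / of_nat r"
  shows "exp_series c (\<lambda>i. \<kappa> ^ i)"
proof -
  have "(\<Sum>r = 1..l. of_nat r * c r * \<kappa> ^ (l - r)) = (\<Sum>r = 1..l. \<kappa> ^ l)" for l
    by (rule sum.cong[OF refl]) (auto simp: assms simp flip: power_add)
  then show ?thesis by (simp add: exp_series_def)
qed

lemma exp_series_trivial:
  assumes "\<And>r. r \<ge> 1 \<Longrightarrow> c r = 0"
  shows "exp_series c (\<lambda>i. if i = 0 then 1 else 0)"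
  using assms by (simp add: exp_series_def)

lemma exp_series_linear:
  assumes "\<And>r. r \<ge> 1 \<Longrightarrow> c r = - (\<kappa> ^ r / of_nat r)"
  shows "exp_series c (\<lambda>i. if i = 0 then 1 else if i = 1 then - \<kappa> else 0)" (is "exp_series c ?\<rho>")
  unfolding exp_series_def
proof (intro conjI allI impI)
  fix l :: nat assume "l > 0"
  have "(\<Sum>r = 1..l. of_nat r * c r * ?\<rho> (l - r)) = (\<Sum>r = 1..l. - (\<kappa> ^ r) * ?\<rho> (l - r))"
    by (rule sum.cong[OF refl]) (auto simp: assms)
  also have "\<dots> = of_nat l * ?\<rho> l"
  proof (cases "l = 1")
    \<comment> \<open>Only r = l and r = l - 1 contribute, with opposite signs.\<close>
    case False
    define k where "k = l - 2"
    have k: "l = Suc (Suc k)" using False \<open>l > 0\<close> by (simp add: k_def)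
    have "(\<Sum>r = 1..l. - (\<kappa> ^ r) * ?\<rho> (l - r)) = (\<Sum>r \<in> {Suc k, Suc (Suc k)}. - (\<kappa> ^ r) * ?\<rho> (l - r))"
      by (rule sum.mono_neutral_right) (auto simp: k)
    then show ?thesis by (simp add: k)
  qed simp
  finally show "of_nat l * ?\<rho> l = (\<Sum>r = 1..l. of_nat r * c r * ?\<rho> (l - r))" by simp
qed simp

text \<open>Multiplication by \<open>z\<^sub>1 - \<kappa> z\<^sub>2\<close> removes the pole of the product of the two operators.\<close>

lemma vcoeff_product_pole:
  assumes c: "\<And>r. r \<ge> 1 \<Longrightarrow> contraction n da pb r = \<kappa> ^ r / of_nat r"
    and d: "kdeg_le (int d) u"
  shows "vcoeff n pa da (vcoeff n pb db u k) (r - 1) - kconst \<kappa> * vcoeff n pa da (vcoeff n pb db u (k - 1)) r =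
    normal_ordered n pa da pb db d u (r - 1) k"
proof -
  define I where "I = nat (k + int d)"
  have rho: "exp_series (\<lambda>r. contraction n da pb r) (\<lambda>i. \<kappa> ^ i)"
    by (rule exp_series_geometric) (rule c)
  note v = vcoeff_vcoeff[OF rho refl d]
  have "vcoeff n pa da (vcoeff n pb db u k) (r - 1) =
     (\<Sum>i\<le>Suc I. kconst (\<kappa> ^ i) * normal_ordered n pa da pb db d u (r - 1 + int i) (k - int i))"
    by (rule v) (simp add: I_def)
  \<comment> \<open>Taking out i = 0 from the geometric series leaves \<kappa> times the series for
    the exponents \<open>(r, k - 1)\<close>.\<close>
  also have "\<dots> = normal_ordered n pa da pb db d u (r - 1) k +
     kconst \<kappa> * (\<Sum>i\<le>I. kconst (\<kappa> ^ i) * normal_ordered n pa da pb db d u (r + int i) (k - 1 - int i))"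
    by (simp add: sum.atMost_Suc_shift sum_distrib_left kconst_mult_left algebra_simps del: sum.atMost_Suc)
  also have "(\<Sum>i\<le>I. kconst (\<kappa> ^ i) * normal_ordered n pa da pb db d u (r + int i) (k - 1 - int i)) =
     vcoeff n pa da (vcoeff n pb db u (k - 1)) r"
    by (rule v[symmetric]) (simp add: I_def)
  finally show ?thesis by simp
qed

text \<open>The contraction series is a polynomial of degree at most 1, so lower bounds hold without
  a multiplier. The extra 1 in the bound pays for the shift of the exponents by its linear
  term.\<close>

lemma vcoeff_product_regular:
  assumes c: "p = 0 \<or> p = - 1" "\<And>r. r \<ge> 1 \<Longrightarrow> contraction n da pb r = of_int p * (\<kappa> ^ r / of_nat r)"
    and d: "kdeg_le (int d) u" and rk: "r < - int d - 1 \<or> k < - int d - 1"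
  shows "vcoeff n pa da (vcoeff n pb db u k) r = 0"
proof -
  define I where "I = nat (k + int d)"
  obtain \<rho> where rho: "exp_series (\<lambda>r. contraction n da pb r) \<rho>" "\<And>i. i > 1 \<Longrightarrow> \<rho> i = 0"
  proof (cases "p = 0")
    case True
    then have "exp_series (\<lambda>r. contraction n da pb r) (\<lambda>i. if i = 0 then 1 else 0)"
      using c by (intro exp_series_trivial) simp
    then show thesis by (rule that) simp
  next
    case False
    then have "exp_series (\<lambda>r. contraction n da pb r) (\<lambda>i. if i = 0 then 1 else if i = 1 then - \<kappa> else 0)"
      using c by (intro exp_series_linear) simp
    then show thesis by (rule that) simp
  qed
  have "vcoeff n pa da (vcoeff n pb db u k) r =
     (\<Sum>i\<le>I. kconst (\<rho> i) * normal_ordered n pa da pb db d u (r + int i) (k - int i))"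
    by (rule vcoeff_vcoeff[OF rho(1) refl d]) (simp add: I_def)
  also have "\<dots> = 0"
  proof (intro sum.neutral ballI)
    fix i
    show "kconst (\<rho> i) * normal_ordered n pa da pb db d u (r + int i) (k - int i) = 0"
    proof (cases "i > 1")
      case False
      then have "normal_ordered n pa da pb db d u (r + int i) (k - int i) = 0"
        using rk by (intro normal_ordered_eq_0) auto
      then show ?thesis by simp
    qed (simp add: rho)
  qed
  finally show ?thesis .
qed

lemma icrexp_sum:
  assumes "r0 \<le> 0" "K - r1 \<le> 0"
  shows "(\<Sum>r = r0..r1. icrexp n pa r * icrexp n pb (K - r)) = icrexp n (\<lambda>r l. pa r l + pb r l) K"
proof (cases "K < 0")
  case True
  then have "icrexp n pa r * icrexp n pb (K - r) = 0" for r by (cases "r < 0") simp_all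
  then show ?thesis using True by simp
next
  case False
  have cr: "crexp (creation n (\<lambda>r l. pa r l + pb r l)) m = crexp (\<lambda>r. creation n pa r + creation n pb r) m" for m
    by (rule crexp_cong) (simp add: creation_def kconst_add distrib_right sum.distrib)
  have "(\<Sum>r = r0..r1. icrexp n pa r * icrexp n pb (K - r)) = (\<Sum>r = 0..K. icrexp n pa r * icrexp n pb (K - r))"
    by (rule sum.mono_neutral_right) (use assms in auto)
  also have "\<dots> = (\<Sum>a\<le>nat K. crexp (creation n pa) a * crexp (creation n pb) (nat K - a))"
    by (rule sum.reindex_bij_witness[of _ int nat]) (use False in \<open>auto simp: icrexp_def nat_diff_distrib le_nat_iff\<close>)
  finally show ?thesis using False by (simp add: icrexp_def cr crexp_sum)
qed

text \<open>Setting z_1 = z_2 = z merges the exponentials and adds their mode coefficients, so a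
  normal ordered product is again of the form \<open>vcoeff\<close>. The bounds \<open>r0\<close>
  and \<open>r1\<close> only have to enclose all nonzero terms.\<close>

lemma normal_ordered_diagonal:
  assumes d: "kdeg_le (int d) u" and R: "r0 \<le> - int d" "K + int d \<le> r1"
  shows "(\<Sum>r = r0..r1. normal_ordered n pa da pb db d u r (K - r)) =
    vcoeff n (\<lambda>r l. pa r l + pb r l) (\<lambda>r l. da r l + db r l) u K"
proof -
  define F where "F l' l = icrexp n (\<lambda>r l. pa r l + pb r l) (K + int (l' + l)) * aexp n da l' (aexp n db l u)" for l' l
  have F0: "F l' l = 0" if "l' + l > d" for l' l
    unfolding F_def using aexp_eq_0[OF kdeg_le_kexp_annihilation[OF d], of l l'] that by simp
  have "(\<Sum>r = r0..r1. normal_ordered n pa da pb db d u r (K - r)) = (\<Sum>l'\<le>d. \<Sum>l\<le>d. \<Sum>r = r0..r1.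
     icrexp n pa (r + int l') * icrexp n pb (K - r + int l) * aexp n da l' (aexp n db l u))"
    unfolding normal_ordered_def by (subst sum.swap, rule sum.cong[OF refl], rule sum.swap)
  also have "\<dots> = (\<Sum>l'\<le>d. \<Sum>l\<le>d. F l' l)"
  proof (intro sum.cong refl)
    fix l' l assume "l' \<in> {..d}" "l \<in> {..d}"
    have "(\<Sum>r = r0..r1. icrexp n pa (r + int l') * icrexp n pb (K - r + int l)) =
      (\<Sum>r = r0 + int l'..r1 + int l'. icrexp n pa r * icrexp n pb (K + int (l' + l) - r))"
      by (rule sum.reindex_bij_witness[of _ "\<lambda>r. r - int l'" "\<lambda>r. r + int l'"]) (auto simp: algebra_simps)
    also have "\<dots> = icrexp n (\<lambda>r l. pa r l + pb r l) (K + int (l' + l))"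
      by (rule icrexp_sum) (use R \<open>l' \<in> {..d}\<close> \<open>l \<in> {..d}\<close> in auto)
    finally show "(\<Sum>r = r0..r1. icrexp n pa (r + int l') * icrexp n pb (K - r + int l) *
        aexp n da l' (aexp n db l u)) = F l' l"
      by (simp add: F_def flip: sum_distrib_right)
  qed
  also have "\<dots> = (\<Sum>(l', l) \<in> {..d} \<times> {..d}. F l' l)" by (simp add: sum.cartesian_product)
  also have "\<dots> = (\<Sum>(l', l) \<in> {(l', l). l' + l \<le> d}. F l' l)"
  proof (rule sum.mono_neutral_right)
    have "l' + l \<le> d" if "F l' l \<noteq> 0" for l' l using F0[of l' l] that by (meson not_le)
    then show "\<forall>x \<in> {..d} \<times> {..d} - {(l', l). l' + l \<le> d}. (case x of (l', l) \<Rightarrow> F l' l) = 0"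
      by auto
  qed auto
  also have "\<dots> = (\<Sum>(L, l') \<in> Sigma {..d} (\<lambda>L. {..L}). F l' (L - l'))"
    by (rule sum.reindex_bij_witness[of _ "\<lambda>(L, l'). (l', L - l')" "\<lambda>(l', l). (l' + l, l')"]) auto
  also have "\<dots> = (\<Sum>L\<le>d. \<Sum>l'\<le>L. F l' (L - l'))" by (simp add: sum.Sigma)
  also have "\<dots> = vcoeff n (\<lambda>r l. pa r l + pb r l) (\<lambda>r l. da r l + db r l) u K"
    unfolding vcoeff_eq[OF d]
  proof (rule sum.cong[OF refl])
    fix L
    have "aexp n (\<lambda>r l. da r l + db r l) L u = kexp (\<lambda>r u. annihilation n da r u + annihilation n db r u) L u"
      by (rule kexp_cong) (simp add: annihilation_def kconst_add distrib_right sum.distrib)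
    also have "\<dots> = (\<Sum>l'\<le>L. aexp n da l' (aexp n db (L - l') u))"
      by (rule kexp_sum) (rule klinear_annihilation annihilation_commute)+
    finally show "(\<Sum>l'\<le>L. F l' (L - l')) = icrexp n (\<lambda>r l. pa r l + pb r l) (K + int L) *
       aexp n (\<lambda>r l. da r l + db r l) L u"
      by (simp add: F_def sum_distrib_left)
  qed
  finally show ?thesis .
qed

lemma icrexp_scale_power:
  assumes "c \<noteq> 0"
  shows "icrexp n (\<lambda>r l. c ^ r * pc r l) k = kconst (c powi k) * icrexp n pc k"
proof -
  have "crexp (creation n (\<lambda>r l. c ^ r * pc r l)) m = crexp (\<lambda>r. kconst (c ^ r) * creation n pc r) m" for m
    by (rule crexp_cong) (simp add: creation_def kconst_mult sum_distrib_left mult.assoc)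
  then show ?thesis
    by (simp add: icrexp_def crexp_scale_power power_int_def)
qed

text \<open>The substitution of c z for z: creation modes gain c^r and annihilation modes
  c^(-r).\<close>

lemma vcoeff_scale_power:
  assumes "c \<noteq> 0"
  shows "vcoeff n (\<lambda>r l. c ^ r * pc r l) (\<lambda>r l. inverse c ^ r * dc r l) u k =
    kconst (c powi k) * vcoeff n pc dc u k"
proof -
  have a: "aexp n (\<lambda>r l. inverse c ^ r * dc r l) m u = kconst (inverse c ^ m) * aexp n dc m u" for m
    unfolding kexp_scale_power[OF klinear_annihilation, symmetric]
    by (rule kexp_cong) (simp add: annihilation_def kconst_mult sum_distrib_left mult.assoc)
  have "c powi (k + int m) * inverse c ^ m = c powi k" for m
    using assms by (simp add: power_int_add power_inverse field_simps)
  then have "kconst (c powi (k + int m)) * (x * (kconst (inverse c ^ m) * y)) = kconst (c powi k) * (x * y)" for m x y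
    by (metis kconst_mult_left mult.left_commute)
  then show ?thesis
    by (simp add: vcoeff_def icrexp_scale_power[OF assms] a sum_distrib_left mult.assoc)
qed

section \<open>Vertex operators on the whole space\<close>

text \<open>The operator \<open>b(z)\<close> is the product of the exponentials in \<open>vcoeff\<close> and an operator mapping
  \<open>e\<^sup>\<beta>\<close> to \<open>\<chi>(\<beta>) z\<^sup>s e\<^bsup>\<gamma>+\<beta>\<^esup>\<close>, \<open>s = (\<gamma>, \<beta>)\<close>.\<close>

definition is_vop :: "nat \<Rightarrow> modes \<Rightarrow> modes \<Rightarrow> wt \<Rightarrow> (wt \<Rightarrow> qf) \<Rightarrow> vfield \<Rightarrow> bool" where
  "is_vop n pc dc \<gamma> \<chi> b \<longleftrightarrow> (\<forall>v \<in> Vspace n. \<forall>s \<beta>. lookup (b v s) (\<gamma> + \<beta>) =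
     (if s - wform n \<gamma> \<beta> \<in> \<int>
      then kconst (\<chi> \<beta>) * vcoeff n pc dc (lookup v \<beta>) \<lfloor>s - wform n \<gamma> \<beta>\<rfloor> else 0))"

section \<open>Components of vertex operators\<close>

lemma lookup_op_pow:
  assumes "\<And>r v \<beta>. r \<ge> 1 \<Longrightarrow> lookup (A r v) \<beta> = D r (lookup v \<beta>)"
  shows "lookup (op_pow A k m v) \<beta> = kpow D k m (lookup v \<beta>)"
  by (induction k arbitrary: m) (simp_all add: lookup_sum assms)

lemma lookup_op_exp:
  assumes "\<And>r v \<beta>. r \<ge> 1 \<Longrightarrow> lookup (A r v) \<beta> = D r (lookup v \<beta>)"
  shows "lookup (op_exp A m v) \<beta> = kexp D m (lookup v \<beta>)"
  by (simp add: op_exp_def kexp_def lookup_sum lookup_vscale lookup_op_pow[of A D, OF assms])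

lemma ex_kdeg_bound: "\<exists>d. \<forall>\<beta>. kdeg_le (int d) (lookup v \<beta>)"
proof (intro exI allI)
  fix \<beta>
  show "kdeg_le (int (\<Sum>\<beta> \<in> keys v. kdeg (lookup v \<beta>))) (lookup v \<beta>)"
  proof (cases "\<beta> \<in> keys v")
    case True
    then have "kdeg (lookup v \<beta>) \<le> (\<Sum>\<beta> \<in> keys v. kdeg (lookup v \<beta>))"
      by (intro member_le_sum) auto
    then show ?thesis by (intro kdeg_le_mono[OF kdeg_le_kdeg]) (simp only: of_nat_le_iff)
  qed (simp add: in_keys_iff)
qed

lemma lookup_nonzero_ex: "v \<noteq> 0 \<Longrightarrow> \<exists>\<beta>. lookup v (\<gamma> + \<beta>) \<noteq> (0::'b::zero)" for \<gamma> :: wt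
proof -
  assume "v \<noteq> 0"
  then obtain \<delta> where "lookup v \<delta> \<noteq> 0" by (metis poly_mapping_eqI lookup_zero)
  then show ?thesis by (intro exI[of _ "\<delta> - \<gamma>"]) simp
qed

text \<open>\<open>is_vop\<close> addresses an output component by the input \<beta>, hence
  comparison at \<gamma> + \<beta>.\<close>

lemma shifted_eqI: "(\<And>\<beta>. lookup v (\<gamma> + \<beta>) = lookup w (\<gamma> + \<beta>)) \<Longrightarrow> v = w" for \<gamma> :: wt
  by (rule poly_mapping_eqI) (metis add_diff_cancel_left' diff_add_cancel add.commute)

lemma vertex_op_is_vop:
  assumes A: "\<And>r v \<beta>. r \<ge> 1 \<Longrightarrow> lookup (A r v) \<beta> = creation n pc r * lookup v \<beta>"
    and B: "\<And>r v \<beta>. r \<ge> 1 \<Longrightarrow> lookup (B r v) \<beta> = annihilation n dc r (lookup v \<beta>)"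
    and L: "\<And>v t \<beta>. lookup (L v t) (\<gamma> + \<beta>) =
      (if wform n \<gamma> \<beta> = t then kconst (\<chi> \<beta>) * lookup v \<beta> else 0)"
  shows "is_vop n pc dc \<gamma> \<chi> (vertex_op A B L)"
  unfolding is_vop_def
proof (intro ballI allI)
  fix v :: vsp and s \<beta>
  obtain d where d: "\<And>\<beta>. kdeg_le (int d) (lookup v \<beta>)" using ex_kdeg_bound by blast
  define T where "T = (\<lambda>(m, l). op_exp A m (op_exp B l (L v (s - of_nat m + of_nat l))))"
  define K where "K = keys v"
  \<comment> \<open>A summand is nonzero only if \<open>m\<close> is the exponent forced by some
    \<beta> in the support of \<open>v\<close> and some \<open>l\<close> within the degree bound, so
    \<open>F\<close> contains the whole support.\<close>
  define F where "F = (\<lambda>(\<beta>, l). (nat \<lfloor>s + of_nat l - wform n \<gamma> \<beta>\<rfloor>, l)) ` (K \<times> {..d})"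
  have T: "lookup (T (m, l)) (\<gamma> + \<beta>) = (if wform n \<gamma> \<beta> = s - of_nat m + of_nat l
     then kconst (\<chi> \<beta>) * (crexp (creation n pc) m * aexp n dc l (lookup v \<beta>)) else 0)" for m l \<beta>
    by (simp add: T_def lookup_op_exp[of A, OF A] lookup_op_exp[of B, OF B] kexp_mult L
        klinear_scale[OF klinear_aexp] klinear_0[OF klinear_aexp] mult.left_commute)
  have finF: "finite F" by (simp add: F_def K_def)
  have supp: "{x. T x \<noteq> 0} \<subseteq> F"
  proof safe
    fix m l assume "T (m, l) \<noteq> 0"
    then obtain \<beta> where "lookup (T (m, l)) (\<gamma> + \<beta>) \<noteq> 0" using lookup_nonzero_ex by blast
    then have w: "wform n \<gamma> \<beta> = s - of_nat m + of_nat l" and a: "aexp n dc l (lookup v \<beta>) \<noteq> 0"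
      by (auto simp: T split: if_splits)
    have "l \<le> d" using a aexp_eq_0[OF d] by (metis not_le of_nat_less_iff)
    moreover have "\<beta> \<in> K" using a by (auto simp: K_def in_keys_iff klinear_0[OF klinear_aexp])
    moreover have "m = nat \<lfloor>s + of_nat l - wform n \<gamma> \<beta>\<rfloor>" using w by simp
    ultimately show "(m, l) \<in> F" unfolding F_def by (intro image_eqI[of _ _ "(\<beta>, l)"]) auto
  qed
  have "vertex_op A B L v s = sum T F"
    unfolding vertex_op_def T_def[symmetric] by (rule Sum_any.expand_superset[OF finF supp])
  then have eq: "lookup (vertex_op A B L v s) (\<gamma> + \<beta>) = (\<Sum>x\<in>F. lookup (T x) (\<gamma> + \<beta>))"
    by (simp add: lookup_sum)
  show "lookup (vertex_op A B L v s) (\<gamma> + \<beta>) = (if s - wform n \<gamma> \<beta> \<in> \<int>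
      then kconst (\<chi> \<beta>) * vcoeff n pc dc (lookup v \<beta>) \<lfloor>s - wform n \<gamma> \<beta>\<rfloor> else 0)"
  proof (cases "s - wform n \<gamma> \<beta> \<in> \<int>")
    case False
    have "lookup (T x) (\<gamma> + \<beta>) = 0" for x
    proof (cases x)
      case (Pair m l)
      have "wform n \<gamma> \<beta> \<noteq> s - of_nat m + of_nat l"
      proof
        assume "wform n \<gamma> \<beta> = s - of_nat m + of_nat l"
        then have "s - wform n \<gamma> \<beta> = of_int (int m - int l)" by simp
        then show False using False by (metis Ints_of_int)
      qed
      then show ?thesis by (simp add: Pair T)
    qed
    then show ?thesis using False eq by simp
  next
    case True
    then obtain k where k: "s - wform n \<gamma> \<beta> = of_int k" by (auto elim: Ints_cases)
    have iff: "wform n \<gamma> \<beta> = s - of_nat m + of_nat l \<longleftrightarrow> int m = k + int l" for m l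
    proof -
      have "wform n \<gamma> \<beta> = s - of_nat m + of_nat l \<longleftrightarrow> (of_int (int m) :: rat) = of_int (k + int l)"
        using k by (auto simp: algebra_simps)
      then show ?thesis by (simp only: of_int_eq_iff)
    qed
    let ?u = "lookup v \<beta>"
    define S where "S = {l \<in> {..d}. k + int l \<ge> 0}"
    \<comment> \<open>The pairs belonging to the given \<beta> need not lie in \<open>F\<close>,
      since \<beta> may be outside the support of \<open>v\<close>. They are adjoined first; then
      all other pairs are dropped.\<close>
    have "(\<Sum>x\<in>F. lookup (T x) (\<gamma> + \<beta>)) =
      (\<Sum>x\<in>F \<union> (\<lambda>l. (nat (k + int l), l)) ` S. lookup (T x) (\<gamma> + \<beta>))"
    proof (rule sum.mono_neutral_left)
      show "\<forall>x\<in>F \<union> (\<lambda>l. (nat (k + int l), l)) ` S - F. lookup (T x) (\<gamma> + \<beta>) = 0"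
        using supp by (metis (mono_tags, lifting) DiffD2 lookup_zero mem_Collect_eq subsetD)
    qed (use finF in \<open>auto simp: S_def\<close>)
    also have "\<dots> = (\<Sum>x\<in>(\<lambda>l. (nat (k + int l), l)) ` S. lookup (T x) (\<gamma> + \<beta>))"
    proof (rule sum.mono_neutral_right)
      show "\<forall>x\<in>F \<union> (\<lambda>l. (nat (k + int l), l)) ` S - (\<lambda>l. (nat (k + int l), l)) ` S. lookup (T x) (\<gamma> + \<beta>) = 0"
      proof
        fix x assume x: "x \<in> F \<union> (\<lambda>l. (nat (k + int l), l)) ` S - (\<lambda>l. (nat (k + int l), l)) ` S"
        obtain m l where ml: "x = (m, l)" by (cases x)
        have "(m, l) \<in> F" using x ml by auto
        then have "l \<le> d" by (auto simp: F_def)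
        then have "int m \<noteq> k + int l" using x ml by (auto simp: S_def image_iff)
        then show "lookup (T x) (\<gamma> + \<beta>) = 0" by (simp add: ml T iff)
      qed
    qed (use finF in \<open>auto simp: S_def\<close>)
    also have "\<dots> = (\<Sum>l\<in>S. kconst (\<chi> \<beta>) * (icrexp n pc (k + int l) * aexp n dc l ?u))"
    proof (subst sum.reindex)
      have "lookup (T (nat (k + int l), l)) (\<gamma> + \<beta>) =
          kconst (\<chi> \<beta>) * (icrexp n pc (k + int l) * aexp n dc l ?u)" if "l \<in> S" for l
        using that unfolding T iff by (simp add: S_def icrexp_def)
      then show "sum ((\<lambda>x. lookup (T x) (\<gamma> + \<beta>)) \<circ> (\<lambda>l. (nat (k + int l), l))) S =
          (\<Sum>l\<in>S. kconst (\<chi> \<beta>) * (icrexp n pc (k + int l) * aexp n dc l ?u))"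
        by simp
    qed (auto simp: inj_on_def)
    also have "\<dots> = (\<Sum>l\<le>d. kconst (\<chi> \<beta>) * (icrexp n pc (k + int l) * aexp n dc l ?u))"
    proof (rule sum.mono_neutral_left)
      have "icrexp n pc (k + int l) = 0" if "l \<in> {..d} - S" for l
      proof -
        have "k + int l < 0" using that by (auto simp: S_def)
        then show ?thesis by simp
      qed
      then show "\<forall>l\<in>{..d} - S. kconst (\<chi> \<beta>) * (icrexp n pc (k + int l) * aexp n dc l ?u) = 0" by simp
    qed (auto simp: S_def)
    also have "\<dots> = kconst (\<chi> \<beta>) * vcoeff n pc dc ?u k"
      by (simp add: vcoeff_eq[OF d] sum_distrib_left)
    finally show ?thesis using True k eq by simp
  qed
qed

lemma is_vopD:
  "is_vop n pc dc \<gamma> \<chi> b \<Longrightarrow> v \<in> Vspace n \<Longrightarrow> lookup (b v s) (\<gamma> + \<beta>) =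
     (if s - wform n \<gamma> \<beta> \<in> \<int>
      then kconst (\<chi> \<beta>) * vcoeff n pc dc (lookup v \<beta>) \<lfloor>s - wform n \<gamma> \<beta>\<rfloor> else 0)"
  by (simp add: is_vop_def)

section \<open>Mapping properties and shifts\<close>

lemma weight_lattice_add: "\<alpha> \<in> weight_lattice n \<Longrightarrow> \<beta> \<in> weight_lattice n \<Longrightarrow> \<alpha> + \<beta> \<in> weight_lattice n"
  using keys_add[of \<alpha> \<beta>] by (auto simp: weight_lattice_def)

lemma Vspace_lattice: "v \<in> Vspace n \<Longrightarrow> lookup v \<beta> \<noteq> 0 \<Longrightarrow> \<beta> \<in> weight_lattice n"
  by (auto simp: Vspace_def in_keys_iff)

lemma Vspace_Kspace: "v \<in> Vspace n \<Longrightarrow> lookup v \<beta> \<in> Kspace n"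
  by (simp add: Vspace_def)

lemma VspaceI:
  assumes "\<And>\<beta>. lookup v \<beta> \<in> Kspace n" "\<And>\<beta>. lookup v \<beta> \<noteq> 0 \<Longrightarrow> \<beta> \<in> weight_lattice n"
  shows "v \<in> Vspace n"
  using assms by (auto simp: Vspace_def in_keys_iff)

lemma Vspace_add: "v \<in> Vspace n \<Longrightarrow> w \<in> Vspace n \<Longrightarrow> v + w \<in> Vspace n"
  by (rule VspaceI) (auto simp: lookup_add Vspace_Kspace intro!: Kspace_add dest: Vspace_lattice, metis Vspace_lattice add_0)

lemma Vspace_vscale: "v \<in> Vspace n \<Longrightarrow> vscale c v \<in> Vspace n"
  by (rule VspaceI) (auto simp: lookup_vscale Vspace_Kspace intro!: Kspace_mult Kspace_kconst, metis Vspace_lattice mult_zero_right)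

lemma vac_Vspace: "vac \<in> Vspace n"
  using Kspace_kconst[of 1 n]
  by (intro VspaceI) (auto simp: vac_def lookup_single when_def weight_lattice_def simp del: single_one split: if_splits)

lemma shifted_VspaceI:
  assumes "\<gamma> \<in> weight_lattice n" "\<And>\<beta>. lookup w (\<gamma> + \<beta>) \<in> Kspace n"
    and "\<And>\<beta>. lookup w (\<gamma> + \<beta>) \<noteq> 0 \<Longrightarrow> \<beta> \<in> weight_lattice n"
  shows "w \<in> Vspace n"
proof (rule VspaceI)
  fix \<delta>
  have \<delta>: "\<delta> = \<gamma> + (\<delta> - \<gamma>)" by simp
  show "lookup w \<delta> \<in> Kspace n" by (subst \<delta>) (rule assms)
  show "\<delta> \<in> weight_lattice n" if "lookup w \<delta> \<noteq> 0"
    by (subst \<delta>) (rule weight_lattice_add, rule assms(1), rule assms(3), use that in simp)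
qed

lemma is_vop_Hom_laurent:
  assumes b: "is_vop n pc dc \<gamma> \<chi> b" and \<gamma>: "\<gamma> \<in> weight_lattice n"
    and N: "\<And>\<beta>. \<beta> \<in> weight_lattice n \<Longrightarrow> of_nat N * wform n \<gamma> \<beta> \<in> \<int>"
  shows "b \<in> Hom_laurent n N"
  unfolding Hom_laurent_def
proof (intro CollectI conjI ballI allI)
  fix v w s assume v: "v \<in> Vspace n" and w: "w \<in> Vspace n"
  show "b (v + w) s = b v s + b w s"
    by (rule shifted_eqI[of _ \<gamma>])
       (simp add: is_vopD[OF b] v w Vspace_add lookup_add vcoeff_add distrib_left)
next
  fix c v s assume v: "v \<in> Vspace n"
  show "b (vscale c v) s = vscale c (b v s)"
    by (rule shifted_eqI[of _ \<gamma>])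
       (simp add: is_vopD[OF b] v Vspace_vscale lookup_vscale vcoeff_scale mult.left_commute)
next
  fix v assume v: "v \<in> Vspace n"
  have nz: "\<beta> \<in> keys v \<and> \<beta> \<in> weight_lattice n \<and> s - wform n \<gamma> \<beta> \<in> \<int> \<and>
      vcoeff n pc dc (lookup v \<beta>) \<lfloor>s - wform n \<gamma> \<beta>\<rfloor> \<noteq> 0"
    if "lookup (b v s) (\<gamma> + \<beta>) \<noteq> 0" for s \<beta>
  proof -
    have "s - wform n \<gamma> \<beta> \<in> \<int>" "vcoeff n pc dc (lookup v \<beta>) \<lfloor>s - wform n \<gamma> \<beta>\<rfloor> \<noteq> 0"
      using that by (auto simp: is_vopD[OF b v] split: if_splits)
    moreover from this have "lookup v \<beta> \<noteq> 0" by auto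
    ultimately show ?thesis using Vspace_lattice[OF v] by (simp add: in_keys_iff)
  qed
  obtain d where d: "\<And>\<beta>. kdeg_le (int d) (lookup v \<beta>)" using ex_kdeg_bound by blast
  show "laurent N (Vspace n) (b v)"
    unfolding laurent_def
  proof (intro conjI allI impI)
    fix s
    show "b v s \<in> Vspace n"
    proof (rule shifted_VspaceI[OF \<gamma>])
      fix \<beta>
      show "lookup (b v s) (\<gamma> + \<beta>) \<in> Kspace n"
        by (auto simp: is_vopD[OF b v] intro!: Kspace_mult Kspace_kconst Kspace_vcoeff Vspace_Kspace v)
    qed (use nz in blast)
    show "of_nat N * s \<in> \<int>" if "b v s \<noteq> 0"
    proof -
      from that obtain \<beta> where "lookup (b v s) (\<gamma> + \<beta>) \<noteq> 0" using lookup_nonzero_ex by blast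
      then have "s - wform n \<gamma> \<beta> \<in> \<int>" "\<beta> \<in> weight_lattice n" using nz by blast+
      then have "of_nat N * (s - wform n \<gamma> \<beta>) + of_nat N * wform n \<gamma> \<beta> \<in> \<int>"
        using Ints_add[OF Ints_mult[OF Ints_of_nat] N] by blast
      then show ?thesis by (simp add: algebra_simps)
    qed
  next
    show "\<exists>B. \<forall>s. b v s \<noteq> 0 \<longrightarrow> B \<le> s"
    proof (intro exI allI impI)
      fix s assume "b v s \<noteq> 0"
      then obtain \<beta> where "lookup (b v s) (\<gamma> + \<beta>) \<noteq> 0" using lookup_nonzero_ex by blast
      then have \<beta>: "\<beta> \<in> keys v" and s: "s - wform n \<gamma> \<beta> \<in> \<int>"
        and "vcoeff n pc dc (lookup v \<beta>) \<lfloor>s - wform n \<gamma> \<beta>\<rfloor> \<noteq> 0" using nz by blast+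
      then have "\<lfloor>s - wform n \<gamma> \<beta>\<rfloor> \<ge> - int d" using vcoeff_eq_0[OF d] by (metis not_le)
      then have "s - wform n \<gamma> \<beta> \<ge> - of_nat d" by (simp add: le_floor_iff)
      moreover have "\<bar>wform n \<gamma> \<beta>\<bar> \<le> (\<Sum>\<beta> \<in> keys v. \<bar>wform n \<gamma> \<beta>\<bar>)"
        using \<beta> by (intro member_le_sum) auto
      ultimately show "- (\<Sum>\<beta> \<in> keys v. \<bar>wform n \<gamma> \<beta>\<bar>) - of_nat d \<le> s" by linarith
    qed
  qed
qed

text \<open>At \<gamma> + \<beta> the exponent is (\<gamma>, \<beta>) + k. The shift contributes
  c^(\<gamma>, \<beta>), absorbed into \<chi>, and c^k, absorbed into the modes. Integrality matters
  because \<open>qshift\<close> rounds the exponent down.\<close>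

lemma is_vop_qshift:
  assumes a: "is_vop n pc dc \<gamma> \<chi> a" and int: "\<And>\<beta>. \<beta> \<in> weight_lattice n \<Longrightarrow> wform n \<gamma> \<beta> \<in> \<int>"
    and c: "c = qh powi u"
  shows "is_vop n (\<lambda>r l. c ^ r * pc r l) (\<lambda>r l. inverse c ^ r * dc r l) \<gamma>
    (\<lambda>\<beta>. \<chi> \<beta> * c powi \<lfloor>wform n \<gamma> \<beta>\<rfloor>) (qshift u a)"
  unfolding is_vop_def
proof (intro ballI allI)
  fix v s \<beta> assume v: "v \<in> Vspace n"
  have c0: "c \<noteq> 0" by (simp add: c)
  show "lookup (qshift u a v s) (\<gamma> + \<beta>) = (if s - wform n \<gamma> \<beta> \<in> \<int>
      then kconst (\<chi> \<beta> * c powi \<lfloor>wform n \<gamma> \<beta>\<rfloor>) * vcoeff n (\<lambda>r l. c ^ r * pc r l) (\<lambda>r l. inverse c ^ r * dc r l)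
        (lookup v \<beta>) \<lfloor>s - wform n \<gamma> \<beta>\<rfloor> else 0)"
  proof (cases "lookup v \<beta> = 0 \<or> s - wform n \<gamma> \<beta> \<notin> \<int>")
    case True
    then show ?thesis by (auto simp: qshift_def lookup_vscale is_vopD[OF a v])
  next
    case False
    then have "wform n \<gamma> \<beta> \<in> \<int>" using int Vspace_lattice[OF v] by blast
    then obtain e where e: "wform n \<gamma> \<beta> = of_int e" by (auto elim: Ints_cases)
    obtain k where k: "s - wform n \<gamma> \<beta> = of_int k" using False by (auto elim: Ints_cases)
    then have "s = of_int (e + k)" using e by (simp add: algebra_simps)
    then have "\<lfloor>s\<rfloor> = e + k" by simp
    then have "qh powi (u * \<lfloor>s\<rfloor>) = c powi e * c powi k"
      by (simp add: c distrib_left power_int_add power_int_mult)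
    then have q: "kconst (qh powi (u * \<lfloor>s\<rfloor>)) = kconst (c powi e) * kconst (c powi k)"
      by (simp add: kconst_mult)
    have se: "s - of_int e = of_int k" using e k by simp
    then have "lookup (a v s) (\<gamma> + \<beta>) = kconst (\<chi> \<beta>) * vcoeff n pc dc (lookup v \<beta>) k"
      using e by (simp add: is_vopD[OF a v])
    then show ?thesis using e se
      by (simp add: qshift_def lookup_vscale vcoeff_scale_power[OF c0] q kconst_mult mult.assoc mult.left_commute)
  qed
qed

lemma wform_denominator: "of_nat (Suc n) * wform n \<alpha> \<beta> \<in> \<int>"
proof -
  have "of_nat (Suc n) * wform n \<alpha> \<beta> = (\<Sum>i = 1..n. \<Sum>j = 1..n.
     of_int (lookup \<alpha> i) * of_int (lookup \<beta> j) *
     (of_nat (min i j) * (of_nat (Suc n) - of_nat (max i j))))"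
    unfolding wform_def sum_distrib_left by (intro sum.cong refl) (simp del: of_nat_Suc)
  also have "\<dots> \<in> \<int>" by (intro Ints_sum Ints_mult Ints_diff Ints_of_int Ints_of_nat)
  finally show ?thesis .
qed


section \<open>Products of vertex operators and their residues\<close>

lemma lookup_pmult2:
  "lookup (lookup (pmult2 p c r s) \<delta>) M =
    (\<Sum>i \<le> degree p. \<Sum>j \<le> degree (coeff p i). coeff (coeff p i) j *
       lookup (lookup (c (r - of_nat i) (s - of_nat j)) \<delta>) M)"
  by (simp add: pmult2_def lookup_sum lookup_vscale lookup_kconst_mult)

lemma vscale_0_left [simp]: "vscale 0 v = 0" and vscale_1 [simp]: "vscale 1 v = v"
  by (rule poly_mapping_eqI, simp add: lookup_vscale)+

lemma pmult2_1: "pmult2 1 c r s = c r s"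
  by (intro poly_mapping_eqI) (simp add: lookup_pmult2)

lemma lookup_pmult2_linear:
  assumes "\<kappa> \<noteq> 0"
  shows "lookup (pmult2 [:[:0, - \<kappa>:], 1:] c r s) \<delta> =
    lookup (c (r - 1) s) \<delta> - kconst \<kappa> * lookup (c r (s - 1)) \<delta>"
proof -
  have d: "degree [:[:0, - \<kappa>:], 1:] = Suc 0" "degree [:0, - \<kappa>:] = Suc 0" using assms by simp_all
  show ?thesis
    by (intro poly_mapping_eqI) (simp add: lookup_pmult2 d lookup_minus lookup_kconst_mult)
qed

text \<open>For a quasi compatible pair, the product may be computed with any polynomial that removes
  the pole, not only with the one selected in the definition.\<close>

lemma lookup_nth_product:
  fixes s :: rat
  assumes q: "quasi_compatible_by n p0 a b" and v: "v \<in> Vspace n"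
  defines "cc \<equiv> \<lambda>\<delta> M r j. lookup (lookup (comp2 a b v (of_int r) (s + of_int j)) \<delta>) M"
  shows "\<exists>B. bounded2_by B (series_mult p0 (cc \<delta> M)) \<and>
    lookup (lookup (nth_product n a k b v s) \<delta>) M =
      fls_nth (fls_nth (inverse (subst_poly p0) * subst_series (series_mult p0 (cc \<delta> M))) (- k - 1)) 0"
proof -
  \<comment> \<open>The coefficients \<open>cc\<close> of the bare product may be unbounded, so they
    are never substituted themselves, only after multiplication by a suitable polynomial. Exponents
    of z_2 are counted from \<open>s\<close> to make them integers.\<close>
  have coords: "\<exists>B. \<forall>\<delta> M. bounded2_by B (series_mult p (cc \<delta> M)) \<and>
      (\<forall>r s'. pmult2 p (comp2 a b v) r s' \<noteq> 0 \<longrightarrow> of_int B \<le> r \<and> of_int B \<le> s' - s)"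
    if qp: "quasi_compatible_by n p a b" for p
  proof -
    obtain B0 where B0: "\<forall>r s. pmult2 p (comp2 a b v) r s \<noteq> 0 \<longrightarrow> B0 \<le> r \<and> B0 \<le> s"
      using qp v unfolding quasi_compatible_by_def laurent2_def by blast
    define B where "B = min \<lfloor>B0\<rfloor> \<lfloor>B0 - s\<rfloor>"
    have B: "of_int B \<le> B0" "of_int B \<le> B0 - s"
      using of_int_floor_le[of B0] of_int_floor_le[of "B0 - s"] by (simp_all add: B_def min_def, linarith+)
    have c: "lookup (lookup (pmult2 p (comp2 a b v) (of_int r) (s + of_int j)) \<delta>) M =
        series_mult p (cc \<delta> M) r j" for \<delta> M r j
      by (simp add: lookup_pmult2 series_mult_def cc_def algebra_simps)
    have nz: "of_int B \<le> r \<and> of_int B \<le> s' - s" if "pmult2 p (comp2 a b v) r s' \<noteq> 0" for r s'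
      using B0 that B by force
    have "bounded2_by B (series_mult p (cc \<delta> M))" for \<delta> M
      unfolding bounded2_by_def
    proof (intro allI impI)
      fix r j assume "series_mult p (cc \<delta> M) r j \<noteq> 0"
      then have "pmult2 p (comp2 a b v) (of_int r) (s + of_int j) \<noteq> 0" by (auto simp flip: c)
      then show "B \<le> r \<and> B \<le> j" using nz by fastforce
    qed
    then show ?thesis using nz by blast
  qed
  define p where "p = (SOME p. quasi_compatible_by n p a b)"
  have p: "quasi_compatible_by n p a b" unfolding p_def using q by (rule someI)
  obtain B where B: "\<And>\<delta> M. bounded2_by B (series_mult p (cc \<delta> M))"
    "\<And>r s'. pmult2 p (comp2 a b v) r s' \<noteq> 0 \<Longrightarrow> of_int B \<le> r \<and> of_int B \<le> s' - s"
    using coords[OF p] by blast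
  obtain B' where B': "bounded2_by B' (series_mult p0 (cc \<delta> M))" using coords[OF q] by blast
  define c where "c = pmult2 p (comp2 a b v)"
  define cp where "cp = series_mult p (cc \<delta> M)"
  define I where "I = inverse (subst_poly p)"
  have c_cp: "lookup (lookup (c (of_int r) (s + of_int j)) \<delta>) M = cp r j" for r j
    by (simp add: lookup_pmult2 series_mult_def cc_def c_def cp_def algebra_simps)
  have e: "s - of_int l + of_nat m - of_int r = s + of_int (- l + int m - r)" for l m r by simp
  have ss_supp: "{r. vscale (qconst (of_int r gchoose m)) (c (of_int r) (s - of_int l + of_nat m - of_int r)) \<noteq> 0} \<subseteq>
      {B..- l + int m - B}" for m l
  proof
    fix r assume "r \<in> {r. vscale (qconst (of_int r gchoose m)) (c (of_int r) (s - of_int l + of_nat m - of_int r)) \<noteq> 0}"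
    then have "c (of_int r) (s + of_int (- l + int m - r)) \<noteq> 0" by (auto simp: e)
    then have "(of_int B :: rat) \<le> of_int r \<and> (of_int B :: rat) \<le> of_int (- l + int m - r)"
      using B(2)[of "of_int r" "s + of_int (- l + int m - r)"] by (simp add: c_def)
    then show "r \<in> {B..- l + int m - B}" by (simp only: of_int_le_iff) auto
  qed
  have ss: "subst_sum c m (s - of_int l) =
      (\<Sum>r = B..- l + int m - B. vscale (qconst (of_int r gchoose m)) (c (of_int r) (s - of_int l + of_nat m - of_int r)))" for m l
    unfolding subst_sum_def by (rule Sum_any.expand_superset[OF _ ss_supp]) simp
  have ss_lookup: "lookup (lookup (subst_sum c m (s - of_int l)) \<delta>) M = subst_coeff cp m (- l)" for m l
    unfolding ss subst_coeff_eq_sum[OF B(1)[of \<delta> M, folded cp_def]] e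
    by (simp only: lookup_sum lookup_vscale lookup_kconst_mult c_cp binq_def)
  have ss_0: "subst_sum c m (s - of_int l) = 0" if "- l < 2 * B - int m" for m l
    using that by (simp add: ss)
  define H where "H = (\<lambda>(m::nat, l::int). vscale (fls_nth (fls_nth I (- k - 1 - int m)) l) (subst_sum c m (s - of_int l)))"
  \<comment> \<open>The pole of \<open>I\<close> bounds \<open>m\<close>; the pole of its
    coefficient bounds \<open>l\<close> from below and \<open>ss_0\<close> bounds it from
    above.\<close>
  define m1 where "m1 = nat (- k - 1 - fls_subdegree I)"
  define ll where "ll m = fls_subdegree (fls_nth I (- k - 1 - int m))" for m
  define F where "F = Sigma {..m1} (\<lambda>m. {ll m..int m - 2 * B})"
  have "{x. H x \<noteq> 0} \<subseteq> F"
  proof safe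
    fix m l assume H: "H (m, l) \<noteq> 0"
    have "fls_nth I (- k - 1 - int m) \<noteq> 0" "fls_nth (fls_nth I (- k - 1 - int m)) l \<noteq> 0"
      "subst_sum c m (s - of_int l) \<noteq> 0"
      using H by (auto simp: H_def)
    then have "\<not> - k - 1 - int m < fls_subdegree I" "\<not> l < ll m" "\<not> - l < 2 * B - int m"
      using ss_0 fls_eq0_below_subdegree unfolding ll_def by blast+
    then show "(m, l) \<in> F" by (auto simp: F_def m1_def)
  qed
  moreover have "finite F" by (simp add: F_def)
  ultimately have np: "nth_product n a k b v s = sum H F"
    unfolding nth_product_def Let_def p_def[symmetric] c_def[symmetric] I_def[symmetric, folded iota_inverse_eq] H_def[symmetric]
    by (intro Sum_any.expand_superset)
  have "lookup (lookup (nth_product n a k b v s) \<delta>) M =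
     (\<Sum>m\<le>m1. \<Sum>l = ll m..int m - 2 * B. fls_nth (fls_nth I (- k - 1 - int m)) l * subst_coeff cp m (- l))"
    unfolding np by (simp add: lookup_sum H_def F_def case_prod_unfold lookup_vscale lookup_kconst_mult ss_lookup sum.Sigma)
  also have "\<dots> = (\<Sum>m\<le>m1. fls_nth (fls_nth I (- k - 1 - int m) * fls_nth (subst_series cp) (int m)) 0)"
  proof (rule sum.cong[OF refl])
    fix m
    note sn = subst_series_nth[OF B(1)[of \<delta> M], folded cp_def]
    have "fls_nth (fls_nth I (- k - 1 - int m) * fls_nth (subst_series cp) (int m)) 0 =
      (\<Sum>j = 2 * B - int m..0 - ll m. fls_nth (fls_nth I (- k - 1 - int m)) (0 - j) * fls_nth (fls_nth (subst_series cp) (int m)) j)"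
      by (rule fls_times_nth_sum) (auto simp: ll_def sn subst_coeff_eq_sum[OF B(1)[of \<delta> M, folded cp_def]])
    also have "\<dots> = (\<Sum>l = ll m..int m - 2 * B. fls_nth (fls_nth I (- k - 1 - int m)) l * subst_coeff cp m (- l))"
      by (rule sum.reindex_bij_witness[of _ uminus uminus]) (auto simp: sn)
    finally show "(\<Sum>l = ll m..int m - 2 * B. fls_nth (fls_nth I (- k - 1 - int m)) l * subst_coeff cp m (- l)) =
      fls_nth (fls_nth I (- k - 1 - int m) * fls_nth (subst_series cp) (int m)) 0" by simp
  qed
  also have "\<dots> = (\<Sum>m = 0..- k - 1 - fls_subdegree I. fls_nth (fls_nth I (- k - 1 - m) * fls_nth (subst_series cp) m) 0)"
  proof (cases "- k - 1 - fls_subdegree I < 0")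
    \<comment> \<open>The integer range is empty, while \<open>m1 = 0\<close> keeps one term; it
      vanishes because its index lies below the subdegree of \<open>I\<close>.\<close>
    case True
    then have "fls_nth I (- k - 1) = 0" "m1 = 0" by (simp_all add: m1_def)
    then show ?thesis using True by simp
  next
    case False
    then show ?thesis
      by (intro sum.reindex_bij_witness[of _ nat int]) (auto simp: m1_def le_nat_iff)
  qed
  also have "\<dots> = fls_nth (fls_nth (I * subst_series cp) (- k - 1)) 0"
  proof -
    have "fls_nth (I * subst_series cp) (- k - 1) =
      (\<Sum>m = 0..- k - 1 - fls_subdegree I. fls_nth I (- k - 1 - m) * fls_nth (subst_series cp) m)"
    proof (rule fls_times_nth_sum)
      show "fls_nth (subst_series cp) m = 0" if "m < 0" for m
        by (intro fls_eqI) (simp add: that subst_series_nth[OF B(1)[of \<delta> M], folded cp_def])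
    qed simp
    then show ?thesis by (simp add: fls_nth_sum)
  qed
  also have "I * subst_series cp = inverse (subst_poly p0) * subst_series (series_mult p0 (cc \<delta> M))"
  proof -
    have "p \<noteq> 0" "p0 \<noteq> 0" using p q by (simp_all add: quasi_compatible_by_def)
    then have nz: "subst_poly p \<noteq> 0" "subst_poly p0 \<noteq> 0" by (simp_all add: subst_poly_nonzero)
    \<comment> \<open>Independence of the polynomial: apply both \<open>p\<close> and
      \<open>p0\<close> to the product, in either order, and divide by the two nonzero substituted
      polynomials.\<close>
    have "subst_poly p0 * subst_series cp = subst_series (series_mult p0 cp)"
      by (rule subst_series_mult[OF B(1)[of \<delta> M, folded cp_def], symmetric])
    also have "\<dots> = subst_series (series_mult p (series_mult p0 (cc \<delta> M)))"
      by (simp only: cp_def series_mult_commute)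
    also have "\<dots> = subst_poly p * subst_series (series_mult p0 (cc \<delta> M))"
      by (rule subst_series_mult[OF B'])
    finally show ?thesis using nz by (simp add: I_def field_simps)
  qed
  finally show ?thesis using B' by blast
qed

lemma normal_ordered_0 [simp]: "normal_ordered n pa da pb db d 0 r k = 0"
  by (simp add: normal_ordered_def klinear_0[OF klinear_aexp])

lemma Kspace_normal_ordered: "u \<in> Kspace n \<Longrightarrow> normal_ordered n pa da pb db d u r k \<in> Kspace n"
  unfolding normal_ordered_def
  by (intro Kspace_sum Kspace_mult Kspace_icrexp Kspace_kexp_annihilation)

text \<open>\<open>e1\<close> and \<open>e2\<close> are the exponents of the lattice part. Finite
  support of \<open>v\<close> makes them and the degrees uniformly bounded.\<close>

lemma laurent2I:
  assumes v: "v \<in> Vspace n" and \<gamma>: "\<gamma> \<in> weight_lattice n"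
    and c: "\<And>r s \<beta>. lookup (c r s) (\<gamma> + \<beta>) =
      (if r - e1 \<beta> \<in> \<int> \<and> s - e2 \<beta> \<in> \<int> then kconst (X \<beta>) * Q (lookup v \<beta>) \<lfloor>r - e1 \<beta>\<rfloor> \<lfloor>s - e2 \<beta>\<rfloor> else 0)"
    and e1: "\<And>\<beta>. \<beta> \<in> weight_lattice n \<Longrightarrow> e1 \<beta> \<in> \<int>"
    and e2: "\<And>\<beta>. of_nat (Suc n) * e2 \<beta> \<in> \<int>"
    and Q0: "\<And>r k. Q 0 r k = 0" and QK: "\<And>u r k. u \<in> Kspace n \<Longrightarrow> Q u r k \<in> Kspace n"
    and Qb: "\<And>u r k. r < - int (kdeg u) - 1 \<or> k < - int (kdeg u) - 1 \<Longrightarrow> Q u r k = 0"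
  shows "laurent2 n c"
proof -
  have nz: "\<beta> \<in> keys v \<and> \<beta> \<in> weight_lattice n \<and> r - e1 \<beta> \<in> \<int> \<and> s - e2 \<beta> \<in> \<int> \<and>
      Q (lookup v \<beta>) \<lfloor>r - e1 \<beta>\<rfloor> \<lfloor>s - e2 \<beta>\<rfloor> \<noteq> 0"
    if "lookup (c r s) (\<gamma> + \<beta>) \<noteq> 0" for r s \<beta>
  proof -
    have *: "r - e1 \<beta> \<in> \<int>" "s - e2 \<beta> \<in> \<int>" "Q (lookup v \<beta>) \<lfloor>r - e1 \<beta>\<rfloor> \<lfloor>s - e2 \<beta>\<rfloor> \<noteq> 0"
      using that by (auto simp: c split: if_splits)
    then have "lookup v \<beta> \<noteq> 0" using Q0 by metis
    then show ?thesis using * Vspace_lattice[OF v] by (simp add: in_keys_iff)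
  qed
  obtain d where d: "\<And>\<beta>. kdeg_le (int d) (lookup v \<beta>)" using ex_kdeg_bound by blast
  define S where "S e = (\<Sum>\<beta> \<in> keys v. \<bar>e \<beta> :: rat\<bar>)" for e
  have S: "\<bar>e \<beta>\<bar> \<le> S e" if "\<beta> \<in> keys v" for e \<beta>
    unfolding S_def using that by (intro member_le_sum) auto
  have S0: "S e \<ge> 0" for e unfolding S_def by (intro sum_nonneg) auto
  show ?thesis
    unfolding laurent2_def
  proof (intro conjI allI)
    fix r s
    show "c r s \<in> Vspace n"
    proof (rule shifted_VspaceI[OF \<gamma>])
      fix \<beta>
      show "lookup (c r s) (\<gamma> + \<beta>) \<in> Kspace n"
        by (auto simp: c intro!: Kspace_mult Kspace_kconst QK Vspace_Kspace v)
    qed (use nz in blast)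
    show "c r s \<noteq> 0 \<longrightarrow> r \<in> \<int> \<and> of_nat (n + 1) * s \<in> \<int>"
    proof
      assume "c r s \<noteq> 0"
      then obtain \<beta> where "lookup (c r s) (\<gamma> + \<beta>) \<noteq> 0" using lookup_nonzero_ex by blast
      then have \<beta>: "\<beta> \<in> weight_lattice n" "r - e1 \<beta> \<in> \<int>" "s - e2 \<beta> \<in> \<int>" using nz by blast+
      have "(r - e1 \<beta>) + e1 \<beta> \<in> \<int>" using \<beta> e1 by (intro Ints_add) auto
      moreover have "of_nat (Suc n) * (s - e2 \<beta>) + of_nat (Suc n) * e2 \<beta> \<in> \<int>"
        by (rule Ints_add[OF Ints_mult[OF Ints_of_nat \<beta>(3)] e2])
      moreover have "of_nat (Suc n) * (s - e2 \<beta>) + of_nat (Suc n) * e2 \<beta> = of_nat (n + 1) * s"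
        by (simp only: right_diff_distrib Suc_eq_plus1)
      ultimately show "r \<in> \<int> \<and> of_nat (n + 1) * s \<in> \<int>" by simp
    qed
  next
    show "\<exists>B. \<forall>r s. c r s \<noteq> 0 \<longrightarrow> B \<le> r \<and> B \<le> s"
    proof (intro exI allI impI)
      fix r s assume "c r s \<noteq> 0"
      then obtain \<beta> where "lookup (c r s) (\<gamma> + \<beta>) \<noteq> 0" using lookup_nonzero_ex by blast
      then have \<beta>: "\<beta> \<in> keys v"
        and Q: "Q (lookup v \<beta>) \<lfloor>r - e1 \<beta>\<rfloor> \<lfloor>s - e2 \<beta>\<rfloor> \<noteq> 0" using nz by blast+
      have "- int (kdeg (lookup v \<beta>)) - 1 \<le> \<lfloor>r - e1 \<beta>\<rfloor> \<and> - int (kdeg (lookup v \<beta>)) - 1 \<le> \<lfloor>s - e2 \<beta>\<rfloor>"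
        using Q Qb by (meson not_le)
      moreover have "kdeg (lookup v \<beta>) \<le> d" by (rule kdeg_leI[OF d])
      ultimately have "- int d - 1 \<le> \<lfloor>r - e1 \<beta>\<rfloor>" "- int d - 1 \<le> \<lfloor>s - e2 \<beta>\<rfloor>" by auto
      then have "- of_nat d - 1 \<le> r - e1 \<beta>" "- of_nat d - 1 \<le> s - e2 \<beta>" by (simp_all add: le_floor_iff)
      then show "- of_nat d - 1 - S e1 - S e2 \<le> r \<and> - of_nat d - 1 - S e1 - S e2 \<le> s"
        using S[OF \<beta>, of e1] S[OF \<beta>, of e2] S0[of e1] S0[of e2] by linarith
    qed
  qed
qed

lemma lookup_comp2:
  assumes a: "is_vop n pa da \<gamma>a \<chi>a a" and b: "is_vop n pb db \<gamma>b \<chi>b b"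
    and \<gamma>b: "\<gamma>b \<in> weight_lattice n" and v: "v \<in> Vspace n"
  shows "lookup (comp2 a b v r s) (\<gamma>a + \<gamma>b + \<beta>) =
    (if r - wform n \<gamma>a (\<gamma>b + \<beta>) \<in> \<int> \<and> s - wform n \<gamma>b \<beta> \<in> \<int>
     then kconst (\<chi>a (\<gamma>b + \<beta>) * \<chi>b \<beta>) * vcoeff n pa da (vcoeff n pb db (lookup v \<beta>) \<lfloor>s - wform n \<gamma>b \<beta>\<rfloor>)
        \<lfloor>r - wform n \<gamma>a (\<gamma>b + \<beta>)\<rfloor> else 0)"
proof -
  have "b \<in> Hom_laurent n (Suc n)" by (rule is_vop_Hom_laurent[OF b \<gamma>b wform_denominator])
  then have "b v s \<in> Vspace n" using v unfolding Hom_laurent_def laurent_def by blast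
  from is_vopD[OF a this, of r "\<gamma>b + \<beta>"] show ?thesis
    by (simp add: comp2_def add.assoc is_vopD[OF b v] vcoeff_scale kconst_mult mult.assoc)
qed

text \<open>With e1 = (\<gamma>a, \<gamma>b + \<beta>) and e2 = (\<gamma>b, \<beta>) the scalar part
  is z_1^e1 z^e2 (1 - \<kappa> z / z_1)^(-p). For p = 1 it equals z_1^(e1 + 1) z^e2 / (z_1 -
  \<kappa> z), with a pole at z_1 = z only for \<kappa> = 1. The extra power of z is the
  \<open>- 1\<close> in the mode index.\<close>

lemma lookup_residue_product:
  assumes a: "is_vop n pa da \<gamma>a \<chi>a a" and b: "is_vop n pb db \<gamma>b \<chi>b b"
    and \<gamma>a: "\<gamma>a \<in> weight_lattice n" and \<gamma>b: "\<gamma>b \<in> weight_lattice n"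
    and int: "\<And>\<beta>. \<beta> \<in> weight_lattice n \<Longrightarrow> wform n \<gamma>a \<beta> \<in> \<int>"
    and \<kappa>: "\<kappa> \<noteq> 0" and p: "p \<in> {- 1, 0, 1}"
    and contr: "\<And>r. r \<ge> 1 \<Longrightarrow> contraction n da pb r = of_int p * (\<kappa> ^ r / of_nat r)"
    and v: "v \<in> Vspace n"
  shows "lookup (nth_product n a 0 b v s) (\<gamma>a + \<gamma>b + \<beta>) =
    (if p = 1 \<and> \<kappa> = 1 \<and> s - wform n \<gamma>b \<beta> \<in> \<int>
     then kconst (\<chi>a (\<gamma>b + \<beta>) * \<chi>b \<beta>) * vcoeff n (\<lambda>r l. pa r l + pb r l) (\<lambda>r l. da r l + db r l)
       (lookup v \<beta>) (\<lfloor>s - wform n \<gamma>b \<beta>\<rfloor> - \<lfloor>wform n \<gamma>a (\<gamma>b + \<beta>)\<rfloor> - 1) else 0)"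
proof -
  define e1 where "e1 \<beta> = wform n \<gamma>a (\<gamma>b + \<beta>)" for \<beta>
  define e2 where "e2 \<beta> = wform n \<gamma>b \<beta>" for \<beta>
  define X where "X \<beta> = \<chi>a (\<gamma>b + \<beta>) * \<chi>b \<beta>" for \<beta>
  \<comment> \<open>Only p = 1 has a pole to remove; otherwise the constant 1 witnesses quasi
    compatibility.\<close>
  define p0 :: "qf poly poly" where "p0 = (if p = 1 then [:[:0, - \<kappa>:], 1:] else 1)"
  define Q where "Q u r k = (if p = 1 then normal_ordered n pa da pb db (kdeg u) u (r - 1) k
    else vcoeff n pa da (vcoeff n pb db u k) r)" for u r k
  have comp: "lookup (comp2 a b v r s) (\<gamma>a + \<gamma>b + \<beta>) =
    (if r - e1 \<beta> \<in> \<int> \<and> s - e2 \<beta> \<in> \<int>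
     then kconst (X \<beta>) * vcoeff n pa da (vcoeff n pb db (lookup v \<beta>) \<lfloor>s - e2 \<beta>\<rfloor>) \<lfloor>r - e1 \<beta>\<rfloor> else 0)"
    if "v \<in> Vspace n" for v r s \<beta>
    using lookup_comp2[OF a b \<gamma>b that] by (simp add: e1_def e2_def X_def)
  have pm: "lookup (pmult2 p0 (comp2 a b v) r s) (\<gamma>a + \<gamma>b + \<beta>) =
    (if r - e1 \<beta> \<in> \<int> \<and> s - e2 \<beta> \<in> \<int> then kconst (X \<beta>) * Q (lookup v \<beta>) \<lfloor>r - e1 \<beta>\<rfloor> \<lfloor>s - e2 \<beta>\<rfloor> else 0)"
    if v: "v \<in> Vspace n" for v r s \<beta>
  proof (cases "p = 1")
    case False
    then show ?thesis by (simp add: p0_def pmult2_1 comp[OF v] Q_def)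
  next
    case True
    have c1: "contraction n da pb r = \<kappa> ^ r / of_nat r" if "r \<ge> 1" for r using contr[OF that] True by simp
    have "x - 1 \<in> \<int> \<longleftrightarrow> x \<in> \<int>" for x :: rat using Ints_add[of "x - 1" 1] Ints_diff[of x 1] by auto
    from this[of "r - e1 \<beta>"] this[of "s - e2 \<beta>"]
    have i1: "r - 1 - e1 \<beta> \<in> \<int> \<longleftrightarrow> r - e1 \<beta> \<in> \<int>" "s - 1 - e2 \<beta> \<in> \<int> \<longleftrightarrow> s - e2 \<beta> \<in> \<int>"
      by (simp_all add: diff_diff_eq add.commute)
    have "\<lfloor>r - 1 - e1 \<beta>\<rfloor> = \<lfloor>r - e1 \<beta>\<rfloor> - 1" "\<lfloor>s - 1 - e2 \<beta>\<rfloor> = \<lfloor>s - e2 \<beta>\<rfloor> - 1" by linarith+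
    then show ?thesis
      using True vcoeff_product_pole[OF c1 kdeg_le_kdeg, symmetric, where pa = pa and u = "lookup v \<beta>" and
          db = db and k = "\<lfloor>s - e2 \<beta>\<rfloor>" and r = "\<lfloor>r - e1 \<beta>\<rfloor>"]
      by (simp add: p0_def lookup_pmult2_linear[OF \<kappa>] comp[OF v] i1 Q_def right_diff_distrib mult.left_commute)
  qed
  have p0: "p0 \<noteq> 0" by (simp add: p0_def)
  have laur: "laurent2 n (pmult2 p0 (comp2 a b v))" if v: "v \<in> Vspace n" for v
  proof (rule laurent2I[OF v weight_lattice_add[OF \<gamma>a \<gamma>b] pm[OF v]])
    show "e1 \<beta> \<in> \<int>" if "\<beta> \<in> weight_lattice n" for \<beta>
      unfolding e1_def by (rule int[OF weight_lattice_add[OF \<gamma>b that]])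
    show "of_nat (Suc n) * e2 \<beta> \<in> \<int>" for \<beta> unfolding e2_def by (rule wform_denominator)
    show "Q u r k \<in> Kspace n" if "u \<in> Kspace n" for u r k
      using that by (simp add: Q_def Kspace_vcoeff Kspace_normal_ordered)
    show "Q u r k = 0" if rk: "r < - int (kdeg u) - 1 \<or> k < - int (kdeg u) - 1" for u r k
    proof (cases "p = 1")
      case True
      then show ?thesis using rk unfolding Q_def by (simp, intro normal_ordered_eq_0) auto
    next
      case False
      then have "p = 0 \<or> p = - 1" using p by auto
      then show ?thesis
        using False vcoeff_product_regular[where p = p and n = n and da = da and pb = pb and \<kappa> = \<kappa> and d = "kdeg u" and
            u = u and r = r and k = k and pa = pa and db = db] contr kdeg_le_kdeg rk
        by (simp add: Q_def)
    qed
  qed (simp add: Q_def)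
  have "of_nat 1 * wform n \<gamma>a \<beta> \<in> \<int>" if "\<beta> \<in> weight_lattice n" for \<beta>
    using int[OF that] by simp
  then have "a \<in> Hom_laurent n 1" by (rule is_vop_Hom_laurent[OF a \<gamma>a])
  moreover have "b \<in> Hom_laurent n (n + 1)" using is_vop_Hom_laurent[OF b \<gamma>b wform_denominator] by simp
  ultimately have q: "quasi_compatible_by n p0 a b"
    using p0 laur by (simp add: quasi_compatible_by_def)
  let ?u = "lookup v \<beta>"
  let ?R = "if p = 1 \<and> \<kappa> = 1 \<and> s - e2 \<beta> \<in> \<int>
     then kconst (X \<beta>) * vcoeff n (\<lambda>r l. pa r l + pb r l) (\<lambda>r l. da r l + db r l)
       ?u (\<lfloor>s - e2 \<beta>\<rfloor> - \<lfloor>e1 \<beta>\<rfloor> - 1) else 0"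
  have "lookup (lookup (nth_product n a 0 b v s) (\<gamma>a + \<gamma>b + \<beta>)) M = lookup ?R M" for M
  proof -
    define cc where "cc = (\<lambda>\<delta> M r j. lookup (lookup (comp2 a b v (of_int r) (s + of_int j)) \<delta>) M)"
    define c where "c = series_mult p0 (cc (\<gamma>a + \<gamma>b + \<beta>) M)"
    obtain B where B: "bounded2_by B c" and
      np: "lookup (lookup (nth_product n a 0 b v s) (\<gamma>a + \<gamma>b + \<beta>)) M =
        fls_nth (fls_nth (inverse (subst_poly p0) * subst_series c) (- 1)) 0"
      using lookup_nth_product[OF q v, of s "\<gamma>a + \<gamma>b + \<beta>" M 0] by (auto simp: c_def cc_def)
    have c: "c r j = lookup (lookup (pmult2 p0 (comp2 a b v) (of_int r) (s + of_int j)) (\<gamma>a + \<gamma>b + \<beta>)) M" for r j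
      by (simp add: c_def lookup_pmult2 series_mult_def cc_def algebra_simps)
    have neg: "fls_nth (subst_series c) m = 0" if "m < 0" for m
      by (intro fls_eqI) (simp add: that subst_series_nth[OF B])
    show ?thesis
    proof (cases "p = 1")
      case False
      have "subst_poly 1 = 1" by (simp add: subst_poly_def)
      then show ?thesis unfolding np using False neg by (simp add: p0_def)
    next
      case True
      have res: "lookup (lookup (nth_product n a 0 b v s) (\<gamma>a + \<gamma>b + \<beta>)) M =
         (if \<kappa> = 1 then subst_coeff c 0 0 else 0)"
        unfolding np p0_def using True neg by (simp add: linear_inverse_residue subst_series_nth[OF B])
      show ?thesis
      \<comment> \<open>The trivial cases are split off because integrality of
        \<open>e1 \<beta>\<close> requires \<beta> in the weight lattice, which is inferred from
        \<open>?u\<close> being nonzero.\<close>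
      proof (cases "?u = 0 \<or> s - e2 \<beta> \<notin> \<int>")
        case zero: True
        have "c r (- r) = 0" for r
        proof (cases "?u = 0")
          case True
          then show ?thesis by (simp add: c pm[OF v] Q_def)
        next
          case False
          then have "s - e2 \<beta> \<notin> \<int>" using zero by simp
          then have "s + of_int (- r) - e2 \<beta> \<notin> \<int>"
            using Ints_add[of "s + of_int (- r) - e2 \<beta>" "of_int r"] by auto
          then show ?thesis by (simp add: c pm[OF v])
        qed
        then have "subst_coeff c 0 0 = 0" by (simp add: subst_coeff_def)
        then show ?thesis unfolding res using zero by auto
      next
        case False
        then obtain K where K: "s - e2 \<beta> = of_int K" by (auto elim: Ints_cases)
        have "e1 \<beta> \<in> \<int>" unfolding e1_def
          using False Vspace_lattice[OF v] by (intro int weight_lattice_add \<gamma>b) auto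
        then obtain e where e: "e1 \<beta> = of_int e" by (auto elim: Ints_cases)
        define d where "d = kdeg ?u"
        have cr: "c r (- r) = lookup (kconst (X \<beta>) * normal_ordered n pa da pb db d ?u (r - e - 1) (K - r)) M" for r
        proof -
          have "s + of_int (- r) - e2 \<beta> = of_int (K - r)" "of_int r - e1 \<beta> = of_int (r - e)"
            using K e by simp_all
          then show ?thesis using True unfolding c pm[OF v]
            by (simp only: floor_of_int Ints_of_int) (simp add: Q_def d_def)
        qed
        \<comment> \<open>The range has to contain the support of \<open>c r (- r)\<close> and,
          after the shift by \<open>e + 1\<close>, that of the normal ordered diagonal.\<close>
        define B' where "B' = min B (e + 1 - int d)"
        define C where "C = max (- B) (K + int d)"
        have "subst_coeff c 0 0 = (\<Sum>r = B'..C. c r (- r))"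
          using subst_coeff_eq_sum_le[OF B, of B' 0 0 C] by (simp add: B'_def C_def)
        also have "\<dots> = lookup (kconst (X \<beta>) * (\<Sum>r = B'..C. normal_ordered n pa da pb db d ?u (r - e - 1) (K - r))) M"
          by (simp add: cr sum_distrib_left lookup_sum)
        also have "(\<Sum>r = B'..C. normal_ordered n pa da pb db d ?u (r - e - 1) (K - r)) =
            (\<Sum>r = B' - e - 1..C - e - 1. normal_ordered n pa da pb db d ?u r (K - e - 1 - r))"
          by (rule sum.reindex_bij_witness[of _ "\<lambda>r. r + e + 1" "\<lambda>r. r - e - 1"]) auto
        also have "\<dots> = vcoeff n (\<lambda>r l. pa r l + pb r l) (\<lambda>r l. da r l + db r l) ?u (K - e - 1)"
          by (rule normal_ordered_diagonal) (auto simp: d_def kdeg_le_kdeg B'_def C_def)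
        finally show ?thesis unfolding res using True False K e by simp
      qed
    qed
  qed
  then show ?thesis by (intro poly_mapping_eqI) (simp add: e1_def e2_def X_def)
qed

section \<open>Contractions of the given vertex operators\<close>

definition x_creation :: "nat \<Rightarrow> nat \<Rightarrow> nat \<Rightarrow> qf" where
  "x_creation j r l = (if l = j then - (qh ^ r / qint (int r)) else 0)"

definition x_annihilation :: "nat \<Rightarrow> nat \<Rightarrow> nat \<Rightarrow> qf" where
  "x_annihilation j r l = (if l = j then qh ^ r / qint (int r) else 0)"

definition Y_creation :: "nat \<Rightarrow> nat \<Rightarrow> nat \<Rightarrow> nat \<Rightarrow> qf" where
  "Y_creation n i r l = qh ^ r / qint (int r) * mcoef n i l (- int r)"

definition Y_annihilation :: "nat \<Rightarrow> nat \<Rightarrow> nat \<Rightarrow> nat \<Rightarrow> qf" where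
  "Y_annihilation n i r l = - (qh ^ r / qint (int r)) * mcoef n i l (int r)"

lemma lookup_zpart: "lookup (zpart n \<alpha> v s) \<beta> = (if wform n \<alpha> \<beta> = s then lookup v \<beta> else 0)"
proof -
  have "lookup (zpart n \<alpha> v s) \<beta> = (\<Sum>\<beta>' \<in> {\<beta>' \<in> keys v. wform n \<alpha> \<beta>' = s}.
     if \<beta>' = \<beta> then lookup v \<beta> else 0)"
    unfolding zpart_def lookup_sum by (rule sum.cong) (auto simp: lookup_single when_def)
  then show ?thesis by (auto simp: in_keys_iff)
qed

lemma lookup_sign_part: "lookup (sign_part n m \<alpha> v) \<beta> =
  kconst (qconst (exp (of_real pi * \<i> * of_rat (of_nat m * wform n \<alpha> \<beta>)))) * lookup v \<beta>"
proof -
  have "lookup (sign_part n m \<alpha> v) \<beta> = (\<Sum>\<beta>' \<in> keys v.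
     if \<beta>' = \<beta> then kconst (qconst (exp (of_real pi * \<i> * of_rat (of_nat m * wform n \<alpha> \<beta>)))) * lookup v \<beta> else 0)"
    unfolding sign_part_def lookup_sum by (rule sum.cong) (auto simp: lookup_single when_def)
  then show ?thesis by (auto simp: in_keys_iff)
qed

lemma lookup_heis_neg: "r \<ge> 1 \<Longrightarrow> lookup (heis n j (- int r) v) \<beta> = kvar j r * lookup v \<beta>"
  by (simp add: heis_def lookup_map0)

lemma lookup_heis_pos: "lookup (heis n j (int r) v) \<beta> = kann n j r (lookup v \<beta>)"
  by (simp add: heis_def lookup_map0)

lemma x_minus_is_vop:
  assumes "j \<in> {1..n}"
  shows "is_vop n (x_creation j) (x_annihilation j) (- simple_root n j) (lat_sign n (- simple_root n j)) (x_minus n j)"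
  unfolding x_minus_def
proof (rule vertex_op_is_vop)
  fix r :: nat and v :: vsp and \<beta> assume "r \<ge> 1"
  have sum: "(\<Sum>l = 1..n. kconst (if l = j then c else 0) * g l) = kconst c * g j" for c and g :: "nat \<Rightarrow> kalg"
    using assms sum.delta[of "{1..n}" j "\<lambda>l. kconst c * g l"] by (simp add: if_distrib if_distribR cong: if_cong)
  show "lookup (vscale (- (qh ^ r / qint (int r))) (heis n j (- int r) v)) \<beta> =
      creation n (x_creation j) r * lookup v \<beta>"
    unfolding lookup_vscale lookup_heis_neg[OF \<open>r \<ge> 1\<close>] creation_def x_creation_def sum by (rule mult.assoc[symmetric])
  show "lookup (vscale (qh ^ r / qint (int r)) (heis n j (int r) v)) \<beta> =
      annihilation n (x_annihilation j) r (lookup v \<beta>)"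
    unfolding lookup_vscale lookup_heis_pos annihilation_def x_annihilation_def sum ..
qed (simp add: lookup_lat_mult lookup_zpart)

lemma Y_op_is_vop:
  "is_vop n (Y_creation n i) (Y_annihilation n i) (fund_weight i)
    (\<lambda>\<beta>. lat_sign n (fund_weight i) \<beta> * qconst (exp (of_real pi * \<i> * of_rat (of_nat (if i = n then 0 else i) *
       wform n (fund_weight n) \<beta>)))) (Y_op n i)"
  unfolding Y_op_def
proof (rule vertex_op_is_vop)
  fix r :: nat and v :: vsp and \<beta> assume "r \<ge> 1"
  show "lookup (vscale (qh ^ r / qint (int r)) (heis_star n i (- int r) v)) \<beta> =
      creation n (Y_creation n i) r * lookup v \<beta>"
    unfolding Y_creation_def creation_def
    by (simp only: lookup_vscale heis_star_def lookup_sum lookup_heis_neg[OF \<open>r \<ge> 1\<close>]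
        sum_distrib_left sum_distrib_right kconst_mult mult.assoc)
  show "lookup (vscale (- (qh ^ r / qint (int r))) (heis_star n i (int r) v)) \<beta> =
      annihilation n (Y_annihilation n i) r (lookup v \<beta>)"
    unfolding Y_annihilation_def annihilation_def
    by (simp only: lookup_vscale heis_star_def lookup_sum lookup_heis_pos sum_distrib_left kconst_mult_left)
qed (simp add: lookup_lat_mult lookup_sign_part lookup_zpart kconst_mult mult.assoc)

lemma lat_sign_nonzero [simp]: "lat_sign n \<alpha> \<beta> \<noteq> 0"
  by (simp add: lat_sign_def)

lemma wform_0_left [simp]: "wform n 0 \<beta> = 0" and wform_0_right [simp]: "wform n \<beta> 0 = 0"
  by (simp_all add: wform_def)

lemma wform_minus_left: "wform n (- \<alpha>) \<beta> = - wform n \<alpha> \<beta>"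
  using wform_add[of n "- \<alpha>" \<alpha> \<beta>] by simp

lemma wform_expand: "wform n \<alpha> \<beta> = (\<Sum>k = 1..n. of_int (lookup \<alpha> k) * wform n (fund_weight k) \<beta>)"
proof -
  have *: "wform n (fund_weight k) \<beta> = (\<Sum>j = 1..n. of_int (lookup \<beta> j) *
     (of_nat (min k j) * (of_nat (Suc n) - of_nat (max k j)) / of_nat (Suc n)))" if "k \<in> {1..n}" for k
  proof -
    have "wform n (fund_weight k) \<beta> = (\<Sum>i = 1..n. if i = k then \<Sum>j = 1..n. of_int (lookup \<beta> j) *
     (of_nat (min k j) * (of_nat (Suc n) - of_nat (max k j)) / of_nat (Suc n)) else 0)"
      unfolding wform_def by (rule sum.cong[OF refl]) (auto simp: lookup_fund_weight)
    then show ?thesis using that by simp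
  qed
  show ?thesis
    by (subst wform_def, rule sum.cong[OF refl], subst *, assumption)
       (simp add: sum_distrib_left mult.assoc)
qed

lemma wform_root:
  assumes "j \<in> {1..n}"
  shows "wform n (simple_root n j) \<beta> = of_int (lookup \<beta> j)"
proof -
  have "wform n (simple_root n j) \<beta> = (\<Sum>k = 1..n. of_int (lookup \<beta> k) * wform n (fund_weight k) (simple_root n j))"
    by (subst wform_sym) (rule wform_expand)
  also have "\<dots> = (\<Sum>k = 1..n. if k = j then of_int (lookup \<beta> k) else 0)"
    by (rule sum.cong[OF refl]) (use assms in \<open>auto simp: wform_fund_root\<close>)
  finally show ?thesis using assms by simp
qed

lemma weight_lattice_root: "- simple_root n j \<in> weight_lattice n"
  by (auto simp: weight_lattice_def in_keys_iff lookup_simple_root split: if_splits)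

lemma weight_lattice_fund: "i \<in> {1..n} \<Longrightarrow> fund_weight i \<in> weight_lattice n"
  by (simp add: weight_lattice_def fund_weight_def)

section \<open>Identities for quantum integers and the quantum Cartan matrix\<close>

lemma qint_scaled: "qint (k * int r) = ((qq ^ r) powi k - (qq ^ r) powi (- k)) / (qq - qq powi (- 1))"
proof -
  have "qq powi (int r * k) = (qq ^ r) powi k" for k by (simp add: power_int_mult)
  from this[of k] this[of "- k"] show ?thesis by (simp add: qint_def mult.commute)
qed

lemma qint_powers:
  assumes "x = qq ^ r" "y = x powi k"
  shows "qint (k * int r) = (y - inverse y) / (qq - qq powi (- 1))"
  using assms by (simp add: qint_scaled power_int_minus)

text \<open>The sequence [k r] is annihilated by the interior rows of the quantum Cartan matrix,
  with [2 r] on the diagonal and -[r] beside it.\<close>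

lemma qint_double: "qint (2 * int r) * qint (k * int r) = qint (int r) * (qint ((k + 1) * int r) + qint ((k - 1) * int r))"
proof -
  define x where "x = qq ^ r"
  define y where "y = x powi k"
  define \<delta> where "\<delta> = qq - qq powi (- 1)"
  have nz: "x \<noteq> 0" "y \<noteq> 0" "\<delta> \<noteq> 0" using qq_diff_nonzero by (simp_all add: x_def y_def \<delta>_def)
  note q = qint_powers[OF x_def, folded \<delta>_def]
  have "qint (2 * int r) = (x * x - inverse (x * x)) / \<delta>" using q[of "x * x" 2] by (simp add: power2_eq_square)
  moreover have "qint (int r) = (x - inverse x) / \<delta>" using q[of x 1] by simp
  moreover have "qint (k * int r) = (y - inverse y) / \<delta>" using q[OF y_def] .
  moreover have "qint ((k + 1) * int r) = (y * x - inverse (y * x)) / \<delta>"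
    using nz by (intro q) (simp add: y_def power_int_add)
  moreover have "qint ((k - 1) * int r) = (y / x - inverse (y / x)) / \<delta>"
    using nz by (intro q) (simp add: y_def power_int_diff)
  ultimately show ?thesis using nz by (simp only:) (simp add: field_simps)
qed

text \<open>A discrete Wronskian: it evaluates the jump where the solutions [b r] and
  [(n + 1 - b) r] of the recursion are joined.\<close>

lemma qint_cross: "qint ((k + 1) * int r) * qint (k' * int r) - qint (k * int r) * qint ((k' - 1) * int r) =
    qint (int r) * qint ((k + k') * int r)"
proof -
  define x where "x = qq ^ r"
  define y where "y = x powi k"
  define z where "z = x powi k'"
  define \<delta> where "\<delta> = qq - qq powi (- 1)"
  have nz: "x \<noteq> 0" "y \<noteq> 0" "z \<noteq> 0" "\<delta> \<noteq> 0" using qq_diff_nonzero by (simp_all add: x_def y_def z_def \<delta>_def)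
  note q = qint_powers[OF x_def, folded \<delta>_def]
  have "qint (int r) = (x - inverse x) / \<delta>" using q[of x 1] by simp
  moreover have "qint (k * int r) = (y - inverse y) / \<delta>" using q[OF y_def] .
  moreover have "qint (k' * int r) = (z - inverse z) / \<delta>" using q[OF z_def] .
  moreover have "qint ((k + 1) * int r) = (y * x - inverse (y * x)) / \<delta>"
    using nz by (intro q) (simp add: y_def power_int_add)
  moreover have "qint ((k' - 1) * int r) = (z / x - inverse (z / x)) / \<delta>"
    using nz by (intro q) (simp add: z_def power_int_diff)
  moreover have "qint ((k + k') * int r) = (y * z - inverse (y * z)) / \<delta>"
    using nz by (intro q) (simp add: y_def z_def power_int_add)
  ultimately show ?thesis using nz by (simp only:) (simp add: field_simps)
qed

text \<open>\<open>sum_cartan\<close> with a function of the Cartan entries in place of the entries,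
  for use with the quantum integers [a r].\<close>

lemma sum_cartan_function:
  fixes h :: "nat \<Rightarrow> 'a::comm_ring_1" and G :: "int \<Rightarrow> 'a"
  assumes j: "j \<in> {1..n}" and h0: "h 0 = 0" and hn: "h (Suc n) = 0" and G0: "G 0 = 0"
  shows "(\<Sum>l = 1..n. G (cartan j l) * h l) = G 2 * h j + G (- 1) * (h (j - 1) + h (Suc j))"
proof -
  have "(\<Sum>l = 1..n. G (cartan j l) * h l) = (\<Sum>l = 0..Suc n. G (cartan j l) * h l)"
    using h0 hn by (simp add: sum.atLeast_Suc_atMost[of 0])
  also have "\<dots> = (\<Sum>l \<in> {j - 1, j, Suc j}. G (cartan j l) * h l)"
    by (rule sum.mono_neutral_right) (use j G0 in \<open>auto simp: cartan_def\<close>)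
  also have "\<dots> = G 2 * h j + G (- 1) * (h (j - 1) + h (Suc j))"
  proof -
    obtain k where "j = Suc k" using j by (cases j) auto
    then show ?thesis by (simp add: cartan_def algebra_simps)
  qed
  finally show ?thesis .
qed

text \<open>The matrix \<open>mcoef\<close> inverts the quantum Cartan matrix \<open>[a\<^sub>i\<^sub>j r] / [r]\<close>.\<close>

lemma sum_cartan_mcoef:
  assumes i: "i \<in> {1..n}" and l: "l \<in> {1..n}" and r: "r \<ge> 1"
  shows "(\<Sum>b = 1..n. qint (cartan l b * int r) * mcoef n i b (- int r)) = (if l = i then qint (int r) else 0)"
proof -
  define s where "s k = qint (k * int r)" for k
  define D where "D = s (int (n + 1)) * s 1"
  \<comment> \<open>A discrete Green function: it solves the recursion on both sides of
    \<open>i\<close>, where its source is, and vanishes at 0 and n + 1.\<close>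
  define h where "h b = mcoef n i b (- int r)" for b
  have s1: "s 1 = qint (int r)" by (simp add: s_def)
  have D: "D \<noteq> 0" using r by (simp add: D_def s_def)
  \<comment> \<open>The four signs produced by the negative argument cancel in
    \<open>mcoef\<close>.\<close>
  have sm: "qint (k * - int r) = - s k" for k by (simp add: s_def flip: qint_minus)
  have h_le: "h b = s (int b) * s (int (n + 1) - int i) / D" if "b \<le> i" for b
    using that i sm[of 1] by (simp add: h_def mcoef_def sm D_def of_nat_diff del: mult_minus_right of_nat_add) simp
  have h_ge: "h b = s (int i) * s (int (n + 1) - int b) / D" if "b \<ge> i" "b \<le> n + 1" for b
    using that i sm[of 1] by (cases "b = i") (simp_all add: h_def mcoef_def sm D_def of_nat_diff del: mult_minus_right of_nat_add, simp_all)
  have dbl: "s 2 * s k = s 1 * (s (k + 1) + s (k - 1))" for k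
    unfolding s_def using qint_double[of r k] by simp
  have cross: "s (k + 1) * s k' - s k * s (k' - 1) = s 1 * s (k + k')" for k k'
    unfolding s_def using qint_cross[of k r k'] by simp
  have "(\<Sum>b = 1..n. s (cartan l b) * h b) = s 2 * h l + s (- 1) * (h (l - 1) + h (Suc l))"
    by (rule sum_cartan_function[OF l]) (use i h_le[of 0] h_ge[of "Suc n"] in \<open>auto simp: s_def\<close>)
  also have "s (- 1) = - s 1" by (simp add: s_def qint_minus)
  also have "s 2 * h l + - s 1 * (h (l - 1) + h (Suc l)) = (if l = i then qint (int r) else 0)"
  proof -
    consider "l < i" | "l = i" | "l > i" by linarith
    then show ?thesis
    proof cases
      case 1
      have "s 2 * h l + - s 1 * (h (l - 1) + h (Suc l)) =
        (s 2 * s (int l) - s 1 * (s (int l + 1) + s (int l - 1))) * s (int (n + 1) - int i) / D"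
        using 1 l by (simp add: h_le of_nat_diff add_divide_distrib diff_divide_distrib algebra_simps)
      then show ?thesis using 1 by (simp only: dbl) simp
    next
      case 2
      have "s 2 * h l + - s 1 * (h (l - 1) + h (Suc l)) =
        (s 2 * s (int i) * s (int (n + 1) - int i) - s 1 * (s (int i - 1) * s (int (n + 1) - int i) +
          s (int i) * s (int (n + 1) - int i - 1))) / D"
        using 2 l h_ge[of "Suc i"] by (simp add: h_le of_nat_diff add_divide_distrib diff_divide_distrib algebra_simps)
      also have "\<dots> = s 1 * (s (int i + 1) * s (int (n + 1) - int i) - s (int i) * s (int (n + 1) - int i - 1)) / D"
        by (simp only: dbl) (simp add: algebra_simps)
      also have "\<dots> = s 1 * (s 1 * s (int (n + 1))) / D"
        by (simp only: cross) simp
      also have "\<dots> = s 1" using D by (simp add: D_def)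
      finally show ?thesis using 2 s1 by simp
    next
      case 3
      have "s 2 * h l + - s 1 * (h (l - 1) + h (Suc l)) =
        s (int i) * (s 2 * s (int (n + 1) - int l) - s 1 * (s (int (n + 1) - int l + 1) + s (int (n + 1) - int l - 1))) / D"
        using 3 l by (simp add: h_ge of_nat_diff add_divide_distrib diff_divide_distrib algebra_simps)
      then show ?thesis using 3 by (simp only: dbl) simp
    qed
  qed
  finally show ?thesis by (simp add: s_def h_def)
qed

lemma contraction_x:
  assumes "l \<in> {1..n}"
  shows "contraction n (x_annihilation l) pc r =
    qh ^ r / qint (int r) * (\<Sum>b = 1..n. pc r b * (qint (cartan l b * int r) * qint (int r) / of_nat r))"
proof -
  have "contraction n (x_annihilation l) pc r = (\<Sum>a = 1..n. if a = l then
     qh ^ r / qint (int r) * (\<Sum>b = 1..n. pc r b * (qint (cartan l b * int r) * qint (int r) / of_nat r)) else 0)"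
    unfolding contraction_def
    by (rule sum.cong[OF refl]) (simp add: x_annihilation_def sum_distrib_left mult.assoc)
  then show ?thesis using assms by simp
qed

text \<open>The modes of \<open>Y_op\<close> are dual to the a_l(r), so only l = i contracts. The
  factors q^(r/2) of the two operators combine to q^r, which puts the pole at z_1 = q z.\<close>

lemma contraction_x_Y:
  assumes i: "i \<in> {1..n}" and l: "l \<in> {1..n}" and r: "r \<ge> 1"
  shows "contraction n (x_annihilation l) (Y_creation n i) r = (if l = i then qq ^ r / of_nat r else 0)"
proof -
  have nz: "qint (int r) \<noteq> 0" using r by simp
  have "contraction n (x_annihilation l) (Y_creation n i) r =
    qh ^ r * qh ^ r / (qint (int r) * of_nat r) * (\<Sum>b = 1..n. qint (cartan l b * int r) * mcoef n i b (- int r))"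
    unfolding contraction_x[OF l] Y_creation_def sum_distrib_left
    by (rule sum.cong[OF refl]) (use nz r in \<open>simp add: field_simps\<close>)
  also have "\<dots> = (if l = i then qh ^ r * qh ^ r / of_nat r else 0)"
    unfolding sum_cartan_mcoef[OF i l r] using nz by simp
  also have "qh ^ r * qh ^ r = qq ^ r" by (simp add: qq_def power2_eq_square power_mult_distrib)
  finally show ?thesis .
qed

lemma contraction_x_x:
  assumes j: "j \<in> {1..n}" and l: "l \<in> {1..n}" and r: "r \<ge> 1"
  shows "contraction n (x_annihilation l) (\<lambda>r a. c ^ r * x_creation j r a) r =
    - (qq ^ r * c ^ r * qint (cartan l j * int r) / (qint (int r) * of_nat r))"
proof -
  have nz: "qint (int r) \<noteq> 0" using r by simp
  have "(\<Sum>b = 1..n. c ^ r * x_creation j r b * (qint (cartan l b * int r) * qint (int r) / of_nat r)) =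
    (\<Sum>b = 1..n. if b = j then - (c ^ r * qh ^ r * qint (cartan l j * int r) / of_nat r) else 0)"
    by (rule sum.cong[OF refl]) (use nz in \<open>simp add: x_creation_def\<close>)
  also have "\<dots> = - (c ^ r * qh ^ r * qint (cartan l j * int r) / of_nat r)" using j by simp
  finally have "contraction n (x_annihilation l) (\<lambda>r a. c ^ r * x_creation j r a) r =
     - (qh ^ r * qh ^ r * c ^ r * qint (cartan l j * int r) / (qint (int r) * of_nat r))"
    unfolding contraction_x[OF l] by simp
  also have "qh ^ r * qh ^ r = qq ^ r" by (simp add: qq_def power2_eq_square power_mult_distrib)
  finally show ?thesis .
qed

lemma contraction_add_right:
  "contraction n dc (\<lambda>r a. pa r a + pb r a) r = contraction n dc pa r + contraction n dc pb r"
  by (simp add: contraction_def distrib_left distrib_right sum.distrib add_divide_distrib)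

lemma contraction_scale_left:
  "contraction n (\<lambda>r a. c ^ r * dc r a) pc r = c ^ r * contraction n dc pc r"
  by (simp add: contraction_def sum_distrib_left mult.assoc)

section \<open>The iterated products\<close>

lemma is_vop_vac:
  assumes b: "is_vop n pc dc \<gamma> \<chi> b"
  shows "lookup (b vac s) (\<gamma> + \<beta>) =
    (if \<beta> = 0 \<and> s \<in> \<int> then kconst (\<chi> 0) * vcoeff n pc dc 1 \<lfloor>s\<rfloor> else 0)"
  using is_vopD[OF b vac_Vspace, of s \<beta>]
  by (auto simp: vac_def lookup_single when_def simp del: single_one)

lemma kconst_eq_0_iff [simp]: "kconst c = 0 \<longleftrightarrow> c = 0"
  by (metis kconst_0 lookup_single_eq lookup_zero kconst_def)

lemma is_vop_vac_nonzero:
  assumes "is_vop n pc dc \<gamma> \<chi> b" "\<chi> 0 \<noteq> 0"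
  shows "lookup (b vac 0) \<gamma> \<noteq> 0"
  using is_vop_vac[OF assms(1), of 0 0] assms(2) by (simp add: vcoeff_1)

lemma is_vop_nonzero:
  assumes "is_vop n pc dc \<gamma> \<chi> b" "\<chi> 0 \<noteq> 0"
  shows "\<not> vfield_zero n b"
proof -
  have "b vac 0 \<noteq> 0" using is_vop_vac_nonzero[OF assms] by auto
  then show ?thesis using vac_Vspace unfolding vfield_zero_def by blast
qed

text \<open>The weight is unique because the z^0 coefficient on the vacuum has the nonzero component
  \<chi>(0).\<close>

lemma is_vop_field_weight:
  assumes b: "is_vop n pc dc \<gamma> \<chi> b" and \<chi>: "\<chi> 0 \<noteq> 0" and \<gamma>: "\<gamma> \<in> weight_lattice n"
  shows "field_weight n b = \<gamma>"
  unfolding field_weight_def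
proof (rule the_equality)
  define d where "d s = lookup (b vac s) \<gamma>" for s
  have "b \<in> Hom_laurent n (Suc n)" by (rule is_vop_Hom_laurent[OF b \<gamma> wform_denominator])
  then have l: "laurent (Suc n) (Vspace n) (b vac)" using vac_Vspace unfolding Hom_laurent_def by blast
  have nz: "b vac s \<noteq> 0" if "d s \<noteq> 0" for s using that by (auto simp: d_def)
  have "laurent (n + 1) (Kspace n) d"
    unfolding laurent_def
  proof (intro conjI allI impI)
    show "d s \<in> Kspace n" for s using l Vspace_Kspace unfolding laurent_def d_def by blast
    show "of_nat (n + 1) * s \<in> \<int>" if "d s \<noteq> 0" for s
      using l nz[OF that] unfolding laurent_def by simp
    show "\<exists>B. \<forall>s. d s \<noteq> 0 \<longrightarrow> B \<le> s" using l nz unfolding laurent_def by meson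
  qed
  moreover have "b vac s = single \<gamma> (d s)" for s
    by (rule shifted_eqI[of _ \<gamma>]) (auto simp: is_vop_vac[OF b] d_def lookup_single when_def is_vop_vac[OF b, where \<beta> = 0, simplified])
  ultimately show "has_weight n b \<gamma>" using \<gamma> by (auto simp: has_weight_def)
next
  fix \<alpha> assume "has_weight n b \<alpha>"
  then obtain d where "b vac 0 = single \<alpha> (d 0)" by (auto simp: has_weight_def)
  then show "\<alpha> = \<gamma>" using is_vop_vac_nonzero[OF b \<chi>] by (auto simp: lookup_single when_def split: if_splits)
qed

text \<open>The zeroth products in \<open>bullet\<close> vanish except for the one shift that moves the pole to \<open>z\<^sub>1 = z\<close>.\<close>

context
  fixes n j :: nat and b :: vfield and pc dc \<gamma> \<chi> p C
  assumes b: "is_vop n pc dc \<gamma> \<chi> b" and \<chi>: "\<And>\<beta>. \<chi> \<beta> \<noteq> 0" and \<gamma>: "\<gamma> \<in> weight_lattice n"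
    and j: "j \<in> {1..n}" and p: "lookup \<gamma> j = p" "p \<in> {- 1, 0, 1}"
    and contr: "\<And>r. r \<ge> 1 \<Longrightarrow> contraction n (x_annihilation j) pc r = of_int p * ((qq powi C) ^ r / of_nat r)"
begin

lemma wform_root_int: "\<beta> \<in> weight_lattice n \<Longrightarrow> wform n (- simple_root n j) \<beta> \<in> \<int>"
  by (simp add: wform_minus_left wform_root[OF j])

text \<open>The shift moves the pole from q^C to \<kappa> = q^(C - u/2), and this is 1 only for u =
  2 C.\<close>

lemma lookup_shifted_product:
  fixes u :: int
  assumes v: "v \<in> Vspace n"
  defines "c \<equiv> qh powi u"
  shows "lookup (nth_product n (qshift u (x_minus n j)) 0 b v s) (- simple_root n j + \<gamma> + \<beta>) =
    (if p = 1 \<and> u = 2 * C \<and> s - wform n \<gamma> \<beta> \<in> \<int>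
     then kconst (lat_sign n (- simple_root n j) (\<gamma> + \<beta>) * c powi \<lfloor>wform n (- simple_root n j) (\<gamma> + \<beta>)\<rfloor> * \<chi> \<beta>) *
       vcoeff n (\<lambda>r l. c ^ r * x_creation j r l + pc r l) (\<lambda>r l. inverse c ^ r * x_annihilation j r l + dc r l)
       (lookup v \<beta>) (\<lfloor>s - wform n \<gamma> \<beta>\<rfloor> - \<lfloor>wform n (- simple_root n j) (\<gamma> + \<beta>)\<rfloor> - 1) else 0)"
proof -
  define \<kappa> where "\<kappa> = inverse c * qq powi C"
  have c0: "c \<noteq> 0" by (simp add: c_def)
  have \<kappa>: "\<kappa> = qh powi (2 * C - u)"
    by (simp add: \<kappa>_def c_def qq_powi power_int_diff field_simps)
  have "\<kappa> = 1 \<longleftrightarrow> u = 2 * C" unfolding \<kappa> by (auto simp: qh_powi_eq_1_iff)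
  moreover have "contraction n (\<lambda>r l. inverse c ^ r * x_annihilation j r l) pc r = of_int p * (\<kappa> ^ r / of_nat r)" if "r \<ge> 1" for r
    by (simp add: contraction_scale_left contr[OF that] \<kappa>_def power_mult_distrib mult.left_commute)
  moreover have "\<kappa> \<noteq> 0" by (simp add: \<kappa>)
  ultimately show ?thesis
    using lookup_residue_product[OF is_vop_qshift[OF x_minus_is_vop[OF j] wform_root_int c_def[THEN meta_eq_to_obj_eq]] b
        weight_lattice_root \<gamma> wform_root_int _ p(2) _ v, of \<kappa> s \<beta>]
    by simp
qed

text \<open>The exponent (wt a, wt b) + 1 is 1 - p. In the surviving case p = 1 it is 0, so of the
  prefactor only q^t with t = C remains.\<close>

lemma bullet_eq:
  assumes v: "v \<in> Vspace n"
  shows "bullet n (x_minus n j) b v s = (if p = 1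
    then vscale (qh powi (2 * C)) (nth_product n (qshift (2 * C) (x_minus n j)) 0 b v s) else 0)"
proof -
  define N where "N u s = nth_product n (qshift u (x_minus n j)) 0 b v s" for u s
  have "field_weight n (x_minus n j) = - simple_root n j"
    by (rule is_vop_field_weight[OF x_minus_is_vop[OF j] lat_sign_nonzero weight_lattice_root])
  moreover have "field_weight n b = \<gamma>" by (rule is_vop_field_weight[OF b \<chi> \<gamma>])
  ultimately have bl: "bullet n (x_minus n j) b v s =
      Sum_any (\<lambda>u. vscale (qh powi (- u * (1 - p)) * qh powi u) (N u (s + of_int (1 - p))))"
    by (simp add: bullet_def Let_def wform_minus_left wform_root[OF j] p(1) N_def)
  have N0: "N u s = 0" if "p \<noteq> 1 \<or> u \<noteq> 2 * C" for u s
    unfolding N_def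
    by (rule shifted_eqI[of _ "- simple_root n j + \<gamma>"], subst lookup_shifted_product[OF v]) (use that in auto)
  have "bullet n (x_minus n j) b v s = (\<Sum>u \<in> {2 * C}. vscale (qh powi (- u * (1 - p)) * qh powi u) (N u (s + of_int (1 - p))))"
    unfolding bl
  proof (rule Sum_any.expand_superset)
    have "u = 2 * C" if "N u s \<noteq> 0" for u s using N0 that by blast
    then show "{u. vscale (qh powi (- u * (1 - p)) * qh powi u) (N u (s + of_int (1 - p))) \<noteq> 0} \<subseteq> {2 * C}"
      by (metis (mono_tags, lifting) mem_Collect_eq singletonI subsetI vscale_zero)
  qed simp
  then show ?thesis using N0 by (simp add: N_def)
qed

lemma bullet_zero_field: "p \<noteq> 1 \<Longrightarrow> vfield_zero n (bullet n (x_minus n j) b)"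
  by (simp add: vfield_zero_def bullet_eq)

lemma bullet_is_vop:
  assumes p1: "p = 1"
  defines "c \<equiv> qh powi (2 * C)"
  shows "is_vop n (\<lambda>r l. c ^ r * x_creation j r l + pc r l) (\<lambda>r l. inverse c ^ r * x_annihilation j r l + dc r l)
    (- simple_root n j + \<gamma>) (\<lambda>\<beta>. c * (lat_sign n (- simple_root n j) (\<gamma> + \<beta>) *
       c powi \<lfloor>wform n (- simple_root n j) (\<gamma> + \<beta>)\<rfloor> * \<chi> \<beta>)) (bullet n (x_minus n j) b)"
  unfolding is_vop_def
proof (intro ballI allI)
  fix v s \<beta> assume v: "v \<in> Vspace n"
  have w: "wform n (- simple_root n j) (\<gamma> + \<beta>) = - of_int (1 + lookup \<beta> j)"
    by (simp add: wform_minus_left wform_root[OF j] lookup_add p(1) p1)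
  have w': "wform n (- simple_root n j + \<gamma>) \<beta> = wform n \<gamma> \<beta> - of_int (lookup \<beta> j)"
    by (simp only: wform_add wform_minus_left wform_root[OF j])
  have eq: "s - wform n (- simple_root n j + \<gamma>) \<beta> = s - wform n \<gamma> \<beta> + of_int (lookup \<beta> j)"
    unfolding w' by simp
  have "s - wform n (- simple_root n j + \<gamma>) \<beta> \<in> \<int> \<longleftrightarrow> s - wform n \<gamma> \<beta> \<in> \<int>"
    unfolding eq using Ints_add[of "s - wform n \<gamma> \<beta>" "of_int (lookup \<beta> j)"]
      Ints_diff[of "s - wform n \<gamma> \<beta> + of_int (lookup \<beta> j)" "of_int (lookup \<beta> j)"] by auto
  \<comment> \<open>The pairing p = 1 in (-\<alpha>_j, \<gamma> + \<beta>) cancels the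
    \<open>- 1\<close> coming from the residue.\<close>
  moreover have "\<lfloor>s - wform n \<gamma> \<beta>\<rfloor> - \<lfloor>wform n (- simple_root n j) (\<gamma> + \<beta>)\<rfloor> - 1 = \<lfloor>s - wform n (- simple_root n j + \<gamma>) \<beta>\<rfloor>"
  proof -
    have "\<lfloor>wform n (- simple_root n j) (\<gamma> + \<beta>)\<rfloor> = - (1 + lookup \<beta> j)"
      unfolding w by (simp only: floor_of_int flip: of_int_minus)
    then show ?thesis unfolding eq by linarith
  qed
  ultimately show "lookup (bullet n (x_minus n j) b v s) (- simple_root n j + \<gamma> + \<beta>) =
     (if s - wform n (- simple_root n j + \<gamma>) \<beta> \<in> \<int>
      then kconst (c * (lat_sign n (- simple_root n j) (\<gamma> + \<beta>) * c powi \<lfloor>wform n (- simple_root n j) (\<gamma> + \<beta>)\<rfloor> * \<chi> \<beta>)) *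
        vcoeff n (\<lambda>r l. c ^ r * x_creation j r l + pc r l) (\<lambda>r l. inverse c ^ r * x_annihilation j r l + dc r l)
        (lookup v \<beta>) \<lfloor>s - wform n (- simple_root n j + \<gamma>) \<beta>\<rfloor> else 0)"
    unfolding bullet_eq[OF v] if_P[OF p1] lookup_vscale lookup_shifted_product[OF v] c_def[symmetric]
    by (simp add: p1 kconst_mult_left)
qed

end

text \<open>If \<open>m\<close> counts the boxes on the diagonals of a partition, this is row +
  column - 1 of the next box on the diagonal l - i.\<close>

definition box_content :: "nat \<Rightarrow> (nat \<Rightarrow> int) \<Rightarrow> nat \<Rightarrow> int" where
  "box_content i m l = \<bar>int l - int i\<bar> + 1 + 2 * m l"

text \<open>The operator obtained from \<open>Y_op n i\<close> after applying, for each \<open>l\<close>, the operator \<open>x_minus n l\<close>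
  \<open>m l\<close> times: its contraction with \<open>x_minus n l\<close> is the expansion of
  \<open>(1 - q\<^sup>c z\<^sub>2 / z\<^sub>1)\<^sup>-\<^sup>p\<close>, where \<open>c\<close> is \<open>box_content i m l\<close> and \<open>p\<close> is \<open>pairing i m l\<close>.\<close>

definition vstate :: "nat \<Rightarrow> nat \<Rightarrow> (nat \<Rightarrow> int) \<Rightarrow> vfield \<Rightarrow> bool" where
  "vstate n i m b \<longleftrightarrow> (\<exists>pc dc \<gamma> \<chi>. is_vop n pc dc \<gamma> \<chi> b \<and> (\<forall>\<beta>. \<chi> \<beta> \<noteq> 0) \<and> \<gamma> \<in> weight_lattice n \<and>
     (\<forall>l \<in> {1..n}. lookup \<gamma> l = pairing i m l) \<and>
     (\<forall>l \<in> {1..n}. \<forall>r \<ge> 1. contraction n (x_annihilation l) pc r =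
        of_int (pairing i m l) * ((qq powi box_content i m l) ^ r / of_nat r)))"

lemma vstate_nonzero: "vstate n i m b \<Longrightarrow> \<not> vfield_zero n b"
  using is_vop_nonzero by (fastforce simp: vstate_def)

lemma vstate_Y_op:
  assumes i: "i \<in> {1..n}"
  shows "vstate n i (\<lambda>_. 0) (Y_op n i)"
  unfolding vstate_def
proof (intro exI conjI)
  show "is_vop n (Y_creation n i) (Y_annihilation n i) (fund_weight i)
    (\<lambda>\<beta>. lat_sign n (fund_weight i) \<beta> * qconst (exp (of_real pi * \<i> * of_rat (of_nat (if i = n then 0 else i) *
       wform n (fund_weight n) \<beta>)))) (Y_op n i)"
    by (rule Y_op_is_vop)
  show "\<forall>l \<in> {1..n}. \<forall>r \<ge> 1. contraction n (x_annihilation l) (Y_creation n i) r =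
        of_int (pairing i (\<lambda>_. 0) l) * ((qq powi box_content i (\<lambda>_. 0) l) ^ r / of_nat r)"
    using i by (auto simp: contraction_x_Y pairing_eq box_content_def)
qed (use i in \<open>auto simp: weight_lattice_fund lookup_fund_weight pairing_eq\<close>)

text \<open>The \<open>eps\<close> values at \<open>j\<close> and \<open>j + 1\<close> fix
  \<open>m l\<close> relative to \<open>m j\<close>: the difference is 0 when \<open>l\<close> is
  further from \<open>i\<close> than \<open>j\<close>, and 1 when it is nearer. In the second case
  the 2 outweighs the decrease of the distance.\<close>

lemma box_content_adjacent:
  assumes "admissible n i m" "pairing i m j = 1" "j \<in> {1..n}" "l \<in> {1..n}" "l = Suc j \<or> j = Suc l"
  shows "box_content i m l = box_content i m j + 1"
proof -
  have "eps i m j \<in> {0, 1}" "eps i m (Suc j) \<in> {0, 1}"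
    using assms by (auto simp: admissible_def)
  then have e: "eps i m j = 1" "eps i m (Suc j) = 0"
    using assms(2) by (auto simp: pairing_def)
  then show ?thesis using assms(5) by (auto simp: eps_def box_content_def split: if_splits)
qed

lemma qint_cartan_quotient:
  assumes r: "r \<ge> 1"
  shows "qint (cartan l j * int r) / qint (int r) =
    (if l = j then qq ^ r + inverse (qq ^ r) else if l = Suc j \<or> j = Suc l then - 1 else 0)"
proof -
  have "qint (2 * int r) = qint (int r) * (qq ^ r + inverse (qq ^ r))"
  proof -
    define x where "x = qq ^ r"
    define \<delta> where "\<delta> = qq - qq powi (- 1)"
    have nz: "x \<noteq> 0" "\<delta> \<noteq> 0" using qq_diff_nonzero by (simp_all add: x_def \<delta>_def)
    note q = qint_powers[OF x_def, folded \<delta>_def]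
    have "qint (2 * int r) = (x * x - inverse (x * x)) / \<delta>" using q[of "x * x" 2] by (simp add: power2_eq_square)
    moreover have "qint (int r) = (x - inverse x) / \<delta>" using q[of x 1] by simp
    ultimately show ?thesis using nz unfolding x_def[symmetric] by (simp only:) (simp add: field_simps)
  qed
  then show ?thesis using r by (auto simp: cartan_def qint_minus)
qed

lemma vstate_step:
  assumes m: "admissible n i m" and b: "vstate n i m b" and j: "j \<in> {1..n}" and pj: "pairing i m j = 1"
  shows "vstate n i (m(j := m j + 1)) (bullet n (x_minus n j) b)"
proof -
  obtain pc dc \<gamma> \<chi> where s: "is_vop n pc dc \<gamma> \<chi> b" "\<And>\<beta>. \<chi> \<beta> \<noteq> 0" "\<gamma> \<in> weight_lattice n"
    "\<And>l. l \<in> {1..n} \<Longrightarrow> lookup \<gamma> l = pairing i m l"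
    "\<And>l r. l \<in> {1..n} \<Longrightarrow> r \<ge> 1 \<Longrightarrow> contraction n (x_annihilation l) pc r =
        of_int (pairing i m l) * ((qq powi box_content i m l) ^ r / of_nat r)"
    using b unfolding vstate_def by blast
  define C where "C = box_content i m j"
  define c where "c = qh powi (2 * C)"
  have c: "c = qq powi C" by (simp add: c_def qq_powi)
  let ?m = "m(j := m j + 1)"
  have pl: "pairing i ?m l = pairing i m l - cartan l j" if "l \<in> {1..n}" for l
    using pairing_update[OF j that, of i m 1] by simp
  show ?thesis
    unfolding vstate_def
  proof (intro exI conjI ballI allI impI)
    show "is_vop n (\<lambda>r l. c ^ r * x_creation j r l + pc r l) (\<lambda>r l. inverse c ^ r * x_annihilation j r l + dc r l)
      (- simple_root n j + \<gamma>) (\<lambda>\<beta>. c * (lat_sign n (- simple_root n j) (\<gamma> + \<beta>) *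
       c powi \<lfloor>wform n (- simple_root n j) (\<gamma> + \<beta>)\<rfloor> * \<chi> \<beta>)) (bullet n (x_minus n j) b)"
      unfolding c_def by (rule bullet_is_vop[OF s(1-3) j s(4)[OF j]]) (use pj s(5)[OF j] C_def in auto)
    show "c * (lat_sign n (- simple_root n j) (\<gamma> + \<beta>) * c powi \<lfloor>wform n (- simple_root n j) (\<gamma> + \<beta>)\<rfloor> * \<chi> \<beta>) \<noteq> 0" for \<beta>
      by (simp add: c s(2))
    show "- simple_root n j + \<gamma> \<in> weight_lattice n"
      by (rule weight_lattice_add[OF weight_lattice_root s(3)])
    fix l assume l: "l \<in> {1..n}"
    show "lookup (- simple_root n j + \<gamma>) l = pairing i ?m l"
      using l by (simp only: lookup_add lookup_uminus lookup_simple_root s(4) pl cartan_sym[of l]) simp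
    fix r :: nat assume r: "r \<ge> 1"
    have "contraction n (x_annihilation l) (\<lambda>r a. c ^ r * x_creation j r a + pc r a) r =
      - (qq ^ r * c ^ r * qint (cartan l j * int r) / (qint (int r) * of_nat r)) +
      of_int (pairing i m l) * ((qq powi box_content i m l) ^ r / of_nat r)"
      by (simp only: contraction_add_right contraction_x_x[OF j l r] s(5)[OF l r])
    also have "qq ^ r * c ^ r * qint (cartan l j * int r) / (qint (int r) * of_nat r) =
      (qint (cartan l j * int r) / qint (int r)) * (qq ^ r * c ^ r / of_nat r)"
      by simp
    also have "- ((qint (cartan l j * int r) / qint (int r)) * (qq ^ r * c ^ r / of_nat r)) +
        of_int (pairing i m l) * ((qq powi box_content i m l) ^ r / of_nat r) =
      of_int (pairing i ?m l) * ((qq powi box_content i ?m l) ^ r / of_nat r)"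
    proof (cases "l = j")
      case True
      \<comment> \<open>The new factor is (1 - c x)(1 - q^2 c x) with c = q^C; its first part
        cancels the old pole and the second remains, at content C + 2.\<close>
      have "pairing i ?m l = - 1" using pl[OF l] pj True by (simp add: cartan_def)
      moreover have "box_content i ?m l = C + 2" using True by (simp add: box_content_def C_def)
      moreover have "(qq powi (C + 2)) ^ r = qq ^ r * qq ^ r * c ^ r"
        by (simp add: c power_int_add power2_eq_square power_mult_distrib)
      moreover have "qq ^ r * inverse (qq ^ r) = 1" by simp
      ultimately show ?thesis
        unfolding qint_cartan_quotient[OF r] using True pj
        by (simp add: C_def[symmetric] c[symmetric] distrib_right mult.assoc[symmetric] del: right_inverse)
           (simp add: field_simps add_divide_distrib)
    next
      case False
      have cont: "box_content i ?m l = box_content i m l" using False by (simp add: box_content_def)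
      show ?thesis
      proof (cases "l = Suc j \<or> j = Suc l")
        case True
        then have ca: "cartan l j = - 1" using False by (auto simp: cartan_def)
        \<comment> \<open>Old and new factor are powers of the same linear term, so their exponents
          simply add and the pairing rises by one.\<close>
        have "box_content i m l = C + 1" unfolding C_def by (rule box_content_adjacent[OF m pj j l True])
        then have "(qq powi box_content i m l) ^ r = qq ^ r * c ^ r"
          by (simp add: c power_int_add power_mult_distrib)
        then show ?thesis
          unfolding qint_cartan_quotient[OF r] cont pl[OF l] using True False ca
          by (simp add: distrib_right add.commute add_divide_distrib)
      next
        case nadj: False
        then have "cartan l j = 0" using False by (auto simp: cartan_def)
        then show ?thesis unfolding qint_cartan_quotient[OF r] cont pl[OF l] using False nadj by simp
      qed
    qed
    finally show "contraction n (x_annihilation l) (\<lambda>r a. c ^ r * x_creation j r a + pc r a) r =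
      of_int (pairing i ?m l) * ((qq powi box_content i ?m l) ^ r / of_nat r)" .
  qed
qed

lemma vstate_bullet_zero:
  assumes m: "admissible n i m" and b: "vstate n i m b" and j: "j \<in> {1..n}" and pj: "pairing i m j \<noteq> 1"
  shows "vfield_zero n (bullet n (x_minus n j) b)"
proof -
  obtain pc dc \<gamma> \<chi> where s: "is_vop n pc dc \<gamma> \<chi> b" "\<And>\<beta>. \<chi> \<beta> \<noteq> 0" "\<gamma> \<in> weight_lattice n"
    "lookup \<gamma> j = pairing i m j"
    "\<And>r. r \<ge> 1 \<Longrightarrow> contraction n (x_annihilation j) pc r =
        of_int (pairing i m j) * ((qq powi box_content i m j) ^ r / of_nat r)"
    using b j unfolding vstate_def by blast
  show ?thesis
    by (rule bullet_zero_field[OF s(1-3) j s(4) admissible_pairing[OF m j] s(5) pj])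
qed

lemma x_minus_Hom_laurent:
  assumes "j \<in> {1..n}" shows "x_minus n j \<in> Hom_laurent n 1"
  by (rule is_vop_Hom_laurent[OF x_minus_is_vop[OF assms] weight_lattice_root])
     (simp add: wform_minus_left wform_root[OF assms])

theorem lemma2p7:
  fixes n i :: nat and js :: "nat list"
    and scale :: "qf \<Rightarrow> 'v \<Rightarrow> 'v::ab_group_add"
    and e f K Kinv :: "nat \<Rightarrow> 'v \<Rightarrow> 'v" and v :: 'v
  assumes "n \<ge> 1" and "i \<in> {1..n}" and "set js \<subseteq> {1..n}"
    and "is_fund_module n i scale e f K Kinv v"
  shows "\<not> vfield_zero n (fold (\<lambda>j b. bullet n (x_minus n j) b) js (Y_op n i))
    \<longleftrightarrow> fold f js v \<noteq> 0"
proof -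
  interpret fund_module n i scale e f K Kinv v
    using assms by unfold_locales
  let ?B = "\<lambda>js b. fold (\<lambda>j b. bullet n (x_minus n j) b) js b"
  \<comment> \<open>Once both sides vanish they stay zero under all further factors.\<close>
  have zero: "vfield_zero n (?B js b) \<and> fold f js 0 = 0" if "vfield_zero n b" "set js \<subseteq> {1..n}" for js b
    using that
  proof (induction js arbitrary: b)
    case (Cons j js)
    have "vfield_zero n (bullet n (x_minus n j) b)"
      by (rule bullet_zero[OF x_minus_Hom_laurent]) (use Cons.prems in auto)
    then show ?case using Cons by (auto simp: op_zero)
  qed simp
  \<comment> \<open>Module vector and field share the same \<open>m\<close>, and at every step
    pairing 1 decides the survival of both.\<close>
  have "\<not> vfield_zero n (?B js b) \<longleftrightarrow> fold f js w \<noteq> 0"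
    if "pathvec N m w" "w \<noteq> 0" "vstate n i m b" "set js \<subseteq> {1..n}" for N m w b
    using that
  proof (induction js arbitrary: N m w b)
    case Nil
    then show ?case by (simp add: vstate_nonzero)
  next
    case (Cons j js)
    then have j: "j \<in> {1..n}" by simp
    note adm = pathvec_admissible[OF Cons.prems(1)]
    show ?case
    proof (cases "pairing i m j = 1")
      case True
      have "f j w \<noteq> 0" using pathvec_f_nonzero_iff[OF Cons.prems(1) j Cons.prems(2)] True by simp
      then show ?thesis
        using Cons.IH[OF pathvec_Suc[OF Cons.prems(1) j True] _ vstate_step[OF adm Cons.prems(3) j True]] Cons.prems(4)
        by simp
    next
      case False
      then have "f j w = 0" using pathvec_f_nonzero_iff[OF Cons.prems(1) j Cons.prems(2)] by blast
      then show ?thesis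
        using zero[OF vstate_bullet_zero[OF adm Cons.prems(3) j False]] Cons.prems(4) by simp
    qed
  qed
  moreover have "v \<noteq> 0" using fund by (simp add: is_fund_module_def)
  ultimately show ?thesis
    using pathvec_0 vstate_Y_op[OF assms(2)] assms(3) by blast
qed

end
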